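(* Fix $\beta, L>0$ and an integer $d\ge 1$. Assume that $m=m(n)$ satisfies $m=o(n)$. Then the minimax risk of coreset-based estimators satisfies $$\inf_{\hat f,\,|S|=m}\ \sup_{f\in\mathcal{P}_{\mathcal{H}}(\beta,L)}\mathbb{E}_f\,\|\hat f_S-f\|_2=\Theta_{\beta,d,L}\Big(n^{-\frac{\beta}{2\beta+d}}+(m\log n)^{-\frac{\beta}{d}}\Big),$$ where the infimum is over all coreset schemes $S$ of cardinality $m$ and all (permutation-invariant, measurable) estimators $\hat f:\mathbb{R}^{d\times m}\to L_2(\mathbb{R}^d)$.
   Context: Hölder densities: for $\beta>0$ let $\lfloor\beta\rfloor$ be the largest integer strictly less than $\beta$. $\mathcal{H}(\beta,L)$ is the set of $f:\mathbb{R}^d\to\mathbb{R}$ supported on $[-1/2,1/2]^d$, $\lfloor\beta\rfloor$ times differentiable, with $|D^sf(x)-D^sf(y)|\le L|x-y|_2^{\beta-\lfloor\beta\rfloor}$ for all $x,y\in\mathbb{R}^d$ and all multi-indices $s$ with $|s|_1=\lfloor\beta\rfloor$. $\mathcal{P}_{\mathcal{H}}(\beta,L)$ is the set of probability densities in $\mathcal{H}(\beta,L)$. For a density $f$, $\mathbb{E}_f$ is expectation when $X=(X_1,\dots,X_n)$ has i.i.d. coordinates with density $f$. $\|\cdot\|_2$ is the $L_2$ norm. Coreset-based estimators: a coreset scheme $S$ of cardinality $m$ is a conditional probability measure $S(\cdot|x)$ on the subsets of $[n]=\{1,\dots,n\}$ of size $m$, given $x\in\mathbb{R}^{d\times n}$;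 $S(X)$ denotes a sample from $S(\cdot|X)$, and the coreset is $X_S=\{X_i\}_{i\in S(X)}$. An estimator on $m$ observations is a measurable map $\hat f:\mathbb{R}^{d\times m}\to L_2(\mathbb{R}^d)$ with $\hat f[y_1,\dots,y_m]=\hat f[y_{\pi(1)},\dots,y_{\pi(m)}]$ for all $y_i$ and all bijections $\pi:[m]\to[m]$. The coreset-based estimator is $\hat f_S[X](\cdot)=\hat f[X_S](\cdot)$. $\Theta_{\beta,d,L}$ means bounded above and below, for large $n$, up to positive constants depending only on $\beta,d,L$.
   Formalization: The formal theorem assumes that P_H(β,L') is nonempty for some L'<L (for small L the class is empty, and at the smallest L it can be a single density with risk 0, so the claim fails), and that m(n)≥1 for large n. *)

theory Defs
  imports "HOL-Probability.Probability" "HOL-Library.Landau_Symbols"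
begin

subsection \<open>Hoelder densities\<close>

definition partial_deriv :: "'d::finite \<Rightarrow> (real ^ 'd \<Rightarrow> real) \<Rightarrow> real ^ 'd \<Rightarrow> real" where
  "partial_deriv i f x = deriv (\<lambda>t::real. f (x + t *\<^sub>R axis i 1)) 0"

fun times_differentiable :: "nat \<Rightarrow> (real ^ 'd::finite \<Rightarrow> real) \<Rightarrow> bool" where
  "times_differentiable 0 f \<longleftrightarrow> True"
| "times_differentiable (Suc k) f \<longleftrightarrow>
     (\<forall>x. f differentiable (at x)) \<and> (\<forall>i. times_differentiable k (partial_deriv i f))"

definition iter_partial :: "'d::finite list \<Rightarrow> (real ^ 'd \<Rightarrow> real) \<Rightarrow> real ^ 'd \<Rightarrow> real" where
  "iter_partial is f = foldr partial_deriv is f"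

text \<open>
  A multi-index is a function \<open>s :: 'd \<Rightarrow> nat\<close>.  The derivative \<open>D\<^sup>s f\<close> is obtained by
  differentiating successively along a list of coordinates containing each \<open>i\<close> exactly
  \<open>s i\<close> times.  The order is immaterial for a \<open>|s|\<close>-times differentiable function (Schwarz);
  \<open>mixed_partials s f\<close> collects the results of all orders, so that no order is singled out.
\<close>

definition mixed_partials ::
    "('d::finite \<Rightarrow> nat) \<Rightarrow> (real ^ 'd \<Rightarrow> real) \<Rightarrow> (real ^ 'd \<Rightarrow> real) set" where
  "mixed_partials s f = {iter_partial is f | is. \<forall>i. count_list is i = s i}"

text \<open>The largest integer strictly less than \<open>\<beta>\<close> (which differs from the floor at integers).\<close>

definition strict_floor :: "real \<Rightarrow> nat" where
  "strict_floor \<beta> = nat (\<lceil>\<beta>\<rceil> - 1)"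

definition holder_class :: "real \<Rightarrow> real \<Rightarrow> (real ^ 'd::finite \<Rightarrow> real) set" where
  "holder_class \<beta> L = {f.
     (\<forall>x. x \<notin> cbox (\<chi> i. - 1/2) (\<chi> i. 1/2) \<longrightarrow> f x = 0) \<and>
     times_differentiable (strict_floor \<beta>) f \<and>
     (\<forall>s. (\<Sum>i\<in>UNIV. s i) = strict_floor \<beta> \<longrightarrow>
        (\<forall>g\<in>mixed_partials s f. \<forall>x y.
           \<bar>g x - g y\<bar> \<le> L * norm (x - y) powr (\<beta> - real (strict_floor \<beta>))))}"

text \<open>
  For small \<open>L\<close> the following class is empty: e.g. for \<open>\<beta> \<le> 1\<close> every point of the cube has
  distance at most 1/2 from the zero set of \<open>f\<close>, so \<open>f \<le> L / 2 powr \<beta>\<close>, and \<open>f\<close> cannot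
  integrate to 1 when \<open>L < 2 powr \<beta>\<close>.  At the smallest \<open>L\<close> for which it is nonempty it may
  consist of a single function.
\<close>

definition holder_densities :: "real \<Rightarrow> real \<Rightarrow> (real ^ 'd::finite \<Rightarrow> real) set" where
  "holder_densities \<beta> L =
     {f \<in> holder_class \<beta> L. (\<forall>x. 0 \<le> f x) \<and> has_bochner_integral lborel f 1}"


subsection \<open>The space \<open>L\<^sub>2\<close>\<close>

text \<open>
  Elements of \<open>L\<^sub>2\<close> are represented by square-integrable functions, and equality in \<open>L\<^sub>2\<close> is
  equality almost everywhere.  Sets that are open for the \<open>L\<^sub>2\<close> seminorm are closed under
  almost-everywhere equality, so measurability into \<open>L2_borel\<close> is Borel measurability
  into the quotient.
\<close>

definition L2_space :: "('a::euclidean_space \<Rightarrow> real) set" where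
  "L2_space = {g \<in> borel_measurable lborel. integrable lborel (\<lambda>x. (g x)\<^sup>2)}"

definition L2_norm :: "('a::euclidean_space \<Rightarrow> real) \<Rightarrow> real" where
  "L2_norm g = sqrt (\<integral>x. (g x)\<^sup>2 \<partial>lborel)"

definition L2_open :: "('a::euclidean_space \<Rightarrow> real) set \<Rightarrow> bool" where
  "L2_open U \<longleftrightarrow> U \<subseteq> L2_space \<and>
     (\<forall>g\<in>U. \<exists>e>0. \<forall>h\<in>L2_space. L2_norm (\<lambda>x. h x - g x) < e \<longrightarrow> h \<in> U)"

definition L2_borel :: "('a::euclidean_space \<Rightarrow> real) measure" where
  "L2_borel = sigma L2_space {U. L2_open U}"


subsection \<open>Coreset-based estimators\<close>

text \<open>
  A data set of \<open>n\<close> points is an element of the product space over the index set \<open>{1..n}\<close>.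
\<close>

definition coreset_schemes ::
    "nat \<Rightarrow> nat \<Rightarrow> ((nat \<Rightarrow> real ^ 'd::finite) \<Rightarrow> nat set measure) set" where
  "coreset_schemes n m =
     measurable (PiM {1..n} (\<lambda>_. borel))
       (prob_algebra (count_space {A. A \<subseteq> {1..n} \<and> card A = m}))"

definition estimators ::
    "nat \<Rightarrow> ((nat \<Rightarrow> real ^ 'd::finite) \<Rightarrow> (real ^ 'd \<Rightarrow> real)) set" where
  "estimators m =
     {fhat \<in> measurable (PiM {1..m} (\<lambda>_. borel)) L2_borel.
        \<forall>y \<in> space (PiM {1..m} (\<lambda>_. borel)). \<forall>\<pi>. bij_betw \<pi> {1..m} {1..m} \<longrightarrow>
          (AE z in lborel. fhat (\<lambda>j\<in>{1..m}. y (\<pi> j)) z = fhat y z)}"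

text \<open>
  The points \<open>x i\<close> with \<open>i \<in> A\<close>, listed by increasing \<open>i\<close>; by permutation invariance of
  estimators the choice of the listing does not matter.
\<close>

definition coreset_points :: "(nat \<Rightarrow> 'a) \<Rightarrow> nat set \<Rightarrow> nat \<Rightarrow> 'a" where
  "coreset_points x A = (\<lambda>j\<in>{1..card A}. x (sorted_list_of_set A ! (j - 1)))"

definition coreset_risk ::
    "nat \<Rightarrow> ((nat \<Rightarrow> real ^ 'd::finite) \<Rightarrow> (real ^ 'd \<Rightarrow> real))
      \<Rightarrow> ((nat \<Rightarrow> real ^ 'd) \<Rightarrow> nat set measure) \<Rightarrow> (real ^ 'd \<Rightarrow> real) \<Rightarrow> ennreal" where
  "coreset_risk n fhat S f =
     (\<integral>\<^sup>+ x. (\<integral>\<^sup>+ A. ennreal (L2_norm (\<lambda>z. fhat (coreset_points x A) z - f z)) \<partial>S x)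
        \<partial>(PiM {1..n} (\<lambda>_. density lborel (\<lambda>z. ennreal (f z)))))"

definition coreset_minimax_risk ::
    "'d::finite itself \<Rightarrow> real \<Rightarrow> real \<Rightarrow> nat \<Rightarrow> nat \<Rightarrow> ennreal" where
  "coreset_minimax_risk _ \<beta> L n m =
     (INF (fhat, S) \<in> estimators m \<times> coreset_schemes n m.
        SUP f \<in> (holder_densities \<beta> L :: (real ^ 'd \<Rightarrow> real) set). coreset_risk n fhat S f)"

end

theory Submission
  imports Defs "HOL-Real_Asymp.Real_Asymp"
begin

text \<open>
  Upper bound.  Members of the class are approximated by piecewise Taylor polynomials on a grid of
  mesh \<open>h\<close> with error \<open>h powr \<beta>\<close>.  For \<open>h\<close> of order \<open>n powr (- 1 / (2 * \<beta> + d))\<close> the projection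
  estimator attains the full-data rate.  The same approximation, applied at successive dyadic scales,
  yields nets of radius \<open>\<epsilon>\<close> and log-cardinality of order \<open>\<epsilon> powr (- d / \<beta>)\<close>.  The coreset does not
  summarize the data: it spells out the index of the member of a net nearest to the projection
  estimator.  Each point carries a label (a residue of a very fine discretization of one coordinate)
  that is nearly uniform over about \<open>n / ln n\<close> values under every density of the class, so among \<open>n\<close>
  points every label occurs, and a choice of \<open>m\<close> of them transmits of order \<open>m * ln n\<close> bits.

  Lower bound.  Perturb a density \<open>f0\<close> on a cube where it is bounded below by the sums of bumps over
  the subsets \<open>\<theta>\<close> of a grid of \<open>D\<close> cells.  An estimate can be close to \<open>f \<theta>\<close> only for the \<open>\<theta>\<close> in a
  Hamming ball, an exponentially small fraction of all \<open>2 ^ D\<close>.  If the likelihood ratios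
  of all \<open>n\<close> points have second moment \<open>exp (D / 10)\<close>, no estimator succeeds for the average \<open>\<theta>\<close>;
  this gives \<open>n powr (- \<beta> / (2 * \<beta> + d))\<close>.  For fixed indices, the likelihood ratio of \<open>m\<close> points is at
  most \<open>2 ^ m\<close>; a union bound over the \<open>n choose m\<close> possible coresets still leaves success exponentially
  unlikely when \<open>D\<close> is a large multiple of \<open>m * ln n\<close>, which gives \<open>(m * ln n) powr (- \<beta> / d)\<close>.
\<close>

subsection \<open>The space \<open>L\<^sub>2\<close>\<close>

text \<open>The kept points may be chosen with the whole sample in view, so their positions can
  carry a much longer message than m observations seem to allow; the upper bound exploits this, and
  the lower bound must allow for it. Only labels below \<open>T'\<close> carry the message, with
  \<open>T' / T\<close> tending to 0: then few sample points have such a label, and the coreset can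
  be filled to size m with points that the decoder ignores. A message of more than n powr (d / (2 *
  \<beta> + d)) points would gain nothing, because the full-data rate is already reached; capping
  the length there keeps \<open>T'\<close> larger than it by a power of n, so that each point is
  worth a constant multiple of ln n nats. If a label is missing, the loss is still bounded, and this
  is rare enough not to matter. In the lower bound the kept points are not i.i.d., since their
  choice depends on all the data. Instead of conditioning on the choice, the success probabilities
  of all hypotheses are summed and moved to the single density \<open>f0\<close>. The bumps use up
  the gap between the Hoelder constants L' and L, which is why \<open>f0\<close> must have a smaller
  constant than the class.\<close>

definition ip :: "('a::euclidean_space \<Rightarrow> real) \<Rightarrow> ('a \<Rightarrow> real) \<Rightarrow> real" where
  "ip f g = (\<integral>x. f x * g x \<partial>lborel)"

lemma L2_integrable_mult:
  assumes "f \<in> L2_space" "g \<in> L2_space"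
  shows "integrable lborel (\<lambda>x. f x * g x)"
proof (rule Bochner_Integration.integrable_bound)
  show "integrable lborel (\<lambda>x. (f x)\<^sup>2 + (g x)\<^sup>2)"
    using assms by (auto simp: L2_space_def)
  show "(\<lambda>x. f x * g x) \<in> borel_measurable lborel"
    using assms by (auto simp: L2_space_def)
  have "\<bar>a * b\<bar> \<le> \<bar>a\<^sup>2 + b\<^sup>2\<bar>" for a b :: real
  proof -
    have "0 \<le> (\<bar>a\<bar> - \<bar>b\<bar>)\<^sup>2" by simp
    then have "2 * (\<bar>a\<bar> * \<bar>b\<bar>) \<le> a\<^sup>2 + b\<^sup>2" by (simp add: power2_diff)
    moreover have "0 \<le> \<bar>a\<bar> * \<bar>b\<bar>" by simp
    ultimately show ?thesis unfolding abs_mult by linarith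
  qed
  then show "AE x in lborel. norm (f x * g x) \<le> norm ((f x)\<^sup>2 + (g x)\<^sup>2)"
    by simp
qed

lemma L2_measurable: "f \<in> L2_space \<Longrightarrow> f \<in> borel_measurable borel"
  by (simp add: L2_space_def)

lemma L2_zero: "(\<lambda>x. 0) \<in> L2_space"
  by (simp add: L2_space_def)

lemma L2_cmult: "f \<in> L2_space \<Longrightarrow> (\<lambda>x. c * f x) \<in> L2_space"
  by (auto simp: L2_space_def power_mult_distrib)

lemma L2_add:
  assumes "f \<in> L2_space" "g \<in> L2_space"
  shows "(\<lambda>x. f x + g x) \<in> L2_space"
  using assms L2_integrable_mult[OF assms]
  by (auto simp: L2_space_def power2_sum mult.assoc)

lemma L2_diff:
  assumes "f \<in> L2_space" "g \<in> L2_space"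
  shows "(\<lambda>x. f x - g x) \<in> L2_space"
  using L2_add[OF assms(1) L2_cmult[OF assms(2), of "-1"]] by simp

lemma L2_sum: "(\<And>i. i \<in> I \<Longrightarrow> f i \<in> L2_space) \<Longrightarrow> (\<lambda>x. \<Sum>i\<in>I. f i x) \<in> L2_space"
  by (induction I rule: infinite_finite_induct) (auto intro: L2_zero L2_add)

lemma ip_commute: "ip f g = ip g f"
  by (simp add: ip_def mult.commute)

lemma ip_add_left:
  assumes "f \<in> L2_space" "g \<in> L2_space" "h \<in> L2_space"
  shows "ip (\<lambda>x. f x + g x) h = ip f h + ip g h"
  using L2_integrable_mult[OF assms(1,3)] L2_integrable_mult[OF assms(2,3)]
  by (simp add: ip_def distrib_right)

lemma ip_cmult_left: "ip (\<lambda>x. c * f x) h = c * ip f h"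
  by (simp add: ip_def mult.assoc)

lemma ip_diff_left:
  assumes "f \<in> L2_space" "g \<in> L2_space" "h \<in> L2_space"
  shows "ip (\<lambda>x. f x - g x) h = ip f h - ip g h"
  using L2_integrable_mult[OF assms(1,3)] L2_integrable_mult[OF assms(2,3)]
  by (simp add: ip_def left_diff_distrib)

lemma ip_sum_left:
  assumes "\<And>i. i \<in> I \<Longrightarrow> f i \<in> L2_space" "h \<in> L2_space"
  shows "ip (\<lambda>x. \<Sum>i\<in>I. f i x) h = (\<Sum>i\<in>I. ip (f i) h)"
  using assms L2_integrable_mult[OF _ assms(2)]
  by (simp add: ip_def sum_distrib_right)

lemma ip_self_nonneg: "0 \<le> ip f f"
  by (simp add: ip_def)

lemma L2_norm_power2: "(L2_norm f)\<^sup>2 = ip f f"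
  by (simp add: L2_norm_def ip_def power2_eq_square)

lemma L2_norm_nonneg [simp]: "0 \<le> L2_norm f"
  by (simp add: L2_norm_def)

lemma L2_norm_minus_commute: "L2_norm (\<lambda>x. f x - g x) = L2_norm (\<lambda>x. g x - f x)"
  by (simp add: L2_norm_def power2_commute)

lemma L2_norm_cmult: "L2_norm (\<lambda>x. c * f x) = \<bar>c\<bar> * L2_norm f"
  by (simp add: L2_norm_def power_mult_distrib real_sqrt_mult)

lemma L2_norm_zero [simp]: "L2_norm (\<lambda>x. 0) = 0"
  by (simp add: L2_norm_def)

lemma ip_diff_self:
  assumes "f \<in> L2_space" "g \<in> L2_space"
  shows "ip (\<lambda>x. f x - g x) (\<lambda>x. f x - g x) = ip f f - 2 * ip f g + ip g g"
proof -
  have d: "(\<lambda>x. f x - g x) \<in> L2_space" by (rule L2_diff[OF assms])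
  show ?thesis
    using assms d ip_commute[of f "\<lambda>x. f x - g x"] ip_commute[of g "\<lambda>x. f x - g x"]
      ip_commute[of g f]
    by (simp add: ip_diff_left)
qed

lemma ip_add_self:
  assumes "f \<in> L2_space" "g \<in> L2_space"
  shows "ip (\<lambda>x. f x + g x) (\<lambda>x. f x + g x) = ip f f + 2 * ip f g + ip g g"
proof -
  have d: "(\<lambda>x. f x + g x) \<in> L2_space" by (rule L2_add[OF assms])
  show ?thesis
    using assms d ip_commute[of f "\<lambda>x. f x + g x"] ip_commute[of g "\<lambda>x. f x + g x"]
      ip_commute[of g f]
    by (simp add: ip_add_left)
qed

lemma ip_Cauchy_Schwarz:
  assumes f: "f \<in> L2_space" and g: "g \<in> L2_space"
  shows "\<bar>ip f g\<bar> \<le> L2_norm f * L2_norm g"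
proof -
  have q: "0 \<le> ip f f - 2 * (t * ip f g) + t\<^sup>2 * ip g g" for t
  proof -
    have "0 \<le> ip (\<lambda>x. f x - t * g x) (\<lambda>x. f x - t * g x)" by (rule ip_self_nonneg)
    also have "\<dots> = ip f f - 2 * ip f (\<lambda>x. t * g x) + ip (\<lambda>x. t * g x) (\<lambda>x. t * g x)"
      by (rule ip_diff_self[OF f L2_cmult[OF g]])
    also have "ip f (\<lambda>x. t * g x) = t * ip f g"
      by (metis ip_commute ip_cmult_left)
    also have "ip (\<lambda>x. t * g x) (\<lambda>x. t * g x) = t\<^sup>2 * ip g g"
      by (metis ip_commute ip_cmult_left power2_eq_square mult.assoc)
    finally show ?thesis .
  qed
  have "(ip f g)\<^sup>2 \<le> ip f f * ip g g"
  proof (cases "ip g g = 0")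
    case True
    have "ip f g = 0"
    proof (rule ccontr)
      assume n: "ip f g \<noteq> 0"
      \<comment> \<open>With \<open>ip g g = 0\<close> the quadratic \<open>q\<close> is linear in
        t; at this t it equals -1.\<close>
      show False using q[of "(ip f f + 1) / (2 * ip f g)"] n True by (simp add: field_simps)
    qed
    then show ?thesis using True by simp
  next
    case False
    then have p: "ip g g > 0" using ip_self_nonneg[of g] by linarith
    \<comment> \<open>The minimizer of the quadratic in t.\<close>
    show ?thesis using q[of "ip f g / ip g g"] p
      by (simp add: field_simps power2_eq_square)
  qed
  then have "(ip f g)\<^sup>2 \<le> (L2_norm f * L2_norm g)\<^sup>2"
    by (simp add: power_mult_distrib L2_norm_power2)
  then show ?thesis using abs_le_square_iff[of "ip f g" "L2_norm f * L2_norm g"] by simp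
qed

lemma L2_norm_triangle:
  assumes f: "f \<in> L2_space" and g: "g \<in> L2_space"
  shows "L2_norm (\<lambda>x. f x + g x) \<le> L2_norm f + L2_norm g"
proof (rule power2_le_imp_le)
  have "(L2_norm (\<lambda>x. f x + g x))\<^sup>2 = ip f f + 2 * ip f g + ip g g"
    by (simp only: L2_norm_power2 ip_add_self[OF assms])
  also have "\<dots> \<le> ip f f + 2 * (L2_norm f * L2_norm g) + ip g g"
    using ip_Cauchy_Schwarz[OF assms] by linarith
  also have "\<dots> = (L2_norm f + L2_norm g)\<^sup>2"
    by (simp add: power2_sum L2_norm_power2)
  finally show "(L2_norm (\<lambda>x. f x + g x))\<^sup>2 \<le> (L2_norm f + L2_norm g)\<^sup>2" .
qed simp

lemma L2_norm_diff_triangle: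
  assumes "f \<in> L2_space" "g \<in> L2_space" "h \<in> L2_space"
  shows "L2_norm (\<lambda>x. f x - h x) \<le> L2_norm (\<lambda>x. f x - g x) + L2_norm (\<lambda>x. g x - h x)"
  using L2_norm_triangle[OF L2_diff[OF assms(1,2)] L2_diff[OF assms(2,3)]] by simp

lemma L2_norm_sum_le:
  assumes "\<And>i. i \<in> I \<Longrightarrow> f i \<in> L2_space"
  shows "L2_norm (\<lambda>x. \<Sum>i\<in>I. f i x) \<le> (\<Sum>i\<in>I. L2_norm (f i))"
  using assms
proof (induction I rule: infinite_finite_induct)
  case (insert i I)
  have "L2_norm (\<lambda>x. f i x + (\<Sum>i\<in>I. f i x)) \<le> L2_norm (f i) + L2_norm (\<lambda>x. \<Sum>i\<in>I. f i x)"
    by (intro L2_norm_triangle L2_sum) (use insert in auto)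
  then show ?case using insert by fastforce
qed auto

subsection \<open>Orthonormal families\<close>

definition orthonormal :: "(nat \<Rightarrow> 'a::euclidean_space \<Rightarrow> real) \<Rightarrow> nat \<Rightarrow> bool" where
  "orthonormal \<phi> r \<longleftrightarrow> (\<forall>i<r. \<phi> i \<in> L2_space) \<and>
     (\<forall>i<r. \<forall>j<r. ip (\<phi> i) (\<phi> j) = (if i = j then 1 else 0))"

definition comb :: "(nat \<Rightarrow> 'a \<Rightarrow> real) \<Rightarrow> nat \<Rightarrow> (nat \<Rightarrow> real) \<Rightarrow> 'a \<Rightarrow> real" where
  "comb \<phi> r a = (\<lambda>x. \<Sum>i<r. a i * \<phi> i x)"

definition proj :: "(nat \<Rightarrow> 'a::euclidean_space \<Rightarrow> real) \<Rightarrow> nat \<Rightarrow> ('a \<Rightarrow> real) \<Rightarrow> 'a \<Rightarrow> real" where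
  "proj \<phi> r f = comb \<phi> r (\<lambda>i. ip f (\<phi> i))"

lemma L2_comb: "(\<And>i. i < r \<Longrightarrow> \<phi> i \<in> L2_space) \<Longrightarrow> comb \<phi> r a \<in> L2_space"
  unfolding comb_def by (intro L2_sum L2_cmult) auto

lemma orthonormal_L2: "orthonormal \<phi> r \<Longrightarrow> i < r \<Longrightarrow> \<phi> i \<in> L2_space"
  by (simp add: orthonormal_def)

lemma L2_proj: "orthonormal \<phi> r \<Longrightarrow> proj \<phi> r f \<in> L2_space"
  unfolding proj_def by (intro L2_comb) (auto simp: orthonormal_L2)

lemma ip_comb_left:
  assumes "\<And>i. i < r \<Longrightarrow> \<phi> i \<in> L2_space" "g \<in> L2_space"
  shows "ip (comb \<phi> r a) g = (\<Sum>i<r. a i * ip (\<phi> i) g)"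
  unfolding comb_def using assms
  by (subst ip_sum_left) (auto simp: ip_cmult_left intro!: L2_cmult)

lemma ip_comb_orthonormal:
  assumes o: "orthonormal \<phi> r" and "j < r"
  shows "ip (comb \<phi> r a) (\<phi> j) = a j"
proof -
  have "ip (comb \<phi> r a) (\<phi> j) = (\<Sum>i<r. a i * ip (\<phi> i) (\<phi> j))"
    using assms by (intro ip_comb_left) (auto simp: orthonormal_def)
  also have "\<dots> = (\<Sum>i<r. if i = j then a i else 0)"
    using assms by (intro sum.cong) (auto simp: orthonormal_def)
  finally show ?thesis using \<open>j < r\<close> by simp
qed

lemma comb_norm_power2:
  assumes o: "orthonormal \<phi> r"
  shows "(L2_norm (comb \<phi> r a))\<^sup>2 = (\<Sum>i<r. (a i)\<^sup>2)"
proof -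
  have "ip (comb \<phi> r a) (comb \<phi> r a) = (\<Sum>i<r. a i * ip (\<phi> i) (comb \<phi> r a))"
    using o by (intro ip_comb_left L2_comb) (auto simp: orthonormal_L2)
  also have "\<dots> = (\<Sum>i<r. a i * a i)"
    by (intro sum.cong refl) (simp add: ip_commute[of _ "comb \<phi> r a"] ip_comb_orthonormal[OF o])
  finally show ?thesis unfolding L2_norm_power2 by (simp add: power2_eq_square)
qed

lemma comb_diff: "comb \<phi> r a x - comb \<phi> r b x = comb \<phi> r (\<lambda>i. a i - b i) x"
  by (simp add: comb_def sum_subtractf left_diff_distrib)

text \<open>The residual of the projection is orthogonal to the span, so the cross term vanishes.
  Best approximation, Bessel's inequality and the separation of bias from rounding error in
  \<open>refine_net\<close> are all read off from this identity.\<close>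

lemma comb_pythagoras:
  assumes o: "orthonormal \<phi> r" and f: "f \<in> L2_space"
  shows "(L2_norm (\<lambda>x. f x - comb \<phi> r a x))\<^sup>2 =
    (L2_norm (\<lambda>x. f x - proj \<phi> r f x))\<^sup>2 + (\<Sum>i<r. (ip f (\<phi> i) - a i)\<^sup>2)"
proof -
  let ?c = "comb \<phi> r (\<lambda>i. ip f (\<phi> i) - a i)"
  let ?e = "\<lambda>x. f x - proj \<phi> r f x"
  have c: "?c \<in> L2_space" using o by (intro L2_comb) (auto simp: orthonormal_L2)
  have e: "?e \<in> L2_space" by (intro L2_diff f L2_proj[OF o])
  have z: "ip ?e (\<phi> i) = 0" if "i < r" for i
  proof -
    have "ip ?e (\<phi> i) = ip f (\<phi> i) - ip (proj \<phi> r f) (\<phi> i)"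
      by (intro ip_diff_left f L2_proj[OF o] orthonormal_L2[OF o that])
    then show ?thesis using ip_comb_orthonormal[OF o that] by (simp add: proj_def)
  qed
  have "ip ?c ?e = (\<Sum>i<r. (ip f (\<phi> i) - a i) * ip (\<phi> i) ?e)"
    by (intro ip_comb_left e orthonormal_L2[OF o])
  then have ce: "ip ?e ?c = 0"
    using z by (simp add: ip_commute[of _ ?e])
  have "(\<lambda>x. f x - comb \<phi> r a x) = (\<lambda>x. ?e x + ?c x)"
    by (auto simp: proj_def comb_diff[symmetric])
  then have "(L2_norm (\<lambda>x. f x - comb \<phi> r a x))\<^sup>2 = ip ?e ?e + 2 * ip ?e ?c + ip ?c ?c"
    by (simp only: L2_norm_power2 ip_add_self[OF e c])
  then show ?thesis
    using ce comb_norm_power2[OF o, of "\<lambda>i. ip f (\<phi> i) - a i"] by (simp add: L2_norm_power2)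
qed

lemma proj_minimal:
  assumes o: "orthonormal \<phi> r" and f: "f \<in> L2_space"
  shows "L2_norm (\<lambda>x. f x - proj \<phi> r f x) \<le> L2_norm (\<lambda>x. f x - comb \<phi> r a x)"
proof (rule power2_le_imp_le)
  show "(L2_norm (\<lambda>x. f x - proj \<phi> r f x))\<^sup>2 \<le> (L2_norm (\<lambda>x. f x - comb \<phi> r a x))\<^sup>2"
    unfolding comb_pythagoras[OF o f, of a] by (simp add: sum_nonneg)
qed simp

lemma bessel:
  assumes o: "orthonormal \<phi> r" and f: "f \<in> L2_space"
  shows "(\<Sum>i<r. (ip f (\<phi> i))\<^sup>2) \<le> (L2_norm f)\<^sup>2"
  using comb_pythagoras[OF o f, of "\<lambda>_. 0"] by (simp add: comb_def)

text \<open>Linearly dependent members are skipped, so \<open>r\<close> may be smaller than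
  \<open>n\<close>. Membership in the span makes sense only up to null sets; a vanishing projection
  error expresses it without naming coefficients.\<close>

lemma gram_schmidt:
  fixes \<psi> :: "nat \<Rightarrow> 'a::euclidean_space \<Rightarrow> real"
  assumes "\<And>i. i < n \<Longrightarrow> \<psi> i \<in> L2_space"
  shows "\<exists>\<phi> r. r \<le> n \<and> orthonormal \<phi> r \<and>
    (\<forall>i<n. L2_norm (\<lambda>x. \<psi> i x - proj \<phi> r (\<psi> i) x) = 0)"
  using assms
proof (induction n)
  case 0
  then show ?case by (intro exI[of _ "\<lambda>_ _. 0"] exI[of _ 0]) (auto simp: orthonormal_def)
next
  case (Suc n)
  obtain \<phi> r where r: "r \<le> n" and o: "orthonormal \<phi> r"
    and z: "\<And>i. i < n \<Longrightarrow> L2_norm (\<lambda>x. \<psi> i x - proj \<phi> r (\<psi> i) x) = 0"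
    using Suc by (metis less_Suc_eq)
  have p: "\<psi> n \<in> L2_space" using Suc.prems by simp
  let ?e = "\<lambda>x. \<psi> n x - proj \<phi> r (\<psi> n) x"
  have e: "?e \<in> L2_space" by (intro L2_diff p L2_proj[OF o])
  show ?case
  proof (cases "L2_norm ?e = 0")
    case True
    then show ?thesis using r o z by (metis le_Suc_eq less_Suc_eq)
  next
    case False
    then have pos: "L2_norm ?e > 0" using L2_norm_nonneg[of ?e] by linarith
    define \<phi>' where "\<phi>' = \<phi>(r := \<lambda>x. (1 / L2_norm ?e) * ?e x)"
    have orth: "ip ?e (\<phi> i) = 0" if "i < r" for i
    proof -
      have "ip ?e (\<phi> i) = ip (\<psi> n) (\<phi> i) - ip (proj \<phi> r (\<psi> n)) (\<phi> i)"
        by (intro ip_diff_left p L2_proj[OF o] orthonormal_L2[OF o that])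
      then show ?thesis using ip_comb_orthonormal[OF o that] by (simp add: proj_def)
    qed
    have n1: "ip (\<phi>' r) (\<phi>' r) = 1"
    proof -
      have "ip (\<phi>' r) (\<phi>' r) = (L2_norm (\<phi>' r))\<^sup>2" by (simp add: L2_norm_power2)
      also have "L2_norm (\<phi>' r) = 1" using pos unfolding \<phi>'_def fun_upd_same L2_norm_cmult by simp
      finally show ?thesis by simp
    qed
    have o': "orthonormal \<phi>' (Suc r)"
      unfolding orthonormal_def
    proof (intro conjI allI impI)
      fix i assume "i < Suc r"
      then show "\<phi>' i \<in> L2_space"
        using orthonormal_L2[OF o, of i] L2_cmult[OF e, of "1 / L2_norm ?e"]
        by (cases "i = r") (simp_all add: \<phi>'_def)
    next
      fix i j assume ij: "i < Suc r" "j < Suc r"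
      have m: "ip (\<phi>' r) (\<phi>' k) = 0" if "k < r" for k
        using orth[OF that] that unfolding \<phi>'_def by (simp add: ip_cmult_left del: times_divide_eq_left)
      have m': "ip (\<phi>' k) (\<phi>' r) = 0" if "k < r" for k
        using m[OF that] ip_commute by metis
      show "ip (\<phi>' i) (\<phi>' j) = (if i = j then 1 else 0)"
        using ij o n1 m m' by (auto simp: less_Suc_eq) (auto simp: \<phi>'_def orthonormal_def)
    qed
    have "L2_norm (\<lambda>x. \<psi> i x - proj \<phi>' (Suc r) (\<psi> i) x) = 0" if i: "i < Suc n" for i
    proof -
      \<comment> \<open>By \<open>proj_minimal\<close> any combination with zero error will do. For
        the new function it is the old projection plus the normalized residual times its
        length.\<close>
      define a where "a = (\<lambda>j. if j < r then ip (\<psi> i) (\<phi> j) else if i = n then L2_norm ?e else 0)"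
      have "comb \<phi>' (Suc r) a x = proj \<phi> r (\<psi> i) x + a r * \<phi>' r x" for x
        by (simp add: comb_def proj_def a_def \<phi>'_def)
      moreover have "a r * \<phi>' r x = (if i = n then ?e x else 0)" for x
        using pos by (simp add: a_def \<phi>'_def)
      ultimately have "L2_norm (\<lambda>x. \<psi> i x - comb \<phi>' (Suc r) a x) = 0"
        using z[of i] i by (cases "i = n") auto
      moreover have "L2_norm (\<lambda>x. \<psi> i x - proj \<phi>' (Suc r) (\<psi> i) x) \<le>
          L2_norm (\<lambda>x. \<psi> i x - comb \<phi>' (Suc r) a x)"
        by (intro proj_minimal o' Suc.prems i)
      ultimately show ?thesis using L2_norm_nonneg by (metis order_antisym)
    qed
    then show ?thesis using o' r by (intro exI[of _ \<phi>'] exI[of _ "Suc r"]) auto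
  qed
qed

text \<open>The approximating functions that come with an explicit rate, the localized monomials,
  are not orthonormal. Passing to an orthonormal family of no larger size preserves every error
  bound and makes rounding and empirical coefficients easy to control.\<close>

lemma orthonormal_spanning:
  fixes \<psi> :: "'b \<Rightarrow> 'a::euclidean_space \<Rightarrow> real"
  assumes fin: "finite I" and L: "\<And>i. i \<in> I \<Longrightarrow> \<psi> i \<in> L2_space"
  shows "\<exists>\<phi> r. r \<le> card I \<and> orthonormal \<phi> r \<and>
    (\<forall>f a. f \<in> L2_space \<longrightarrow>
      L2_norm (\<lambda>x. f x - proj \<phi> r f x) \<le> L2_norm (\<lambda>x. f x - (\<Sum>i\<in>I. a i * \<psi> i x)))"
proof -
  obtain h where h: "bij_betw h {..<card I} I"
    using ex_bij_betw_nat_finite[OF fin] by (metis atLeast0LessThan)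
  then have hI: "h i \<in> I" if "i < card I" for i using that by (auto simp: bij_betw_def)
  obtain \<phi> r where r: "r \<le> card I" and o: "orthonormal \<phi> r"
    and z: "\<And>i. i < card I \<Longrightarrow> L2_norm (\<lambda>x. \<psi> (h i) x - proj \<phi> r (\<psi> (h i)) x) = 0"
    using gram_schmidt[of "card I" "\<lambda>i. \<psi> (h i)"] L hI by blast
  have zI: "L2_norm (\<lambda>x. \<psi> i x - proj \<phi> r (\<psi> i) x) = 0" if "i \<in> I" for i
  proof -
    have "i \<in> h ` {..<card I}" using h that by (simp add: bij_betw_def)
    then obtain k where "k < card I" "h k = i" by auto
    then show ?thesis using z by blast
  qed
  have "L2_norm (\<lambda>x. f x - proj \<phi> r f x) \<le> L2_norm (\<lambda>x. f x - (\<Sum>i\<in>I. a i * \<psi> i x))"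
    if f: "f \<in> L2_space" for f a
  proof -
    define b where "b = (\<lambda>k. \<Sum>i\<in>I. a i * ip (\<psi> i) (\<phi> k))"
    have c: "comb \<phi> r b x = (\<Sum>i\<in>I. a i * proj \<phi> r (\<psi> i) x)" for x
      unfolding comb_def b_def proj_def sum_distrib_left sum_distrib_right
      by (subst sum.swap) (simp add: mult.assoc)
    have s: "(\<lambda>x. \<Sum>i\<in>I. a i * \<psi> i x) \<in> L2_space" by (intro L2_sum L2_cmult L)
    have cb: "comb \<phi> r b \<in> L2_space" using o by (intro L2_comb) (auto simp: orthonormal_L2)
    have "L2_norm (\<lambda>x. f x - proj \<phi> r f x) \<le> L2_norm (\<lambda>x. f x - comb \<phi> r b x)"
      by (rule proj_minimal[OF o f])
    also have "\<dots> \<le> L2_norm (\<lambda>x. f x - (\<Sum>i\<in>I. a i * \<psi> i x))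
        + L2_norm (\<lambda>x. (\<Sum>i\<in>I. a i * \<psi> i x) - comb \<phi> r b x)"
      by (rule L2_norm_diff_triangle[OF f s cb])
    also have "(\<lambda>x. (\<Sum>i\<in>I. a i * \<psi> i x) - comb \<phi> r b x)
        = (\<lambda>x. \<Sum>i\<in>I. a i * (\<psi> i x - proj \<phi> r (\<psi> i) x))"
      by (simp add: c sum_subtractf right_diff_distrib)
    also have "L2_norm \<dots> \<le> (\<Sum>i\<in>I. L2_norm (\<lambda>x. a i * (\<psi> i x - proj \<phi> r (\<psi> i) x)))"
      by (intro L2_norm_sum_le L2_cmult L2_diff L L2_proj[OF o])
    also have "\<dots> = 0" by (simp add: L2_norm_cmult zI)
    finally show ?thesis by simp
  qed
  then show ?thesis using r o by blast
qed

subsection \<open>Metric entropy\<close>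

text \<open>Exponential weights: every admissible \<open>z\<close> has weight at least 1, and the
  total weight over a box factorizes into \<open>r\<close> two-sided geometric series, each at most
  \<open>exp 2\<close>. The exponent is linear in \<open>A\<close> and \<open>r\<close>; counting
  all vectors of a cube would cost a logarithm per coordinate.\<close>

lemma card_small_integer_vectors:
  fixes A :: real
  assumes A: "0 \<le> A"
  shows "finite {z \<in> {..<r} \<rightarrow>\<^sub>E (UNIV :: int set). (\<Sum>i<r. real_of_int \<bar>z i\<bar>) \<le> A}" (is "finite ?Z")
    and "real (card {z \<in> {..<r} \<rightarrow>\<^sub>E (UNIV :: int set). (\<Sum>i<r. real_of_int \<bar>z i\<bar>) \<le> A})
      \<le> exp (A + 2 * real r)"
proof -
  define B where "B = \<lceil>A\<rceil>"
  let ?P = "{..<r} \<rightarrow>\<^sub>E {-B..B}"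
  have fP: "finite ?P" by (intro finite_PiE) auto
  have sub: "?Z \<subseteq> ?P"
  proof
    fix z assume z: "z \<in> ?Z"
    have "z i \<in> {-B..B}" if "i < r" for i
    proof -
      have "real_of_int \<bar>z i\<bar> \<le> (\<Sum>i<r. real_of_int \<bar>z i\<bar>)"
        using that by (intro member_le_sum) auto
      also have "\<dots> \<le> A" using z by simp
      finally have "real_of_int \<bar>z i\<bar> \<le> of_int B" unfolding B_def by linarith
      then have "\<bar>z i\<bar> \<le> B" by linarith
      then show ?thesis by auto
    qed
    then show "z \<in> ?P" using z by (auto simp: PiE_def Pi_def)
  qed
  then show fin: "finite ?Z" using fP finite_subset by blast
  have geo: "(\<Sum>k\<in>{-B..B}. exp (- real_of_int \<bar>k\<bar>)) \<le> exp 2"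
  proof -
    let ?q = "exp (-1) :: real"
    have q: "0 < ?q" "?q \<le> 1/2"
      using exp_ge_add_one_self[of 1] by (auto simp: exp_minus field_simps)
    have "(\<Sum>k\<in>{-B..B}. exp (- real_of_int \<bar>k\<bar>)) \<le> (\<Sum>k\<in>(int ` {..nat B}) \<union> ((\<lambda>k. - int k) ` {..nat B}). exp (- real_of_int \<bar>k\<bar>))"
    proof (intro sum_mono2)
      show "{-B..B} \<subseteq> (int ` {..nat B}) \<union> ((\<lambda>k. - int k) ` {..nat B})"
      proof
        fix k assume k: "k \<in> {-B..B}"
        show "k \<in> (int ` {..nat B}) \<union> ((\<lambda>k. - int k) ` {..nat B})"
        proof (cases "k \<ge> 0")
          case True then have "k = int (nat k)" "nat k \<le> nat B" using k by auto
          then show ?thesis by blast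
        next
          case False then have "k = - int (nat (-k))" "nat (-k) \<le> nat B" using k by auto
          then show ?thesis by blast
        qed
      qed
    qed auto
    also have "\<dots> \<le> (\<Sum>k\<in>int ` {..nat B}. exp (- real_of_int \<bar>k\<bar>)) + (\<Sum>k\<in>(\<lambda>k. - int k) ` {..nat B}. exp (- real_of_int \<bar>k\<bar>))"
      by (subst sum_Un) (auto intro!: sum_nonneg)
    also have "\<dots> = 2 * (\<Sum>k\<le>nat B. ?q ^ k)"
      by (subst (1 2) sum.reindex) (auto simp: inj_on_def exp_of_nat_mult[symmetric])
    also have "(\<Sum>k\<le>nat B. ?q ^ k) \<le> (\<Sum>k\<le>nat B. (1/2) ^ k)"
      using q by (intro sum_mono power_mono) auto
    also have "(\<Sum>k\<le>nat B. (1/2::real) ^ k) \<le> 2"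
      by (subst sum_gp0) (auto simp: field_simps)
    finally have "(\<Sum>k\<in>{-B..B}. exp (- real_of_int \<bar>k\<bar>)) \<le> 2 * 2" by simp
    also have "2 * 2 \<le> (exp 1 :: real) * exp 1"
      using exp_ge_add_one_self[of 1] by (intro mult_mono) auto
    also have "\<dots> = exp 2" by (simp add: exp_add[symmetric])
    finally show ?thesis .
  qed
  have "real (card ?Z) = (\<Sum>z\<in>?Z. 1)" by simp
  also have "\<dots> \<le> (\<Sum>z\<in>?Z. exp (A - (\<Sum>i<r. real_of_int \<bar>z i\<bar>)))"
    by (intro sum_mono) auto
  also have "\<dots> \<le> (\<Sum>z\<in>?P. exp (A - (\<Sum>i<r. real_of_int \<bar>z i\<bar>)))"
    by (intro sum_mono2 fP sub) auto
  also have "\<dots> = exp A * (\<Sum>z\<in>?P. \<Prod>i<r. exp (- real_of_int \<bar>z i\<bar>))"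
    unfolding sum_distrib_left
    unfolding exp_sum[OF finite_lessThan, symmetric] exp_add[symmetric] by (simp add: sum_negf)
  also have "(\<Sum>z\<in>?P. \<Prod>i<r. exp (- real_of_int \<bar>z i\<bar>)) = (\<Prod>i<r. \<Sum>k\<in>{-B..B}. exp (- real_of_int \<bar>k\<bar>))"
    by (rule prod_sum_PiE[symmetric]) auto
  also have "\<dots> \<le> (\<Prod>i<r. exp 2)"
    by (intro prod_mono conjI geo sum_nonneg) auto
  also have "\<dots> = exp (2 * real r)" by (simp add: exp_of_nat_mult[symmetric] mult.commute)
  finally show "real (card ?Z) \<le> exp (A + 2 * real r)" by (simp add: exp_add)
qed

text \<open>
  Only the difference to the previous net is quantized.  At precision \<open>s\<close> this takes boundedly many
  bits per dimension, so no logarithmic factor is lost when the scales are summed.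
\<close>

lemma refine_net:
  fixes F :: "('a::euclidean_space \<Rightarrow> real) set" and s D q :: real
  assumes L2: "F \<subseteq> L2_space" "finite G" "G \<subseteq> L2_space"
    and s: "s > 0" and q: "q \<ge> 0" and D: "real r \<le> D" "D > 0"
    and o: "orthonormal \<phi> r"
    and app: "\<And>f. f \<in> F \<Longrightarrow> L2_norm (\<lambda>x. f x - proj \<phi> r f x) \<le> s"
    and net: "\<And>f. f \<in> F \<Longrightarrow> \<exists>g\<in>G. L2_norm (\<lambda>x. f x - g x) \<le> q * s"
  shows "\<exists>G'. finite G' \<and> G' \<subseteq> L2_space \<and> real (card G') \<le> real (card G) * exp ((q + 3) * D) \<and>
    (\<forall>f\<in>F. \<exists>g\<in>G'. L2_norm (\<lambda>x. f x - g x) \<le> 2 * s)"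
proof -
  \<comment> \<open>With this mesh, rounding at most \<open>D\<close> coefficients moves the
    function by at most \<open>s\<close>.\<close>
  define \<delta> where "\<delta> = s / sqrt D"
  have \<delta>: "\<delta> > 0" using s D by (simp add: \<delta>_def)
  \<comment> \<open>By Cauchy-Schwarz the coefficients of the difference have absolute sum at most
    \<open>sqrt D * (q * s)\<close>, which is \<open>q * D\<close> in units of \<delta>; rounding
    adds at most 1/2 for each of them.\<close>
  define A where "A = (q + 1) * D"
  have A: "A \<ge> 0" using q D by (simp add: A_def)
  define Z where "Z = {z \<in> {..<r} \<rightarrow>\<^sub>E (UNIV :: int set). (\<Sum>i<r. real_of_int \<bar>z i\<bar>) \<le> A}"
  have fZ: "finite Z" unfolding Z_def by (rule card_small_integer_vectors[OF A])
  have cZ: "real (card Z) \<le> exp ((q + 3) * D)"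
  proof -
    have "real (card Z) \<le> exp (A + 2 * real r)"
      unfolding Z_def by (rule card_small_integer_vectors[OF A])
    also have "\<dots> \<le> exp ((q + 3) * D)" using D by (simp add: A_def algebra_simps)
    finally show ?thesis .
  qed
  \<comment> \<open>Only the projection of the old center is kept; the part of \<open>f\<close>
    outside the span is covered by \<open>app\<close>.\<close>
  define G' where "G' = (\<lambda>(g, z). comb \<phi> r (\<lambda>i. ip g (\<phi> i) + \<delta> * real_of_int (z i))) ` (G \<times> Z)"
  have "real (card G') \<le> real (card (G \<times> Z))"
    unfolding G'_def using L2(2) fZ by (intro of_nat_mono card_image_le) auto
  also have "\<dots> = real (card G) * real (card Z)" by (simp add: card_cartesian_product)
  also have "\<dots> \<le> real (card G) * exp ((q + 3) * D)"
    by (intro mult_left_mono cZ) auto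
  finally have c: "real (card G') \<le> real (card G) * exp ((q + 3) * D)" .
  have "\<exists>g\<in>G'. L2_norm (\<lambda>x. f x - g x) \<le> 2 * s" if f: "f \<in> F" for f
  proof -
    obtain g where g: "g \<in> G" and fg: "L2_norm (\<lambda>x. f x - g x) \<le> q * s" using net[OF f] by blast
    have fL: "f \<in> L2_space" and gL: "g \<in> L2_space" using f g L2 by auto
    define t where "t i = ip f (\<phi> i) - ip g (\<phi> i)" for i
    have "(\<Sum>i<r. (t i)\<^sup>2) = (\<Sum>i<r. (ip (\<lambda>x. f x - g x) (\<phi> i))\<^sup>2)"
      unfolding t_def using fL gL orthonormal_L2[OF o] by (intro sum.cong) (auto simp: ip_diff_left)
    also have "\<dots> \<le> (L2_norm (\<lambda>x. f x - g x))\<^sup>2" by (rule bessel[OF o L2_diff[OF fL gL]])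
    also have "\<dots> \<le> (q * s)\<^sup>2" using fg by (intro power_mono) auto
    finally have t2: "(\<Sum>i<r. (t i)\<^sup>2) \<le> (q * s)\<^sup>2" .
    have t1: "(\<Sum>i<r. \<bar>t i\<bar>) \<le> sqrt D * (q * s)"
    proof (rule power2_le_imp_le)
      have "(\<Sum>i<r. \<bar>t i\<bar> * 1)\<^sup>2 \<le> (\<Sum>i<r. \<bar>t i\<bar>\<^sup>2) * (\<Sum>i<r. 1\<^sup>2)"
        by (rule Cauchy_Schwarz_ineq_sum)
      also have "\<dots> = (\<Sum>i<r. (t i)\<^sup>2) * real r" by simp
      also have "\<dots> \<le> (q * s)\<^sup>2 * D"
        using t2 D by (intro mult_mono) auto
      finally show "(\<Sum>i<r. \<bar>t i\<bar>)\<^sup>2 \<le> (sqrt D * (q * s))\<^sup>2"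
        using D by (simp add: power_mult_distrib mult.commute)
    qed (use D q s in auto)
    define z where "z = (\<lambda>i\<in>{..<r}. round (t i / \<delta>))"
    have zr: "\<bar>real_of_int (z i) - t i / \<delta>\<bar> \<le> 1/2" if "i < r" for i
      using of_int_round_abs_le[of "t i / \<delta>"] that by (simp add: z_def)
    have "(\<Sum>i<r. real_of_int \<bar>z i\<bar>) \<le> (\<Sum>i<r. \<bar>t i\<bar> / \<delta> + 1/2)"
    proof (intro sum_mono)
      fix i assume "i \<in> {..<r}"
      then have "\<bar>real_of_int (z i) - t i / \<delta>\<bar> \<le> 1/2" using zr[of i] by simp
      moreover have "\<bar>t i / \<delta>\<bar> = \<bar>t i\<bar> / \<delta>" using \<delta> by (simp add: abs_divide)
      ultimately show "real_of_int \<bar>z i\<bar> \<le> \<bar>t i\<bar> / \<delta> + 1/2" by linarith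
    qed
    also have "\<dots> = (\<Sum>i<r. \<bar>t i\<bar>) / \<delta> + real r / 2"
      by (simp add: sum.distrib sum_divide_distrib)
    also have "\<dots> \<le> sqrt D * (q * s) / \<delta> + D"
      using t1 \<delta> D by (intro add_mono divide_right_mono) auto
    also have "sqrt D * (q * s) / \<delta> = q * D"
      using s D by (simp add: \<delta>_def field_simps)
    finally have "(\<Sum>i<r. real_of_int \<bar>z i\<bar>) \<le> A" by (simp add: A_def algebra_simps)
    then have z: "z \<in> Z" by (simp add: Z_def z_def)
    let ?g = "comb \<phi> r (\<lambda>i. ip g (\<phi> i) + \<delta> * real_of_int (z i))"
    have "?g \<in> G'" unfolding G'_def using g z by (intro image_eqI[of _ _ "(g, z)"]) auto
    moreover have "L2_norm (\<lambda>x. f x - ?g x) \<le> 2 * s"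
    proof (rule power2_le_imp_le)
      have e: "(t i - \<delta> * real_of_int (z i))\<^sup>2 \<le> \<delta>\<^sup>2" if "i < r" for i
      proof -
        have "\<bar>t i - \<delta> * real_of_int (z i)\<bar> = \<delta> * \<bar>real_of_int (z i) - t i / \<delta>\<bar>"
          using \<delta> by (simp add: abs_mult_pos' field_simps abs_minus_commute)
        also have "\<dots> \<le> \<delta> * 1" using zr[OF that] \<delta> by (intro mult_left_mono) auto
        finally show ?thesis using abs_le_square_iff[of "t i - \<delta> * real_of_int (z i)" \<delta>] \<delta> by simp
      qed
      have "(L2_norm (\<lambda>x. f x - ?g x))\<^sup>2 = (L2_norm (\<lambda>x. f x - proj \<phi> r f x))\<^sup>2
          + (\<Sum>i<r. (t i - \<delta> * real_of_int (z i))\<^sup>2)"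
        unfolding comb_pythagoras[OF o fL] t_def by (simp add: algebra_simps)
      also have "\<dots> \<le> s\<^sup>2 + (\<Sum>i<r. \<delta>\<^sup>2)"
        by (intro add_mono power_mono[OF app[OF f]] sum_mono e) auto
      also have "\<dots> \<le> s\<^sup>2 + D * \<delta>\<^sup>2" using D by (simp add: mult_right_mono)
      also have "\<dots> = 2 * s\<^sup>2" using D by (simp add: \<delta>_def power_divide)
      also have "\<dots> \<le> (2 * s)\<^sup>2" by (simp add: power_mult_distrib)
      finally show "(L2_norm (\<lambda>x. f x - ?g x))\<^sup>2 \<le> (2 * s)\<^sup>2" .
    qed (use s in simp)
    ultimately show ?thesis by blast
  qed
  moreover have "G' \<subseteq> L2_space"
    unfolding G'_def using orthonormal_L2[OF o] by (auto intro!: L2_comb)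
  moreover have "finite G'" unfolding G'_def using fZ L2 by auto
  ultimately show ?thesis using c by blast
qed

text \<open>The logarithms of the refinement factors grow geometrically in \<open>j\<close>, so
  their sum is of the order of the last one. The nets built this way need not lie in
  \<open>F\<close>; each center is finally exchanged for a nearby member of \<open>F\<close>, which
  doubles the radius. Membership is wanted because the decoder must return functions with a small
  projection error of their own.\<close>

lemma entropy_bound:
  fixes F :: "('a::euclidean_space \<Rightarrow> real) set" and M C \<beta> :: real and d :: nat
  assumes d: "d \<ge> 1" and \<beta>: "\<beta> > 0" and M: "M > 0" and C: "C > 0"
    and F: "F \<subseteq> L2_space" "\<And>f. f \<in> F \<Longrightarrow> L2_norm f \<le> C"
    and app: "\<And>j::nat. \<exists>\<phi> r. orthonormal \<phi> r \<and> real r \<le> M * 2 ^ (j * d) \<and>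
      (\<forall>f\<in>F. L2_norm (\<lambda>x. f x - proj \<phi> r f x) \<le> C * 2 powr (- \<beta> * real j))"
  shows "\<exists>K>0. \<forall>j::nat. \<exists>G. finite G \<and> G \<subseteq> F \<and> real (card G) \<le> exp (K * 2 ^ (j * d)) \<and>
    (\<forall>f\<in>F. \<exists>g\<in>G. L2_norm (\<lambda>x. f x - g x) \<le> 4 * C * 2 powr (- \<beta> * real j))"
proof -
  \<comment> \<open>The radius at scale \<open>j\<close> is \<open>q\<close> times the precision at
    scale \<open>Suc j\<close>. In \<open>K\<close> the factor 2 closes the induction: since
    \<open>2 * 2 ^ (j * d)\<close> is at most \<open>2 ^ (Suc j * d)\<close>, the old exponent takes
    up at most half of the new budget and the refinement the other half.\<close>
  define q where "q = 2 * 2 powr \<beta>"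
  define K where "K = 2 * (q + 3) * M"
  have q: "q > 0" by (simp add: q_def)
  have K: "K > 0" using q M by (simp add: K_def)
  have outer: "\<exists>G. finite G \<and> G \<subseteq> L2_space \<and> real (card G) \<le> exp (K * 2 ^ (j * d)) \<and>
    (\<forall>f\<in>F. \<exists>g\<in>G. L2_norm (\<lambda>x. f x - g x) \<le> 2 * (C * 2 powr (- \<beta> * real j)))" for j
  proof (induction j)
    case 0
    have "L2_norm (\<lambda>x. f x - 0) \<le> 2 * C" if "f \<in> F" for f
      using F(2)[OF that] C by simp
    then show ?case using K by (intro exI[of _ "{\<lambda>_. 0}"]) (auto simp: L2_zero)
  next
    case (Suc j)
    then obtain G where G: "finite G" "G \<subseteq> L2_space" "real (card G) \<le> exp (K * 2 ^ (j * d))"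
      and net: "\<And>f. f \<in> F \<Longrightarrow> \<exists>g\<in>G. L2_norm (\<lambda>x. f x - g x) \<le> 2 * (C * 2 powr (- \<beta> * real j))"
      by blast
    obtain \<phi> r where o: "orthonormal \<phi> r" and r: "real r \<le> M * 2 ^ (Suc j * d)"
      and a: "\<And>f. f \<in> F \<Longrightarrow> L2_norm (\<lambda>x. f x - proj \<phi> r f x) \<le> C * 2 powr (- \<beta> * real (Suc j))"
      using app[of "Suc j"] by blast
    let ?s = "C * 2 powr (- \<beta> * real (Suc j))"
    have s: "2 * (C * 2 powr (- \<beta> * real j)) = q * ?s"
      by (simp add: q_def powr_add[symmetric] algebra_simps)
    have "\<exists>G'. finite G' \<and> G' \<subseteq> L2_space \<and> real (card G') \<le> real (card G) * exp ((q + 3) * (M * 2 ^ (Suc j * d))) \<and>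
      (\<forall>f\<in>F. \<exists>g\<in>G'. L2_norm (\<lambda>x. f x - g x) \<le> 2 * ?s)"
    proof (rule refine_net[OF F(1) G(1,2) _ _ r _ o a])
      show "0 < ?s" "0 \<le> q" "0 < M * 2 ^ (Suc j * d)" using C q M by auto
      show "\<exists>g\<in>G. L2_norm (\<lambda>x. f x - g x) \<le> q * ?s" if "f \<in> F" for f
        using net[OF that] unfolding s .
    qed
    then obtain G' where G': "finite G'" "G' \<subseteq> L2_space"
        "real (card G') \<le> real (card G) * exp ((q + 3) * (M * 2 ^ (Suc j * d)))"
        "\<forall>f\<in>F. \<exists>g\<in>G'. L2_norm (\<lambda>x. f x - g x) \<le> 2 * ?s" by blast
    note G'(3)
    also have "real (card G) * exp ((q + 3) * (M * 2 ^ (Suc j * d)))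
        \<le> exp (K * 2 ^ (j * d)) * exp ((q + 3) * (M * 2 ^ (Suc j * d)))"
      by (intro mult_right_mono G(3)) auto
    also have "\<dots> = exp (K * 2 ^ (j * d) + K / 2 * 2 ^ (Suc j * d))"
      by (simp add: exp_add[symmetric] K_def)
    also have "\<dots> \<le> exp (K * 2 ^ (Suc j * d))"
    proof -
      have "(2::real) ^ (j * d) * 2 ^ 1 \<le> 2 ^ (j * d) * 2 ^ d"
        using d by (intro mult_left_mono power_increasing) auto
      then have "K / 2 * (2 ^ (j * d) * 2) \<le> K / 2 * 2 ^ (Suc j * d)"
        using K by (intro mult_left_mono) (auto simp: power_add mult.commute)
      then show ?thesis by simp
    qed
    finally show ?case using G' by blast
  qed
  have "\<exists>G. finite G \<and> G \<subseteq> F \<and> real (card G) \<le> exp (K * 2 ^ (j * d)) \<and>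
    (\<forall>f\<in>F. \<exists>g\<in>G. L2_norm (\<lambda>x. f x - g x) \<le> 4 * C * 2 powr (- \<beta> * real j))" for j
  proof -
    let ?e = "2 * (C * 2 powr (- \<beta> * real j))"
    obtain G where G: "finite G" "G \<subseteq> L2_space" "real (card G) \<le> exp (K * 2 ^ (j * d))"
      and net: "\<And>f. f \<in> F \<Longrightarrow> \<exists>g\<in>G. L2_norm (\<lambda>x. f x - g x) \<le> ?e"
      using outer[of j] by blast
    define H where "H = {g \<in> G. \<exists>f\<in>F. L2_norm (\<lambda>x. f x - g x) \<le> ?e}"
    define p where "p g = (SOME f. f \<in> F \<and> L2_norm (\<lambda>x. f x - g x) \<le> ?e)" for g
    have p: "p g \<in> F \<and> L2_norm (\<lambda>x. p g x - g x) \<le> ?e" if "g \<in> H" for g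
    proof -
      have "\<exists>f. f \<in> F \<and> L2_norm (\<lambda>x. f x - g x) \<le> ?e"
        using that by (auto simp: H_def)
      from someI_ex[OF this] show ?thesis by (simp only: p_def)
    qed
    have fH: "finite H" "H \<subseteq> G" using G by (auto simp: H_def)
    have "real (card (p ` H)) \<le> real (card G)"
      using fH G by (intro of_nat_mono) (meson card_image_le card_mono le_trans)
    also note G(3)
    finally have c: "real (card (p ` H)) \<le> exp (K * 2 ^ (j * d))" .
    have "\<exists>g\<in>p ` H. L2_norm (\<lambda>x. f x - g x) \<le> 4 * C * 2 powr (- \<beta> * real j)" if f: "f \<in> F" for f
    proof -
      obtain g where g: "g \<in> G" "L2_norm (\<lambda>x. f x - g x) \<le> ?e" using net[OF f] by blast
      then have gH: "g \<in> H" using f by (auto simp: H_def)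
      have "L2_norm (\<lambda>x. f x - p g x) \<le> L2_norm (\<lambda>x. f x - g x) + L2_norm (\<lambda>x. g x - p g x)"
        using f p[OF gH] F(1) G(2) g(1) by (intro L2_norm_diff_triangle) auto
      also have "L2_norm (\<lambda>x. g x - p g x) = L2_norm (\<lambda>x. p g x - g x)"
        by (rule L2_norm_minus_commute)
      also have "L2_norm (\<lambda>x. f x - g x) + \<dots> \<le> ?e + ?e"
        using g p[OF gH] by (intro add_mono) auto
      finally show ?thesis using gH by (intro bexI[of _ "p g"]) auto
    qed
    then show ?thesis using fH p c by (intro exI[of _ "p ` H"]) auto
  qed
  then show ?thesis using K by blast
qed

subsection \<open>Taylor expansion\<close>

text \<open>\<open>partial_deriv\<close> is a one-dimensional \<open>deriv\<close>, which by itself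
  says nothing about other directions; total differentiability turns it into the values of the
  derivative on the axes.\<close>

lemma line_derivative:
  fixes f :: "real ^ 'd::finite \<Rightarrow> real"
  assumes "f differentiable (at (a + t *\<^sub>R v))"
  shows "((\<lambda>t. f (a + t *\<^sub>R v)) has_real_derivative
    (\<Sum>i\<in>UNIV. v $ i * partial_deriv i f (a + t *\<^sub>R v))) (at t)"
proof -
  define y where "y = a + t *\<^sub>R v"
  obtain D where D: "(f has_derivative D) (at y)"
    using assms unfolding differentiable_def y_def by blast
  have lin: "linear D" using D by (rule has_derivative_linear)
  have dir: "((\<lambda>s. f (b + s *\<^sub>R u)) has_real_derivative D u) (at s)" if "b + s *\<^sub>R u = y" for b s u
  proof -
    have "((\<lambda>s. f (b + s *\<^sub>R u)) has_derivative (\<lambda>h. D (h *\<^sub>R u))) (at s)"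
    proof (rule has_derivative_compose[where f = "\<lambda>s. b + s *\<^sub>R u" and g = f])
      show "((\<lambda>s. b + s *\<^sub>R u) has_derivative (\<lambda>h. h *\<^sub>R u)) (at s)"
        by (auto intro!: derivative_eq_intros)
      show "(f has_derivative D) (at (b + s *\<^sub>R u))" using D that by simp
    qed
    then show ?thesis
      unfolding has_field_derivative_def
      by (rule has_derivative_eq_rhs) (simp add: linear_cmul[OF lin] fun_eq_iff)
  qed
  have pd: "partial_deriv i f y = D (axis i 1)" for i
    unfolding partial_deriv_def by (rule DERIV_imp_deriv, rule dir) simp
  have "v = (\<Sum>i\<in>UNIV. (v $ i) *\<^sub>R axis i 1)"
    by (simp add: vec_eq_iff axis_def if_distrib cong: if_cong)
  then have "D v = D (\<Sum>i\<in>UNIV. (v $ i) *\<^sub>R axis i 1)" by simp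
  also have "\<dots> = (\<Sum>i\<in>UNIV. v $ i * D (axis i 1))"
    by (simp add: linear_sum[OF lin] linear_cmul[OF lin])
  finally have "D v = (\<Sum>i\<in>UNIV. v $ i * D (axis i 1))" .
  with dir[of a t v] show ?thesis by (simp add: pd flip: y_def)
qed

lemma iter_partial_Nil [simp]: "iter_partial [] f = f"
  by (simp add: iter_partial_def)

lemma iter_partial_Cons: "iter_partial (i # is) f = partial_deriv i (iter_partial is f)"
  by (simp add: iter_partial_def)

lemma iter_partial_snoc: "iter_partial (is @ [i]) f = iter_partial is (partial_deriv i f)"
  by (simp add: iter_partial_def)

lemma times_differentiable_iter_partial:
  "times_differentiable k f \<Longrightarrow> length is \<le> k \<Longrightarrow> times_differentiable (k - length is) (iter_partial is f)"
proof (induction "is" arbitrary: k f rule: rev_induct)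
  case (snoc i "is")
  then obtain k' where k: "k = Suc k'" by (cases k) auto
  then have "times_differentiable (k' - length is) (iter_partial is (partial_deriv i f))"
    using snoc by auto
  then show ?case by (simp add: k iter_partial_snoc)
qed simp

lemma differentiable_iter_partial:
  "times_differentiable k f \<Longrightarrow> length is < k \<Longrightarrow> iter_partial is f differentiable (at x)"
  using times_differentiable_iter_partial[of k f "is"]
  by (cases "k - length is") auto

text \<open>Indexing by ordered lists replaces multi-index factorials: each multi-index occurs once
  per ordering, so all Taylor terms of degree \<open>l\<close> carry the same factor
  \<open>1 / fact l\<close>.\<close>

definition list_monom :: "real ^ 'd \<Rightarrow> 'd list \<Rightarrow> real" where
  "list_monom v is = prod_list (map (\<lambda>i. v $ i) is)"

definition index_lists :: "nat \<Rightarrow> 'd list set" where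
  "index_lists l = {is. length is = l}"

lemma finite_index_lists: "finite (index_lists l :: 'd::finite list set)"
  using finite_lists_length_eq[of "UNIV :: 'd set" l] by (simp add: index_lists_def)

lemma card_index_lists: "card (index_lists l :: 'd::finite list set) = CARD('d) ^ l"
  using card_lists_length_eq[of "UNIV :: 'd set" l] by (simp add: index_lists_def)

lemma sum_index_lists_Suc:
  "(\<Sum>is\<in>index_lists (Suc l). F is) = (\<Sum>is\<in>index_lists l. \<Sum>i\<in>(UNIV :: 'd::finite set). F (i # is))"
proof -
  have e: "index_lists (Suc l) = (\<lambda>(is, i). i # is) ` (index_lists l \<times> (UNIV :: 'd set))"
    by (auto simp: index_lists_def length_Suc_conv)
  have "(\<Sum>is\<in>index_lists (Suc l). F is) = (\<Sum>(is, i)\<in>index_lists l \<times> UNIV. F (i # is))"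
    unfolding e by (subst sum.reindex) (auto simp: inj_on_def intro!: sum.cong)
  then show ?thesis by (simp add: sum.cartesian_product)
qed

lemma abs_list_monom_le:
  assumes "\<And>i. \<bar>v $ i\<bar> \<le> c" "0 \<le> c"
  shows "\<bar>list_monom v is\<bar> \<le> c ^ length is"
  by (induction "is") (auto simp: list_monom_def abs_mult assms intro!: mult_mono)

text \<open>The order \<open>k\<close> and the exponent \<alpha> are separate parameters, so that a
  partial derivative of \<open>f\<close> satisfies the same condition with \<open>k\<close> lowered
  by one and \<alpha> unchanged.\<close>

definition holder_derivs :: "nat \<Rightarrow> real \<Rightarrow> real \<Rightarrow> (real ^ 'd::finite \<Rightarrow> real) \<Rightarrow> bool" where
  "holder_derivs k \<alpha> L f \<longleftrightarrow> times_differentiable k f \<and>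
    (\<forall>is. length is = k \<longrightarrow>
      (\<forall>x y. \<bar>iter_partial is f x - iter_partial is f y\<bar> \<le> L * norm (x - y) powr \<alpha>))"

text \<open>Lagrange's remainder evaluates the derivatives of order \<open>k\<close> at an
  intermediate point; moving them back to \<open>a\<close> costs one Hoelder increment for each of
  the \<open>CARD('d) ^ k\<close> lists.\<close>

lemma holder_taylor:
  fixes f :: "real ^ 'd::finite \<Rightarrow> real"
  assumes f: "holder_derivs k \<alpha> L f" and \<alpha>: "\<alpha> > 0" and L: "L \<ge> 0"
  shows "\<bar>f x - (\<Sum>l\<le>k. \<Sum>is\<in>index_lists l. iter_partial is f a / fact l * list_monom (x - a) is)\<bar>
    \<le> L * real CARD('d) ^ k * norm (x - a) powr (real k + \<alpha>)"
proof -
  define v where "v = x - a"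
  define D where "D l t = (\<Sum>is\<in>index_lists l. list_monom v is * iter_partial is f (a + t *\<^sub>R v))" for l t
  have td: "times_differentiable k f" using f by (simp add: holder_derivs_def)
  have deriv: "(D l has_real_derivative D (Suc l) t) (at t)" if "l < k" for l t
  proof -
    have "(D l has_real_derivative (\<Sum>is\<in>index_lists l. list_monom v is *
        (\<Sum>i\<in>UNIV. v $ i * partial_deriv i (iter_partial is f) (a + t *\<^sub>R v)))) (at t)"
      unfolding D_def
      by (intro DERIV_sum DERIV_cmult line_derivative differentiable_iter_partial[OF td])
         (use that in \<open>auto simp: index_lists_def\<close>)
    also have "(\<Sum>is\<in>index_lists l. list_monom v is *
        (\<Sum>i\<in>UNIV. v $ i * partial_deriv i (iter_partial is f) (a + t *\<^sub>R v))) = D (Suc l) t"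
      unfolding D_def sum_index_lists_Suc
      by (simp add: sum_distrib_left iter_partial_Cons list_monom_def algebra_simps)
    finally show ?thesis .
  qed
  have D0: "D 0 t = f (a + t *\<^sub>R v)" for t by (simp add: D_def index_lists_def list_monom_def)
  have "\<exists>t\<ge>0. t \<le> 1 \<and> f x = (\<Sum>l<k. D l 0 / fact l) + D k t / fact k"
  \<comment> \<open>Maclaurin's formula requires a positive order.\<close>
  proof (cases "k = 0")
    case True
    then show ?thesis by (intro exI[of _ 1]) (auto simp: D0 v_def)
  next
    case False
    have "\<exists>t>0. t < 1 \<and> D 0 1 = (\<Sum>m<k. D m 0 / fact m * 1 ^ m) + D k t / fact k * 1 ^ k"
      using False deriv by (intro Maclaurin) auto
    then show ?thesis by (auto simp: D0 v_def intro: less_imp_le)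
  qed
  then obtain t where t: "0 \<le> t" "t \<le> 1" and e: "f x = (\<Sum>l<k. D l 0 / fact l) + D k t / fact k"
    by blast
  have tay: "(\<Sum>l\<le>k. \<Sum>is\<in>index_lists l. iter_partial is f a / fact l * list_monom (x - a) is)
      = (\<Sum>l\<le>k. D l 0 / fact l)"
    by (simp add: D_def v_def sum_divide_distrib mult.commute)
  have "f x - (\<Sum>l\<le>k. D l 0 / fact l) = (D k t - D k 0) / fact k"
    using e by (simp add: lessThan_Suc_atMost[symmetric] diff_divide_distrib)
  then have "\<bar>f x - (\<Sum>l\<le>k. D l 0 / fact l)\<bar> = \<bar>D k t - D k 0\<bar> / fact k" by simp
  also have "\<dots> \<le> \<bar>D k t - D k 0\<bar>"
    using divide_left_mono[of 1 "fact k" "\<bar>D k t - D k 0\<bar>"] by simp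
  also have "\<bar>D k t - D k 0\<bar> \<le> (\<Sum>is\<in>(index_lists k :: 'd list set). norm v ^ k * (L * norm v powr \<alpha>))"
  proof -
    have "\<bar>D k t - D k 0\<bar> = \<bar>\<Sum>is\<in>index_lists k. list_monom v is *
        (iter_partial is f (a + t *\<^sub>R v) - iter_partial is f (a + 0 *\<^sub>R v))\<bar>"
      by (simp add: D_def sum_subtractf right_diff_distrib)
    also have "\<dots> \<le> (\<Sum>is\<in>index_lists k. \<bar>list_monom v is *
        (iter_partial is f (a + t *\<^sub>R v) - iter_partial is f (a + 0 *\<^sub>R v))\<bar>)"
      by (rule sum_abs)
    also have "\<dots> \<le> (\<Sum>is\<in>(index_lists k :: 'd list set). norm v ^ k * (L * norm v powr \<alpha>))"
    proof (intro sum_mono)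
      fix "is" :: "'d list" assume i: "is \<in> index_lists k"
      have 1: "\<bar>list_monom v is\<bar> \<le> norm v ^ k"
        using abs_list_monom_le[of v "norm v" "is"] i component_le_norm_cart[of v]
        by (auto simp: index_lists_def)
      have "\<bar>iter_partial is f (a + t *\<^sub>R v) - iter_partial is f (a + 0 *\<^sub>R v)\<bar>
          \<le> L * norm ((a + t *\<^sub>R v) - (a + 0 *\<^sub>R v)) powr \<alpha>"
        using f i unfolding holder_derivs_def index_lists_def by blast
      also have "\<dots> \<le> L * norm v powr \<alpha>"
        using t L \<alpha> by (intro mult_left_mono powr_mono2) (auto intro: mult_left_le_one_le)
      finally show "\<bar>list_monom v is * (iter_partial is f (a + t *\<^sub>R v) - iter_partial is f (a + 0 *\<^sub>R v))\<bar>
          \<le> norm v ^ k * (L * norm v powr \<alpha>)"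
        unfolding abs_mult using 1 by (intro mult_mono) auto
    qed
    finally show ?thesis .
  qed
  also have "\<dots> = L * real CARD('d) ^ k * norm v powr (real k + \<alpha>)"
    by (cases "v = 0") (use \<alpha> in \<open>auto simp: card_index_lists powr_add powr_realpow\<close>)
  finally show ?thesis by (simp only: tay v_def)
qed

lemma strict_floor_bounds:
  assumes "\<beta> > 0"
  shows "real (strict_floor \<beta>) < \<beta>" "\<beta> \<le> real (strict_floor \<beta>) + 1"
proof -
  have "\<lceil>\<beta>\<rceil> \<ge> 1" using assms by linarith
  then have "real (strict_floor \<beta>) = of_int \<lceil>\<beta>\<rceil> - 1" unfolding strict_floor_def by simp
  then show "real (strict_floor \<beta>) < \<beta>" "\<beta> \<le> real (strict_floor \<beta>) + 1" by linarith+
qed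

text \<open>Every list has exactly one vector of counts, and the entries of that vector sum to the
  length of the list. Quantifying over multi-indices and then over orderings is therefore the same
  as quantifying over lists.\<close>

lemma holder_class_iff:
  fixes f :: "real ^ 'd::finite \<Rightarrow> real"
  shows "f \<in> holder_class \<beta> L \<longleftrightarrow> (\<forall>x. x \<notin> cbox (\<chi> i. - 1/2) (\<chi> i. 1/2) \<longrightarrow> f x = 0) \<and>
    holder_derivs (strict_floor \<beta>) (\<beta> - real (strict_floor \<beta>)) L f"
proof -
  have c: "(\<Sum>i\<in>UNIV. s i) = length is" if "\<forall>i. count_list is i = s i" for s :: "'d \<Rightarrow> nat" and "is"
  proof -
    have "s = count_list is" using that by auto
    then show ?thesis using sum_count_set[of "is" UNIV] by simp
  qed
  show ?thesis
    unfolding holder_class_def holder_derivs_def mixed_partials_def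
    by (auto dest: c) (metis c)
qed

subsection \<open>Bounds on the Hoelder class\<close>

lemma partial_deriv_outside:
  fixes f :: "real ^ 'd::finite \<Rightarrow> real"
  assumes S: "closed S" and z: "\<And>x. x \<notin> S \<Longrightarrow> f x = 0" and x: "x \<notin> S"
  shows "partial_deriv i f x = 0"
proof -
  have "((\<lambda>t::real. x + t *\<^sub>R axis i 1) \<longlongrightarrow> x + 0 *\<^sub>R axis i 1) (at 0)"
    by (intro tendsto_intros)
  then have "((\<lambda>t::real. x + t *\<^sub>R axis i 1) \<longlongrightarrow> x) (at 0)" by simp
  then have "\<forall>\<^sub>F t in at (0::real). x + t *\<^sub>R axis i 1 \<in> - S"
    by (rule topological_tendstoD) (use S x in auto)
  then have "\<forall>\<^sub>F t in nhds (0::real). t \<noteq> 0 \<longrightarrow> x + t *\<^sub>R axis i 1 \<in> - S"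
    by (simp add: eventually_at_filter)
  then have "\<forall>\<^sub>F t in nhds (0::real). x + t *\<^sub>R axis i 1 \<notin> S"
    by eventually_elim (use x in \<open>case_tac "t = 0"; auto\<close>)
  then have "\<forall>\<^sub>F t in nhds (0::real). f (x + t *\<^sub>R axis i 1) = 0"
    by eventually_elim (auto intro: z)
  then have "deriv (\<lambda>t. f (x + t *\<^sub>R axis i 1)) 0 = deriv (\<lambda>_. 0) (0::real)"
    by (intro deriv_cong_ev) auto
  then show ?thesis by (simp add: partial_deriv_def)
qed

lemma iter_partial_outside:
  fixes f :: "real ^ 'd::finite \<Rightarrow> real"
  assumes S: "closed S" and z: "\<And>x. x \<notin> S \<Longrightarrow> f x = 0"
  shows "x \<notin> S \<Longrightarrow> iter_partial is f x = 0"
proof (induction "is" arbitrary: x)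
  case (Cons i "is")
  show ?case unfolding iter_partial_Cons
    by (rule partial_deriv_outside[OF S]) (use Cons in auto)
qed (use z in simp)

abbreviation unit_box :: "(real ^ 'd::finite) set" where
  "unit_box \<equiv> cbox (\<chi> i. - 1/2) (\<chi> i. 1/2)"

text \<open>Expand around a point outside the closed box: there all derivatives vanish, the Taylor
  polynomial is zero, and only the remainder over a bounded distance is left.\<close>

lemma holder_derivs_bounded:
  fixes f :: "real ^ 'd::finite \<Rightarrow> real"
  assumes f: "holder_derivs k \<alpha> L f" and \<alpha>: "\<alpha> > 0" and L: "L \<ge> 0"
    and z: "\<And>x. x \<notin> unit_box \<Longrightarrow> f x = 0"
  shows "\<bar>f x\<bar> \<le> L * real CARD('d) ^ k * (2 * real CARD('d)) powr (real k + \<alpha>)"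
proof (cases "x \<in> unit_box")
  case False
  then show ?thesis using z L by auto
next
  case True
  let ?a = "(\<chi> i. 1) :: real ^ 'd"
  have a: "?a \<notin> unit_box" by (auto simp: mem_box_cart)
  have "iter_partial is f ?a = 0" for "is"
    by (rule iter_partial_outside[OF closed_cbox z a])
  then have "\<bar>f x\<bar> \<le> L * real CARD('d) ^ k * norm (x - ?a) powr (real k + \<alpha>)"
    using holder_taylor[OF f \<alpha> L, of x ?a] by simp
  also have "\<dots> \<le> L * real CARD('d) ^ k * (2 * real CARD('d)) powr (real k + \<alpha>)"
  proof (intro mult_left_mono powr_mono2)
    have "norm (x - ?a) \<le> (\<Sum>i\<in>UNIV. \<bar>(x - ?a) $ i\<bar>)" by (rule norm_le_l1_cart)
    also have "\<dots> \<le> (\<Sum>i\<in>(UNIV :: 'd set). 2)"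
    proof (intro sum_mono)
      fix i :: 'd
      have "- 1/2 \<le> x $ i" "x $ i \<le> 1/2" using True by (auto simp: mem_box_cart)
      then show "\<bar>(x - ?a) $ i\<bar> \<le> 2" by simp
    qed
    finally show "norm (x - ?a) \<le> 2 * real CARD('d)" by simp
  qed (use L \<alpha> in auto)
  finally show ?thesis .
qed

lemma holder_class_bounded:
  assumes "\<beta> > 0" "L > 0"
  shows "\<exists>B>0. \<forall>f\<in>(holder_class \<beta> L :: (real ^ 'd::finite \<Rightarrow> real) set). \<forall>x. \<bar>f x\<bar> \<le> B"
proof (intro exI conjI ballI allI)
  let ?k = "strict_floor \<beta>"
  let ?B = "L * real CARD('d) ^ ?k * (2 * real CARD('d)) powr (real ?k + (\<beta> - real ?k))"
  show "?B > 0" using assms by simp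
  show "\<bar>f x\<bar> \<le> ?B" if "f \<in> holder_class \<beta> L" for f :: "real ^ 'd \<Rightarrow> real" and x
    using that assms strict_floor_bounds[OF assms(1)] unfolding holder_class_iff
    by (intro holder_derivs_bounded) auto
qed

lemma holder_class_continuous:
  fixes f :: "real ^ 'd::finite \<Rightarrow> real"
  assumes \<beta>: "\<beta> > 0" and f: "f \<in> holder_class \<beta> L"
  shows "continuous_on UNIV f"
proof (cases "strict_floor \<beta>")
  case 0
  then have h: "\<bar>f x - f y\<bar> \<le> L * norm (x - y) powr \<beta>" for x y
    using f unfolding holder_class_iff holder_derivs_def by auto
  have "isCont f y" for y
  proof -
    have "((\<lambda>x. L * norm (x - y) powr \<beta>) \<longlongrightarrow> L * 0) (at y)"
    proof (intro tendsto_intros)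
      have "((\<lambda>x. norm (x - y)) \<longlongrightarrow> norm (y - y)) (at y)" by (intro tendsto_intros)
      then show "((\<lambda>x. norm (x - y) powr \<beta>) \<longlongrightarrow> 0) (at y)"
        using \<beta> by (auto intro!: tendsto_eq_intros)
    qed
    then have "((\<lambda>x. f x - f y) \<longlongrightarrow> 0) (at y)"
      by (intro Lim_null_comparison[of "\<lambda>x. f x - f y"]) (auto simp: h)
    then show ?thesis by (simp add: isCont_def LIM_zero_iff)
  qed
  then show ?thesis by (simp add: continuous_at_imp_continuous_on)
next
  case (Suc k)
  then have "f differentiable (at x)" for x using f unfolding holder_class_iff holder_derivs_def by simp
  then show ?thesis
    by (simp add: continuous_at_imp_continuous_on differentiable_imp_continuous_within)
qed

lemma holder_class_measurable:
  assumes "\<beta> > 0" "f \<in> holder_class \<beta> L"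
  shows "f \<in> borel_measurable borel"
  using holder_class_continuous[OF assms] by (rule borel_measurable_continuous_onI)

text \<open>If at least one derivative exists, each first partial derivative also vanishes outside
  the box and has one derivative less, so it is bounded and the mean value theorem applies;
  otherwise the claim is the Hoelder condition itself. Uniformity in \<open>f\<close> is what later
  gives one labelling for the entire class.\<close>

lemma holder_class_equicontinuous:
  assumes \<beta>: "\<beta> > 0" and L: "L > 0"
  shows "\<exists>B>0. \<exists>w>0. \<forall>f\<in>(holder_class \<beta> L :: (real ^ 'd::finite \<Rightarrow> real) set). \<forall>x i t.
    0 \<le> t \<longrightarrow> \<bar>f (x + t *\<^sub>R axis i 1) - f x\<bar> \<le> B * t powr w"
proof (cases "strict_floor \<beta>")
  case 0
  have "\<bar>f (x + t *\<^sub>R axis i 1) - f x\<bar> \<le> L * t powr \<beta>"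
    if "f \<in> holder_class \<beta> L" "0 \<le> t" for f :: "real ^ 'd \<Rightarrow> real" and x i t
  proof -
    have "\<bar>f u - f v\<bar> \<le> L * norm (u - v) powr \<beta>" for u v
      using that(1) 0 unfolding holder_class_iff holder_derivs_def by auto
    from this[of "x + t *\<^sub>R axis i 1" x]
    have "\<bar>f (x + t *\<^sub>R axis i 1) - f x\<bar> \<le> L * norm (x + t *\<^sub>R axis i 1 - x) powr \<beta>" .
    then show ?thesis using that(2) by (simp add: norm_axis_1)
  qed
  then show ?thesis using \<beta> L by blast
next
  case (Suc k)
  define \<alpha> where "\<alpha> = \<beta> - real (Suc k)"
  have \<alpha>: "\<alpha> > 0" using strict_floor_bounds[OF \<beta>] Suc by (simp add: \<alpha>_def)
  let ?B = "L * real CARD('d) ^ k * (2 * real CARD('d)) powr (real k + \<alpha>)"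
  have "\<bar>f (x + t *\<^sub>R axis i 1) - f x\<bar> \<le> ?B * t powr 1"
    if f: "f \<in> holder_class \<beta> L" and t: "0 \<le> t" for f :: "real ^ 'd \<Rightarrow> real" and x i t
  proof (cases "t = 0")
    case False
    have hd: "holder_derivs (Suc k) \<alpha> L f" and z: "\<And>x. x \<notin> unit_box \<Longrightarrow> f x = 0"
      using f Suc unfolding holder_class_iff \<alpha>_def by auto
    have hp: "holder_derivs k \<alpha> L (partial_deriv i f)"
      using hd unfolding holder_derivs_def iter_partial_snoc[symmetric] by auto
    have b: "\<bar>partial_deriv i f y\<bar> \<le> ?B" for y
      by (rule holder_derivs_bounded[OF hp \<alpha>])
         (use L in \<open>auto intro: partial_deriv_outside[OF closed_cbox z]\<close>)
    have d: "((\<lambda>s. f (x + s *\<^sub>R axis i 1)) has_real_derivative partial_deriv i f (x + s *\<^sub>R axis i 1)) (at s)" for s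
    proof -
      have "(\<Sum>j\<in>UNIV. axis i (1::real) $ j * q j) = q i" for q :: "'d \<Rightarrow> real"
        by (simp add: axis_def mult_delta_left)
      from this[of "\<lambda>j. partial_deriv j f (x + s *\<^sub>R axis i 1)"] show ?thesis
        using line_derivative[of f x s "axis i 1"] hd unfolding holder_derivs_def by simp
    qed
    obtain s where "f (x + t *\<^sub>R axis i 1) - f (x + 0 *\<^sub>R axis i 1) = (t - 0) * partial_deriv i f (x + s *\<^sub>R axis i 1)"
      using MVT2[of 0 t "\<lambda>s. f (x + s *\<^sub>R axis i 1)" "\<lambda>s. partial_deriv i f (x + s *\<^sub>R axis i 1)"] d t False by auto
    then show ?thesis using b t by (simp add: abs_mult mult.commute[of t] mult_right_mono)
  qed simp
  moreover have "?B > 0" using L by simp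
  ultimately show ?thesis by (metis zero_less_one)
qed

lemma L2_bounded_support:
  fixes f :: "'a::euclidean_space \<Rightarrow> real"
  assumes m: "f \<in> borel_measurable borel" and b: "\<And>x. \<bar>f x\<bar> \<le> B" and z: "\<And>x. x \<notin> cbox c d \<Longrightarrow> f x = 0"
  shows "f \<in> L2_space" "L2_norm f \<le> B * sqrt (measure lborel (cbox c d))"
proof -
  have B: "B \<ge> 0" using b[of undefined] by linarith
  have le: "(f x)\<^sup>2 \<le> B\<^sup>2 * indicator (cbox c d) x" for x
    using b[of x] z[of x] B abs_le_square_iff[of "f x" B] by (auto simp: indicator_def)
  have i: "integrable lborel (\<lambda>x. B\<^sup>2 * indicator (cbox c d) x :: real)"
    by (intro integrable_mult_right integrable_real_indicator emeasure_bounded_finite) auto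
  have "integrable lborel (\<lambda>x. (f x)\<^sup>2)"
    by (rule Bochner_Integration.integrable_bound[OF i]) (use m le in \<open>auto intro: order_trans\<close>)
  then show "f \<in> L2_space" using m by (simp add: L2_space_def)
  have "(\<integral>x. (f x)\<^sup>2 \<partial>lborel) \<le> (\<integral>x. B\<^sup>2 * indicator (cbox c d) x \<partial>lborel)"
    by (rule integral_mono) (use le i \<open>integrable lborel (\<lambda>x. (f x)\<^sup>2)\<close> in auto)
  also have "\<dots> = B\<^sup>2 * measure lborel (cbox c d)" by simp
  finally have "L2_norm f \<le> sqrt (B\<^sup>2 * measure lborel (cbox c d))" by (simp add: L2_norm_def)
  then show "L2_norm f \<le> B * sqrt (measure lborel (cbox c d))" using B by (simp add: real_sqrt_mult)
qed

lemma holder_class_L2: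
  assumes "\<beta> > 0" "L > 0"
  shows "(holder_class \<beta> L :: (real ^ 'd::finite \<Rightarrow> real) set) \<subseteq> L2_space"
proof
  fix f :: "real ^ 'd \<Rightarrow> real" assume f: "f \<in> holder_class \<beta> L"
  obtain B where "\<forall>f\<in>(holder_class \<beta> L :: (real ^ 'd \<Rightarrow> real) set). \<forall>x. \<bar>f x\<bar> \<le> B"
    using holder_class_bounded[OF assms] by blast
  moreover have "f x = 0" if "x \<notin> unit_box" for x
    using f that unfolding holder_class_iff by blast
  ultimately show "f \<in> L2_space"
    using f holder_class_measurable[OF assms(1) f]
    by (intro L2_bounded_support(1)[of f B "\<chi> i. - 1/2" "\<chi> i. 1/2"]) auto
qed

subsection \<open>Piecewise polynomial approximation\<close>

text \<open>A monomial centered at the lower corner of the grid cell \<open>k\<close> and cut off to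
  that cell. The cells are half-open, so that no point lies in two of them.\<close>

definition cell_fun :: "nat \<Rightarrow> ('d::finite \<Rightarrow> nat) \<Rightarrow> 'd list \<Rightarrow> real ^ 'd \<Rightarrow> real" where
  "cell_fun N k is x = (\<Prod>i\<in>UNIV. indicator {real (k i)..<real (k i) + 1} (real N * (x $ i + 1/2)))
     * list_monom (x - (\<chi> i. real (k i) / real N - 1/2)) is"

lemma measurable_vec_nth [measurable]: "(\<lambda>x :: real ^ 'd::finite. x $ i) \<in> borel_measurable borel"
  by (intro borel_measurable_continuous_onI continuous_intros)

lemma measurable_list_monom [measurable]:
  "(\<lambda>x :: real ^ 'd::finite. list_monom (x - a) is) \<in> borel_measurable borel"
  by (induction "is") (auto simp: list_monom_def)

lemma cell_coordinates:
  assumes N: "N \<ge> 1" and c: "\<And>i. real N * (x $ i + 1/2) \<in> {real (k i)..<real (k i) + 1}"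
  shows "0 \<le> (x - (\<chi> i. real (k i) / real N - 1/2)) $ i" "(x - (\<chi> i. real (k i) / real N - 1/2)) $ i \<le> 1 / real N"
proof -
  have "real (k i) / real N \<le> x $ i + 1/2" "x $ i + 1/2 \<le> (real (k i) + 1) / real N"
    using c[of i] N by (auto simp: pos_le_divide_eq pos_divide_le_eq mult.commute)
  then show "0 \<le> (x - (\<chi> i. real (k i) / real N - 1/2)) $ i"
    "(x - (\<chi> i. real (k i) / real N - 1/2)) $ i \<le> 1 / real N"
    by (auto simp: add_divide_distrib)
qed

lemma cell_fun_nonzero:
  assumes "cell_fun N k is x \<noteq> 0"
  shows "real N * (x $ i + 1/2) \<in> {real (k i)..<real (k i) + 1}"
proof -
  have "indicator {real (k i)..<real (k i) + 1} (real N * (x $ i + 1/2)) \<noteq> (0::real)"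
    using assms unfolding cell_fun_def by (auto simp: prod_zero_iff)
  then show ?thesis by (auto simp: indicator_def split: if_splits)
qed

text \<open>Points of the unit box with a coordinate equal to 1/2 fall into cells of index
  \<open>N\<close>, so these are included; they stick out of the unit box by up to one mesh
  width.\<close>

abbreviation big_box :: "(real ^ 'd::finite) set" where
  "big_box \<equiv> cbox (\<chi> i. - 1/2) (\<chi> i. 3/2)"

lemma cell_subset_big_box:
  fixes x :: "real ^ 'd::finite"
  assumes N: "N \<ge> 1" and k: "\<And>i. k i \<le> N"
    and c: "\<And>i. real N * (x $ i + 1/2) \<in> {real (k i)..<real (k i) + 1}"
  shows "x \<in> big_box"
proof -
  have "- 1/2 \<le> x $ i \<and> x $ i \<le> 3/2" for i
  proof -
    have "0 \<le> (x - (\<chi> i. real (k i) / real N - 1/2)) $ i" "(x - (\<chi> i. real (k i) / real N - 1/2)) $ i \<le> 1 / real N"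
      by (rule cell_coordinates[OF N c])+
    moreover have "0 \<le> real (k i) / real N" "real (k i) / real N \<le> 1" "1 / real N \<le> 1" using k[of i] N by (auto simp: field_simps)
    ultimately show ?thesis unfolding vector_minus_component vec_lambda_beta by linarith
  qed
  then show ?thesis by (auto simp: mem_box_cart)
qed

lemma cell_fun_L2:
  fixes k :: "'d::finite \<Rightarrow> nat"
  assumes N: "N \<ge> 1" and k: "\<And>i. k i \<le> N"
  shows "cell_fun N k is \<in> L2_space"
proof (rule L2_bounded_support(1)[where c = "\<chi> i. - 1/2" and d = "\<chi> i. 3/2" and B = 1])
  show "cell_fun N k is \<in> borel_measurable borel" unfolding cell_fun_def by measurable
  show "\<bar>cell_fun N k is x\<bar> \<le> 1" for x
  proof (cases "cell_fun N k is x = 0")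
    case False
    note c = cell_fun_nonzero[OF False]
    have "\<bar>list_monom (x - (\<chi> i. real (k i) / real N - 1/2)) is\<bar> \<le> 1 ^ length is"
    proof (rule abs_list_monom_le)
      fix i
      have "1 / real N \<le> 1" using N by simp
      then show "\<bar>(x - (\<chi> i. real (k i) / real N - 1/2)) $ i\<bar> \<le> 1"
        using cell_coordinates[OF N c, of i] by linarith
    qed simp
    moreover have "(\<Prod>i\<in>UNIV. indicator {real (k i)..<real (k i) + 1} (real N * (x $ i + 1/2))) = (1::real)"
      using c by (intro prod.neutral) auto
    ultimately show ?thesis by (simp add: cell_fun_def)
  qed simp
  show "cell_fun N k is x = 0" if "x \<notin> big_box" for x
  proof (rule ccontr)
    assume "cell_fun N k is x \<noteq> 0"
    from cell_subset_big_box[OF N k cell_fun_nonzero[OF this]] that show False by blast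
  qed
qed

text \<open>On each cell the approximant is the Taylor polynomial at the corner, which is within
  distance \<open>CARD('d) / N\<close>. Off the cells both functions vanish, so the uniform error
  becomes an L2 error at the price of the volume of \<open>big_box\<close>.\<close>

lemma holder_piecewise_approx:
  fixes f :: "real ^ 'd::finite \<Rightarrow> real"
  assumes \<beta>: "\<beta> > 0" and L: "L > 0" and N: "N \<ge> 1" and f: "f \<in> holder_class \<beta> L"
  defines "I \<equiv> (UNIV \<rightarrow> {0..N}) \<times> {is. length is \<le> strict_floor \<beta>}"
  shows "\<exists>a. L2_norm (\<lambda>x. f x - (\<Sum>p\<in>I. a p * cell_fun N (fst p) (snd p) x))
    \<le> L * real CARD('d) ^ strict_floor \<beta> * (real CARD('d)) powr \<beta> * sqrt (measure lborel (big_box :: (real ^ 'd) set)) * real N powr (- \<beta>)"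
proof -
  let ?k = "strict_floor \<beta>"
  define corner where "corner k = (\<chi> i. real (k i) / real N - 1/2)" for k :: "'d \<Rightarrow> nat"
  define a where "a p = (iter_partial (snd p) f (corner (fst p)) / fact (length (snd p)))" for p
  define P where "P x = (\<Sum>p\<in>I. a p * cell_fun N (fst p) (snd p) x)" for x
  have fl: "finite {is :: 'd list. length is \<le> ?k}"
    using finite_lists_length_le[of "UNIV :: 'd set" ?k] by simp
  have fc: "finite ((UNIV :: 'd set) \<rightarrow> {0..N})"
    using finite_PiE[of "UNIV :: 'd set" "\<lambda>_. {0..N}"] by (simp add: PiE_UNIV_domain)
  have hd: "holder_derivs ?k (\<beta> - real ?k) L f" and z: "\<And>x. x \<notin> unit_box \<Longrightarrow> f x = 0"
    using f unfolding holder_class_iff by auto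
  let ?B = "L * real CARD('d) ^ ?k * (real CARD('d) / real N) powr \<beta>"
  have Bpos: "?B \<ge> 0" using L by simp
  have "\<bar>f x - P x\<bar> \<le> ?B \<and> (x \<notin> big_box \<longrightarrow> f x - P x = 0)" for x
  proof (cases "\<exists>k\<in>UNIV \<rightarrow> {0..N}. \<forall>i. real N * (x $ i + 1/2) \<in> {real (k i)..<real (k i) + 1}")
    case True
    then obtain k where k: "k \<in> UNIV \<rightarrow> {0..N}" and c: "\<And>i. real N * (x $ i + 1/2) \<in> {real (k i)..<real (k i) + 1}"
      by blast
    have kN: "k i \<le> N" for i using k by (auto simp: Pi_def)
    have un: "k' = k" if "cell_fun N k' is x \<noteq> 0" for k' "is"
    proof
      fix i
      have "real N * (x $ i + 1/2) \<in> {real (k' i)..<real (k' i) + 1}" by (rule cell_fun_nonzero[OF that])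
      then show "k' i = k i" using c[of i] by auto
    qed
    have one: "cell_fun N k is x = list_monom (x - corner k) is" for "is"
    proof -
      have "(\<Prod>i\<in>UNIV. indicator {real (k i)..<real (k i) + 1} (real N * (x $ i + 1/2))) = (1::real)"
        using c by (intro prod.neutral) auto
      then show ?thesis by (simp add: cell_fun_def corner_def)
    qed
    have "P x = (\<Sum>k'\<in>UNIV \<rightarrow> {0..N}. \<Sum>is | length is \<le> ?k. a (k', is) * cell_fun N k' is x)"
      unfolding P_def I_def by (simp add: sum.cartesian_product case_prod_unfold)
    also have "\<dots> = (\<Sum>k'\<in>{k}. \<Sum>is | length is \<le> ?k. a (k', is) * cell_fun N k' is x)"
      by (rule sum.mono_neutral_right[OF fc]) (use k un in \<open>auto intro!: sum.neutral\<close>)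
    also have "\<dots> = (\<Sum>is | length is \<le> ?k. a (k, is) * list_monom (x - corner k) is)"
      by (simp add: one)
    also have "{is :: 'd list. length is \<le> ?k} = (\<Union>l\<in>{..?k}. index_lists l)"
      by (auto simp: index_lists_def)
    also have "(\<Sum>is\<in>\<dots>. a (k, is) * list_monom (x - corner k) is)
      = (\<Sum>l\<le>?k. \<Sum>is\<in>index_lists l. a (k, is) * list_monom (x - corner k) is)"
      by (rule sum.UNION_disjoint) (auto simp: finite_index_lists, auto simp: index_lists_def)
    also have "\<dots> = (\<Sum>l\<le>?k. \<Sum>is\<in>index_lists l. iter_partial is f (corner k) / fact l * list_monom (x - corner k) is)"
      by (intro sum.cong refl) (auto simp: a_def index_lists_def)
    finally have "\<bar>f x - P x\<bar> \<le> L * real CARD('d) ^ ?k * norm (x - corner k) powr (real ?k + (\<beta> - real ?k))"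
      using holder_taylor[OF hd, of x "corner k"] strict_floor_bounds[OF \<beta>] L by simp
    also have "\<dots> \<le> L * real CARD('d) ^ ?k * (real CARD('d) / real N) powr (real ?k + (\<beta> - real ?k))"
    proof (intro mult_left_mono powr_mono2)
      have "norm (x - corner k) \<le> (\<Sum>i\<in>UNIV. \<bar>(x - corner k) $ i\<bar>)" by (rule norm_le_l1_cart)
      also have "\<dots> \<le> (\<Sum>i\<in>(UNIV :: 'd set). 1 / real N)"
        unfolding corner_def using cell_coordinates[OF N c] by (intro sum_mono) (auto simp: abs_of_nonneg)
      finally show "norm (x - corner k) \<le> real CARD('d) / real N" by simp
    qed (use L \<beta> in auto)
    finally show ?thesis using cell_subset_big_box[OF N kN c] by auto
  next
    case False
    have P0: "P x = 0"
      unfolding P_def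
    proof (intro sum.neutral ballI)
      fix p assume p: "p \<in> I"
      then have "cell_fun N (fst p) (snd p) x = 0"
        using False cell_fun_nonzero[of N "fst p" "snd p" x] unfolding I_def by (cases p) auto
      then show "a p * cell_fun N (fst p) (snd p) x = 0" by simp
    qed
    have "x \<notin> unit_box"
    proof
      assume x: "x \<in> unit_box"
      define k where "k i = nat \<lfloor>real N * (x $ i + 1/2)\<rfloor>" for i
      have "k i \<le> N \<and> real N * (x $ i + 1/2) \<in> {real (k i)..<real (k i) + 1}" for i
      proof -
        have b: "- 1/2 \<le> x $ i" "x $ i \<le> 1/2" using x by (auto simp: mem_box_cart)
        then have "0 \<le> real N * (x $ i + 1/2)" by simp
        moreover have "real N * (x $ i + 1/2) \<le> real N * 1" using b by (intro mult_left_mono) auto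
        ultimately have fl: "0 \<le> \<lfloor>real N * (x $ i + 1/2)\<rfloor>" "\<lfloor>real N * (x $ i + 1/2)\<rfloor> \<le> int N" by (auto, linarith)
        then have "real (k i) = of_int \<lfloor>real N * (x $ i + 1/2)\<rfloor>" by (simp add: k_def)
        then show ?thesis using fl by (auto simp: k_def)
      qed
      then show False using False by (auto simp: Pi_def)
    qed
    then show ?thesis using z P0 Bpos by auto
  qed
  moreover have "(\<lambda>x. f x - P x) \<in> borel_measurable borel"
  proof -
    have "P \<in> L2_space"
      unfolding P_def I_def by (intro L2_sum L2_cmult cell_fun_L2[OF N]) (auto simp: Pi_def)
    then show ?thesis using L2_measurable holder_class_measurable[OF \<beta> f] by measurable
  qed
  ultimately have "L2_norm (\<lambda>x. f x - P x) \<le> ?B * sqrt (measure lborel (big_box :: (real ^ 'd) set))"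
    by (intro L2_bounded_support(2)) auto
  also have "?B = L * real CARD('d) ^ ?k * real CARD('d) powr \<beta> * real N powr (- \<beta>)"
    using N by (simp add: powr_divide powr_minus_divide)
  finally show ?thesis unfolding P_def by (intro exI[of _ a]) (simp add: mult_ac)
qed

text \<open>Only the coefficients of the Taylor pieces depend on \<open>f\<close>, not the cells or
  the monomials, so one space serves the whole class. Both the nets and the projection estimator are
  built on it.\<close>

lemma holder_class_subspaces:
  assumes \<beta>: "\<beta> > 0" and L: "L > 0"
  shows "\<exists>M>0. \<exists>C>0. \<forall>j::nat. \<exists>(\<phi> :: nat \<Rightarrow> real ^ 'd::finite \<Rightarrow> real) r.
    orthonormal \<phi> r \<and> real r \<le> M * 2 ^ (j * CARD('d)) \<and>
    (\<forall>f\<in>holder_class \<beta> L. L2_norm (\<lambda>x. f x - proj \<phi> r f x) \<le> C * 2 powr (- \<beta> * real j))"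
proof -
  let ?k = "strict_floor \<beta>"
  let ?J = "{is :: 'd list. length is \<le> ?k}"
  \<comment> \<open>The factor \<open>2 ^ CARD('d)\<close> absorbs the extra cell in each direction,
    by \<open>N + 1 \<le> 2 * N\<close>.\<close>
  define M where "M = 2 ^ CARD('d) * real (card ?J)"
  define C where "C = L * real CARD('d) ^ strict_floor \<beta> * (real CARD('d)) powr \<beta> * sqrt (measure lborel (big_box :: (real ^ 'd) set)) + 1"
  have fl: "finite ?J"
    using finite_lists_length_le[of "UNIV :: 'd set" ?k] by simp
  have "card ?J > 0" using fl by (auto simp: card_gt_0_iff intro: exI[of _ "[]"])
  then have M: "M > 0" by (simp add: M_def)
  have C: "C > 0" unfolding C_def using L by (intro add_nonneg_pos mult_nonneg_nonneg) auto
  have "\<exists>(\<phi> :: nat \<Rightarrow> real ^ 'd \<Rightarrow> real) r. orthonormal \<phi> r \<and> real r \<le> M * 2 ^ (j * CARD('d)) \<and>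
    (\<forall>f\<in>holder_class \<beta> L. L2_norm (\<lambda>x. f x - proj \<phi> r f x) \<le> C * 2 powr (- \<beta> * real j))" for j :: nat
  proof -
    define N where "N = (2::nat) ^ j"
    have N: "N \<ge> 1" by (simp add: N_def)
    define I where "I = ((UNIV :: 'd set) \<rightarrow> {0..N}) \<times> ?J"
    have fc: "finite ((UNIV :: 'd set) \<rightarrow> {0..N})"
      using finite_PiE[of "UNIV :: 'd set" "\<lambda>_. {0..N}"] by (simp add: PiE_UNIV_domain)
    have fI: "finite I" using fl fc by (simp add: I_def)
    have L2I: "cell_fun N (fst p) (snd p) \<in> L2_space" if "p \<in> I" for p
      using that by (intro cell_fun_L2 N) (auto simp: I_def Pi_def)
    obtain \<phi> r where r: "r \<le> card I" and o: "orthonormal \<phi> r"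
      and app: "\<And>f a. f \<in> L2_space \<Longrightarrow> L2_norm (\<lambda>x. f x - proj \<phi> r f x) \<le>
        L2_norm (\<lambda>x. f x - (\<Sum>p\<in>I. a p * cell_fun N (fst p) (snd p) x))"
      using orthonormal_spanning[OF fI, of "\<lambda>p. cell_fun N (fst p) (snd p)"] L2I by blast
    have "card ((UNIV :: 'd set) \<rightarrow> {0..N}) = (N + 1) ^ CARD('d)"
      using card_PiE[of "UNIV :: 'd set" "\<lambda>_. {0..N}"] by (simp add: PiE_UNIV_domain)
    then have "real (card I) = real (N + 1) ^ CARD('d) * real (card ?J)"
      by (simp add: I_def card_cartesian_product)
    also have "\<dots> \<le> (2 * real N) ^ CARD('d) * real (card ?J)"
      using N by (intro mult_right_mono power_mono) auto
    also have "\<dots> = M * 2 ^ (j * CARD('d))"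
      by (simp add: M_def N_def power_mult_distrib power_mult)
    finally have "real r \<le> M * 2 ^ (j * CARD('d))" using r by linarith
    moreover have "L2_norm (\<lambda>x. f x - proj \<phi> r f x) \<le> C * 2 powr (- \<beta> * real j)"
      if f: "f \<in> holder_class \<beta> L" for f
    proof -
      have fL: "f \<in> L2_space" using holder_class_L2[OF assms] f by blast
      obtain a where a: "L2_norm (\<lambda>x. f x - (\<Sum>p\<in>I. a p * cell_fun N (fst p) (snd p) x)) \<le> (C - 1) * real N powr (- \<beta>)"
        using holder_piecewise_approx[OF assms N f] unfolding I_def C_def by auto
      have "L2_norm (\<lambda>x. f x - proj \<phi> r f x) \<le> (C - 1) * real N powr (- \<beta>)"
        using app[OF fL, of a] a by linarith
      also have "\<dots> \<le> C * real N powr (- \<beta>)" by (intro mult_right_mono) auto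
      also have "real N powr (- \<beta>) = 2 powr (- \<beta> * real j)"
        by (simp add: N_def powr_realpow[symmetric] powr_powr mult.commute)
      finally show ?thesis .
    qed
    ultimately show ?thesis using o by blast
  qed
  then show ?thesis using M C by blast
qed

subsection \<open>Product measures\<close>

lemma product_integral_one:
  fixes g :: "'a \<Rightarrow> real"
  assumes D: "prob_space D" and I: "finite I" "k \<in> I" and g: "integrable D g"
  shows "integrable (PiM I (\<lambda>_. D)) (\<lambda>x. g (x k))"
    and "(\<integral>x. g (x k) \<partial>PiM I (\<lambda>_. D)) = (\<integral>x. g x \<partial>D)"
proof -
  interpret D: prob_space D by fact
  interpret product_sigma_finite "\<lambda>_. D" ..
  let ?h = "\<lambda>i. if i = k then g else (\<lambda>_. 1)"
  have h: "integrable D (?h i)" for i using g by simp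
  have e: "(\<Prod>i\<in>I. ?h i (x i)) = g (x k)" for x :: "_ \<Rightarrow> 'a"
  proof -
    have "(\<Prod>i\<in>I. ?h i (x i)) = (\<Prod>i\<in>I. if i = k then g (x i) else 1)" by (intro prod.cong) auto
    then show ?thesis using I by simp
  qed
  have e2: "(\<Prod>i\<in>I. integral\<^sup>L D (?h i)) = (\<integral>x. g x \<partial>D)"
  proof -
    have "(\<Prod>i\<in>I. integral\<^sup>L D (?h i)) = (\<Prod>i\<in>I. if i = k then (\<integral>x. g x \<partial>D) else 1)"
      by (intro prod.cong) (auto simp: D.prob_space)
    then show ?thesis using I by simp
  qed
  show "integrable (PiM I (\<lambda>_. D)) (\<lambda>x. g (x k))"
    using product_integrable_prod[OF I(1), of ?h] h unfolding e by blast
  show "(\<integral>x. g (x k) \<partial>PiM I (\<lambda>_. D)) = (\<integral>x. g x \<partial>D)"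
    using product_integral_prod[OF I(1), of ?h] h unfolding e e2 by blast
qed

lemma product_integral_two:
  fixes g :: "'a \<Rightarrow> real"
  assumes D: "prob_space D" and I: "finite I" "k \<in> I" "l \<in> I" "k \<noteq> l" and g: "integrable D g"
  shows "integrable (PiM I (\<lambda>_. D)) (\<lambda>x. g (x k) * g (x l))"
    and "(\<integral>x. g (x k) * g (x l) \<partial>PiM I (\<lambda>_. D)) = (\<integral>x. g x \<partial>D)\<^sup>2"
proof -
  interpret D: prob_space D by fact
  interpret product_sigma_finite "\<lambda>_. D" ..
  let ?h = "\<lambda>i. if i = k \<or> i = l then g else (\<lambda>_. 1)"
  have h: "integrable D (?h i)" for i using g by simp
  have split: "(\<Prod>i\<in>I. if i = k \<or> i = l then c i else 1) = c k * c l" for c :: "_ \<Rightarrow> real"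
  proof -
    have "(\<Prod>i\<in>I. if i = k \<or> i = l then c i else 1) = (\<Prod>i\<in>{k, l}. if i = k \<or> i = l then c i else 1)"
      by (rule prod.mono_neutral_right) (use I in auto)
    also have "\<dots> = c k * c l" using I by simp
    finally show ?thesis .
  qed
  have e: "(\<Prod>i\<in>I. ?h i (x i)) = g (x k) * g (x l)" for x :: "_ \<Rightarrow> 'a"
  proof -
    have "(\<Prod>i\<in>I. ?h i (x i)) = (\<Prod>i\<in>I. if i = k \<or> i = l then g (x i) else 1)" by (intro prod.cong) auto
    also have "\<dots> = g (x k) * g (x l)" by (rule split)
    finally show ?thesis .
  qed
  have e2: "(\<Prod>i\<in>I. integral\<^sup>L D (?h i)) = (\<integral>x. g x \<partial>D)\<^sup>2"
  proof -
    have "(\<Prod>i\<in>I. integral\<^sup>L D (?h i)) = (\<Prod>i\<in>I. if i = k \<or> i = l then (\<integral>x. g x \<partial>D) else 1)"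
      by (intro prod.cong) (auto simp: D.prob_space)
    also have "\<dots> = (\<integral>x. g x \<partial>D) * (\<integral>x. g x \<partial>D)" by (rule split)
    finally show ?thesis by (simp add: power2_eq_square)
  qed
  show "integrable (PiM I (\<lambda>_. D)) (\<lambda>x. g (x k) * g (x l))"
    using product_integrable_prod[OF I(1), of ?h] h unfolding e by blast
  show "(\<integral>x. g (x k) * g (x l) \<partial>PiM I (\<lambda>_. D)) = (\<integral>x. g x \<partial>D)\<^sup>2"
    using product_integral_prod[OF I(1), of ?h] h unfolding e e2 by blast
qed

text \<open>Independence turns the mixed terms into squares of the mean, which is zero.\<close>

lemma integral_centered_sum_power2:
  fixes g :: "'a \<Rightarrow> real"
  assumes D: "prob_space D" and I: "finite I" and g: "integrable D g" "integrable D (\<lambda>x. (g x)\<^sup>2)"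
    and z: "(\<integral>x. g x \<partial>D) = 0"
  shows "integrable (PiM I (\<lambda>_. D)) (\<lambda>x. (\<Sum>k\<in>I. g (x k))\<^sup>2)"
    and "(\<integral>x. (\<Sum>k\<in>I. g (x k))\<^sup>2 \<partial>PiM I (\<lambda>_. D)) = real (card I) * (\<integral>x. (g x)\<^sup>2 \<partial>D)"
proof -
  let ?P = "PiM I (\<lambda>_. D)"
  have e: "(\<Sum>k\<in>I. g (x k))\<^sup>2 = (\<Sum>k\<in>I. \<Sum>l\<in>I. g (x k) * g (x l))" for x :: "_ \<Rightarrow> 'a"
    by (simp add: power2_eq_square sum_product)
  have i: "integrable ?P (\<lambda>x. g (x k) * g (x l))" and
    v: "(\<integral>x. g (x k) * g (x l) \<partial>?P) = (if k = l then (\<integral>x. (g x)\<^sup>2 \<partial>D) else 0)"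
    if "k \<in> I" "l \<in> I" for k l
  proof -
    have "integrable ?P (\<lambda>x. g (x k) * g (x l)) \<and>
      (\<integral>x. g (x k) * g (x l) \<partial>?P) = (if k = l then (\<integral>x. (g x)\<^sup>2 \<partial>D) else 0)"
    proof (cases "k = l")
      case True
      then show ?thesis using product_integral_one[OF D I that(1) g(2)] by (simp add: power2_eq_square)
    next
      case False
      then show ?thesis using product_integral_two[OF D I that False g(1)] z by simp
    qed
    then show "integrable ?P (\<lambda>x. g (x k) * g (x l))"
      "(\<integral>x. g (x k) * g (x l) \<partial>?P) = (if k = l then (\<integral>x. (g x)\<^sup>2 \<partial>D) else 0)" by blast+
  qed
  show "integrable ?P (\<lambda>x. (\<Sum>k\<in>I. g (x k))\<^sup>2)"
    unfolding e using i by auto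
  have "(\<integral>x. (\<Sum>k\<in>I. g (x k))\<^sup>2 \<partial>?P) = (\<Sum>k\<in>I. \<Sum>l\<in>I. (\<integral>x. g (x k) * g (x l) \<partial>?P))"
    unfolding e using i by (simp add: Bochner_Integration.integral_sum)
  also have "\<dots> = (\<Sum>k\<in>I. \<Sum>l\<in>I. if k = l then (\<integral>x. (g x)\<^sup>2 \<partial>D) else 0)"
    using v by (intro sum.cong) auto
  also have "\<dots> = real (card I) * (\<integral>x. (g x)\<^sup>2 \<partial>D)"
    using I by simp
  finally show "(\<integral>x. (\<Sum>k\<in>I. g (x k))\<^sup>2 \<partial>?P) = real (card I) * (\<integral>x. (g x)\<^sup>2 \<partial>D)" .
qed

text \<open>The variance is replaced by the second moment because the latter is easy to control: a
  normalized basis function has second moment at most \<open>B\<close> under a density bounded by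
  \<open>B\<close>.\<close>

lemma integral_mean_error_power2:
  fixes g :: "'a \<Rightarrow> real"
  assumes D: "prob_space D" and n: "n \<ge> 1" and g: "integrable D g" "integrable D (\<lambda>x. (g x)\<^sup>2)"
  defines "\<mu> \<equiv> (\<integral>x. g x \<partial>D)"
  shows "integrable (PiM {1..n} (\<lambda>_. D)) (\<lambda>x. ((\<Sum>k\<in>{1..n}. g (x k)) / real n - \<mu>)\<^sup>2)"
    and "(\<integral>x. ((\<Sum>k\<in>{1..n}. g (x k)) / real n - \<mu>)\<^sup>2 \<partial>PiM {1..n} (\<lambda>_. D)) \<le> (\<integral>x. (g x)\<^sup>2 \<partial>D) / real n"
proof -
  interpret D: prob_space D by fact
  let ?g = "\<lambda>x. g x - \<mu>"
  have sq: "(?g x)\<^sup>2 = (g x)\<^sup>2 - 2 * \<mu> * g x + \<mu>\<^sup>2" for x by (simp add: power2_diff)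
  have c1: "integrable D ?g" using g by simp
  have c2: "integrable D (\<lambda>x. (?g x)\<^sup>2)" unfolding sq using g by simp
  have c3: "(\<integral>x. ?g x \<partial>D) = 0" using g by (simp add: \<mu>_def D.prob_space)
  have c4: "(\<integral>x. (?g x)\<^sup>2 \<partial>D) \<le> (\<integral>x. (g x)\<^sup>2 \<partial>D)"
  proof -
    have "(\<integral>x. (?g x)\<^sup>2 \<partial>D) = (\<integral>x. (g x)\<^sup>2 \<partial>D) - 2 * \<mu> * \<mu> + \<mu>\<^sup>2"
      unfolding sq using g by (simp add: \<mu>_def D.prob_space)
    then show ?thesis by (simp add: power2_eq_square)
  qed
  have e: "((\<Sum>k\<in>{1..n}. g (x k)) / real n - \<mu>)\<^sup>2 = (\<Sum>k\<in>{1..n}. ?g (x k))\<^sup>2 / (real n)\<^sup>2" for x :: "_ \<Rightarrow> 'a"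
    using n by (simp add: sum_subtractf power_divide[symmetric] diff_divide_distrib)
  show "integrable (PiM {1..n} (\<lambda>_. D)) (\<lambda>x. ((\<Sum>k\<in>{1..n}. g (x k)) / real n - \<mu>)\<^sup>2)"
    unfolding e using integral_centered_sum_power2(1)[OF D _ c1 c2 c3, of "{1..n}"] by auto
  have "(\<integral>x. ((\<Sum>k\<in>{1..n}. g (x k)) / real n - \<mu>)\<^sup>2 \<partial>PiM {1..n} (\<lambda>_. D))
      = real n * (\<integral>x. (?g x)\<^sup>2 \<partial>D) / (real n)\<^sup>2"
    unfolding e using integral_centered_sum_power2(2)[OF D _ c1 c2 c3, of "{1..n}"] by simp
  also have "\<dots> = (\<integral>x. (?g x)\<^sup>2 \<partial>D) / real n" using n by (simp add: power2_eq_square)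
  also have "\<dots> \<le> (\<integral>x. (g x)\<^sup>2 \<partial>D) / real n" using c4 by (intro divide_right_mono) auto
  finally show "(\<integral>x. ((\<Sum>k\<in>{1..n}. g (x k)) / real n - \<mu>)\<^sup>2 \<partial>PiM {1..n} (\<lambda>_. D)) \<le> (\<integral>x. (g x)\<^sup>2 \<partial>D) / real n" .
qed

subsection \<open>Labels\<close>

abbreviation dens :: "('a::euclidean_space \<Rightarrow> real) \<Rightarrow> 'a measure" where
  "dens f \<equiv> density lborel (\<lambda>z. ennreal (f z))"

lemma holder_densitiesD:
  assumes "f \<in> holder_densities \<beta> L"
  shows "f \<in> holder_class \<beta> L" "\<And>x. 0 \<le> f x" "integrable lborel f" "(\<integral>x. f x \<partial>lborel) = 1"
    "f \<in> borel_measurable borel"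
  using assms borel_measurable_has_bochner_integral[of lborel f 1]
  by (auto simp: holder_densities_def has_bochner_integral_iff)

lemma prob_space_dens:
  assumes "f \<in> holder_densities \<beta> L"
  shows "prob_space (dens f)"
proof
  note f = holder_densitiesD[OF assms]
  have "(\<integral>\<^sup>+x. ennreal (f x) \<partial>lborel) = ennreal (\<integral>x. f x \<partial>lborel)"
    by (rule nn_integral_eq_integral) (use f in auto)
  then show "emeasure (dens f) (space (dens f)) = 1"
    using f by (simp add: emeasure_density)
qed

lemma integrable_dens_bounded:
  fixes g :: "'a::euclidean_space \<Rightarrow> real"
  assumes f: "f \<in> borel_measurable borel" "\<And>x. 0 \<le> f x" "\<And>x. f x \<le> B" and g: "integrable lborel g"
  shows "integrable (dens f) g" "(\<integral>x. g x \<partial>dens f) = (\<integral>x. f x * g x \<partial>lborel)"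
proof -
  have gm: "g \<in> borel_measurable borel" using g borel_measurable_integrable by fastforce
  have "integrable lborel (\<lambda>x. f x * g x)"
  proof (rule Bochner_Integration.integrable_bound)
    show "integrable lborel (\<lambda>x. B * g x)" using g by simp
    have "norm (f x * g x) \<le> norm (B * g x)" for x
      using f(2,3)[of x] by (simp add: abs_mult mult_right_mono)
    then show "AE x in lborel. norm (f x * g x) \<le> norm (B * g x)" by simp
  qed (use f gm in auto)
  then show "integrable (dens f) g"
    using f gm by (subst integrable_density) auto
  show "(\<integral>x. g x \<partial>dens f) = (\<integral>x. f x * g x \<partial>lborel)"
    using f gm by (subst integral_density) auto
qed

lemma measure_dens:
  assumes f: "f \<in> holder_densities \<beta> L" and A: "A \<in> sets borel"
  shows "measure (dens f) A = (\<integral>x. f x * indicator A x \<partial>lborel)"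
    "integrable lborel (\<lambda>x. f x * indicator A x)"
proof -
  note h = holder_densitiesD[OF f]
  show i: "integrable lborel (\<lambda>x. f x * indicator A x)"
    using integrable_mult_indicator[of A lborel f] h A by (simp add: mult.commute)
  have "emeasure (dens f) A = (\<integral>\<^sup>+x. ennreal (f x) * indicator A x \<partial>lborel)"
    using h A by (intro emeasure_density) auto
  also have "\<dots> = (\<integral>\<^sup>+x. ennreal (f x * indicator A x) \<partial>lborel)"
    by (intro nn_integral_cong) (auto simp: indicator_def)
  also have "\<dots> = ennreal (\<integral>x. f x * indicator A x \<partial>lborel)"
    using h by (intro nn_integral_eq_integral i) auto
  finally show "measure (dens f) A = (\<integral>x. f x * indicator A x \<partial>lborel)"
    unfolding measure_def using h by (simp add: integral_nonneg_AE)
qed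

lemma integral_translate:
  fixes g :: "'a::euclidean_space \<Rightarrow> real"
  assumes "g \<in> borel_measurable borel"
  shows "(\<integral>x. g (c + x) \<partial>lborel) = (\<integral>x. g x \<partial>lborel)"
proof -
  have "(\<integral>x. g x \<partial>lborel) = (\<integral>x. g x \<partial>distr lborel borel ((+) c))"
    by (simp add: lborel_distr_plus)
  also have "\<dots> = (\<integral>x. g (c + x) \<partial>lborel)"
    using assms by (subst integral_distr) auto
  finally show ?thesis by simp
qed

text \<open>
  The label of a point is the residue of a very fine discretization of one coordinate; shifting
  that coordinate permutes the labels cyclically, so equicontinuity makes them nearly uniform.
\<close>

lemma uniform_labels:
  assumes \<beta>: "\<beta> > 0" and L: "L > 0" and T: "T \<ge> (1::nat)"
  shows "\<exists>lab :: real ^ 'd::finite \<Rightarrow> nat. lab \<in> measurable borel (count_space UNIV) \<and> (\<forall>x. lab x < T) \<and>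
    (\<forall>f\<in>holder_densities \<beta> L. \<forall>l<T. 1 / (2 * real T) \<le> measure (dens f) {x. lab x = l} \<and>
      measure (dens f) {x. lab x = l} \<le> 2 / real T)"
proof -
  obtain B w where B: "B > 0" and w: "w > 0" and eq: "\<And>f x i t. f \<in> (holder_class \<beta> L :: (real ^ 'd \<Rightarrow> real) set) \<Longrightarrow>
    0 \<le> t \<Longrightarrow> \<bar>f (x + t *\<^sub>R axis i 1) - f x\<bar> \<le> B * t powr w"
    using holder_class_equicontinuous[OF \<beta> L] by blast
  define i :: 'd where "i = undefined"
  define box3 where "box3 = (cbox (\<chi> i. - 3/2) (\<chi> i. 3/2) :: (real ^ 'd) set)"
  define V where "V = measure lborel box3 + 1"
  have V: "V > 0" by (simp add: V_def add_nonneg_pos)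
  \<comment> \<open>Chosen so that a change of the density by at most \<open>B * \<epsilon>\<close>
    on a set of volume at most \<open>V\<close> changes a probability by at most
    \<open>1 / (4 * real T)\<close>.\<close>
  define \<epsilon> where "\<epsilon> = 1 / (4 * real T * B * V)"
  have e: "\<epsilon> > 0" using T B V by (simp add: \<epsilon>_def)
  \<comment> \<open>Shifts up to \<open>h\<close> change the density by at most
    \<open>B * \<epsilon>\<close>; the bound 1 keeps the shifted support inside \<open>box3\<close>.
    \<open>N\<close> is then so large that all shifts \<open>l / N\<close> with \<open>l < T\<close>
    are at most \<open>h\<close>.\<close>
  define h where "h = min 1 (\<epsilon> powr (1 / w))"
  have h: "h > 0" "h \<le> 1" using e by (auto simp: h_def)
  define N where "N = max 1 (real T / h)"
  have N: "N > 0" by (simp add: N_def)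
  have TN: "real T / N \<le> h" using h T by (simp add: N_def field_simps max_def)
  define lab where "lab x = nat (\<lfloor>N * x $ i\<rfloor> mod int T)" for x :: "real ^ 'd"
  have lm: "lab \<in> measurable borel (count_space UNIV)" unfolding lab_def by measurable
  have lT: "lab x < T" for x using T by (simp add: lab_def nat_less_iff)
  have setm: "{x. lab x = l} \<in> sets borel" for l
    using measurable_sets[OF lm, of "{l}"] by (simp add: vimage_def)
  have "1 / (2 * real T) \<le> measure (dens f) {x. lab x = l} \<and> measure (dens f) {x. lab x = l} \<le> 2 / real T"
    if f: "f \<in> holder_densities \<beta> L" and l: "l < T" for f l
  proof -
    interpret D: prob_space "dens f" by (rule prob_space_dens[OF f])
    note hf = holder_densitiesD[OF f]
    define p where "p l = measure (dens f) {x. lab x = l}" for l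
    have diff: "\<bar>p l - p 0\<bar> \<le> 1 / (4 * real T)" if l: "l < T" for l
    proof -
      define s where "s = real l / N"
      have s: "0 \<le> s" "s \<le> h" using l N TN divide_right_mono[of "real l" "real T" N] by (auto simp: s_def)
      define H where "H x = (indicator {x. lab x = 0} x :: real)" for x :: "real ^ 'd"
      have Hm: "H \<in> borel_measurable borel" unfolding H_def using setm by simp
      \<comment> \<open>Shifting by \<open>l / N\<close> adds exactly \<open>l\<close> to the floor,
        and thus carries label 0 to label \<open>l\<close>.\<close>
      have sh: "indicator {x. lab x = l} (s *\<^sub>R axis i 1 + x) = H x" for x
      proof -
        have "N * (s *\<^sub>R axis i 1 + x) $ i = N * x $ i + of_int (int l)"
          using N by (simp add: s_def axis_def field_simps)
        then have "\<lfloor>N * (s *\<^sub>R axis i 1 + x) $ i\<rfloor> = \<lfloor>N * x $ i\<rfloor> + int l"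
          by (metis floor_add_int)
        then have "lab (s *\<^sub>R axis i 1 + x) = nat ((\<lfloor>N * x $ i\<rfloor> + int l) mod int T)" by (simp add: lab_def)
        then have "lab (s *\<^sub>R axis i 1 + x) = l \<longleftrightarrow> (\<lfloor>N * x $ i\<rfloor> + int l) mod int T = int l"
          using T by (auto simp: nat_eq_iff)
        also have "\<dots> \<longleftrightarrow> (\<lfloor>N * x $ i\<rfloor> + int l) mod int T = int l mod int T" using l by simp
        also have "\<dots> \<longleftrightarrow> \<lfloor>N * x $ i\<rfloor> mod int T = 0" by (simp add: mod_eq_dvd_iff mod_eq_0_iff_dvd)
        also have "\<dots> \<longleftrightarrow> lab x = 0"
        proof -
          have "0 \<le> \<lfloor>N * x $ i\<rfloor> mod int T" using T by simp
          then show ?thesis unfolding lab_def by linarith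
        qed
        finally show ?thesis by (simp add: H_def indicator_def)
      qed
      have "p l = (\<integral>x. f x * indicator {x. lab x = l} x \<partial>lborel)"
        unfolding p_def by (rule measure_dens[OF f setm])
      also have "\<dots> = (\<integral>x. f (s *\<^sub>R axis i 1 + x) * indicator {x. lab x = l} (s *\<^sub>R axis i 1 + x) \<partial>lborel)"
        by (rule integral_translate[symmetric]) (use hf setm in auto)
      also have "\<dots> = (\<integral>x. f (x + s *\<^sub>R axis i 1) * H x \<partial>lborel)"
        unfolding sh by (simp add: add.commute)
      finally have pl: "p l = (\<integral>x. f (x + s *\<^sub>R axis i 1) * H x \<partial>lborel)" .
      have p0: "p 0 = (\<integral>x. f x * H x \<partial>lborel)"
        unfolding p_def H_def by (rule measure_dens[OF f setm])
      have zero: "f x = 0" if "x \<notin> unit_box" for x using hf(1) that unfolding holder_class_iff by blast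
      have bd: "\<bar>f (x + s *\<^sub>R axis i 1) * H x - f x * H x\<bar> \<le> B * s powr w * indicator box3 x" for x
      proof (cases "x \<in> box3")
        case True
        have "\<bar>f (x + s *\<^sub>R axis i 1) * H x - f x * H x\<bar> = \<bar>f (x + s *\<^sub>R axis i 1) - f x\<bar> * H x"
          by (simp add: H_def indicator_def)
        also have "\<dots> \<le> \<bar>f (x + s *\<^sub>R axis i 1) - f x\<bar>" by (simp add: H_def indicator_def)
        also have "\<dots> \<le> B * s powr w" by (rule eq[OF hf(1) s(1)])
        finally show ?thesis using True by simp
      next
        case False
        then obtain j where j: "x $ j < - 3/2 \<or> x $ j > 3/2" unfolding box3_def mem_box_cart by (auto simp: not_le)
        have "x \<notin> unit_box" "x + s *\<^sub>R axis i 1 \<notin> unit_box"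
        proof -
          show "x \<notin> unit_box" using j unfolding mem_box_cart by (auto intro!: exI[of _ j])
          have "(x + s *\<^sub>R axis i 1) $ j < - 1/2 \<or> (x + s *\<^sub>R axis i 1) $ j > 1/2"
            using j s h by (auto simp: axis_def)
          then show "x + s *\<^sub>R axis i 1 \<notin> unit_box" unfolding mem_box_cart by (metis vec_lambda_beta not_less)
        qed
        then show ?thesis using zero B by simp
      qed
      have ib: "integrable lborel (\<lambda>x. B * s powr w * indicator box3 x :: real)"
        unfolding box3_def
        by (intro integrable_mult_right integrable_real_indicator emeasure_bounded_finite) auto
      have i0: "integrable lborel (\<lambda>x. f x * H x)" unfolding H_def by (rule measure_dens[OF f setm])
      have id: "integrable lborel (\<lambda>x. f (x + s *\<^sub>R axis i 1) * H x - f x * H x)"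
        by (rule Bochner_Integration.integrable_bound[OF ib]) (use hf Hm bd B in \<open>auto intro: order_trans\<close>)
      have i1: "integrable lborel (\<lambda>x. f (x + s *\<^sub>R axis i 1) * H x)"
        using Bochner_Integration.integrable_add[OF id i0] by simp
      have "p l - p 0 = (\<integral>x. f (x + s *\<^sub>R axis i 1) * H x - f x * H x \<partial>lborel)"
        unfolding pl p0 by (rule Bochner_Integration.integral_diff[OF i1 i0, symmetric])
      then have "\<bar>p l - p 0\<bar> \<le> (\<integral>x. \<bar>f (x + s *\<^sub>R axis i 1) * H x - f x * H x\<bar> \<partial>lborel)"
        using integral_abs_bound by metis
      also have "\<dots> \<le> (\<integral>x. B * s powr w * indicator box3 x \<partial>lborel)"
        by (rule integral_mono) (use id ib bd in auto)
      also have "\<dots> = B * s powr w * measure lborel box3" by simp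
      also have "\<dots> \<le> B * \<epsilon> * V"
      proof (intro mult_mono)
        have "s powr w \<le> (\<epsilon> powr (1 / w)) powr w" using s w by (intro powr_mono2) (auto simp: h_def)
        also have "\<dots> = \<epsilon>" using e w by (simp add: powr_powr)
        finally show "s powr w \<le> \<epsilon>" .
      qed (use B e in \<open>auto simp: V_def\<close>)
      also have "\<dots> = 1 / (4 * real T)" using B V by (simp add: \<epsilon>_def)
      finally show ?thesis .
    qed
    \<comment> \<open>The labels partition the space, so the \<open>p l\<close> have average 1/T;
      since any two differ by at most 1/(2T), each lies between 1/(2T) and 3/(2T).\<close>
    have "(\<Sum>l<T. p l) = measure (dens f) (\<Union>l\<in>{..<T}. {x. lab x = l})"
      unfolding p_def by (rule D.finite_measure_finite_Union[symmetric]) (use setm in \<open>auto simp: disjoint_family_on_def\<close>)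
    also have "(\<Union>l\<in>{..<T}. {x. lab x = l}) = space (dens f)" using lT by auto
    finally have sum1: "(\<Sum>l<T. p l) = 1" by (simp only: D.prob_space)
    have dl: "\<bar>p l' - p l\<bar> \<le> 1 / (2 * real T)" if "l' < T" for l'
      using diff[OF that] diff[OF l] by (simp add: field_simps)
    have "(\<Sum>l'<T. p l' - p l) \<le> (\<Sum>l'<T. 1 / (2 * real T))"
    proof (intro sum_mono)
      fix l' assume "l' \<in> {..<T}"
      then show "p l' - p l \<le> 1 / (2 * real T)" using dl[of l'] by (simp only: lessThan_iff abs_le_iff)
    qed
    then have 1: "1 - real T * p l \<le> 1/2" using T sum1 by (simp add: sum_subtractf)
    have "(\<Sum>l'<T. p l - p l') \<le> (\<Sum>l'<T. 1 / (2 * real T))"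
    proof (intro sum_mono)
      fix l' assume "l' \<in> {..<T}"
      then have "- (p l' - p l) \<le> 1 / (2 * real T)" using dl[of l'] by (simp only: lessThan_iff abs_le_iff)
      then show "p l - p l' \<le> 1 / (2 * real T)" by linarith
    qed
    then have 2: "real T * p l - 1 \<le> 1/2" using T sum1 by (simp add: sum_subtractf)
    show ?thesis using 1 2 T unfolding p_def[symmetric] by (simp add: field_simps)
  qed
  then show ?thesis using lm lT by (intro exI[of _ lab]) auto
qed

text \<open>One sample point represents each label of the code word; the rest is padding with labels
  from \<open>T'\<close> on, which do not affect the intersection. At least half of the sample is
  available for padding, and \<open>m\<close> is at most that.\<close>

lemma coreset_with_labels:
  fixes lb :: "nat \<Rightarrow> nat"
  assumes \<Lambda>: "\<Lambda> \<subseteq> {..<T'}" "card \<Lambda> \<le> m" and hit: "\<And>l. l < T' \<Longrightarrow> \<exists>k\<in>{1..n}. lb k = l"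
    and few: "2 * card {k \<in> {1..n}. lb k < T'} \<le> n" and m: "2 * m \<le> n"
  shows "\<exists>A\<subseteq>{1..n}. card A = m \<and> lb ` A \<inter> {..<T'} = \<Lambda>"
proof -
  define r where "r l = (SOME k. k \<in> {1..n} \<and> lb k = l)" for l
  have r: "r l \<in> {1..n} \<and> lb (r l) = l" if "l \<in> \<Lambda>" for l
  proof -
    have "\<exists>k. k \<in> {1..n} \<and> lb k = l" using hit[of l] that \<Lambda> by blast
    from someI_ex[OF this] show ?thesis unfolding r_def .
  qed
  have inj: "inj_on r \<Lambda>" using r by (metis inj_onI)
  have fL: "finite \<Lambda>" using \<Lambda> finite_subset by blast
  let ?J = "{k \<in> {1..n}. \<not> lb k < T'}"
  have "{k \<in> {1..n}. lb k < T'} \<union> ?J = {1..n}" by auto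
  moreover have "card ({k \<in> {1..n}. lb k < T'} \<union> ?J) = card {k \<in> {1..n}. lb k < T'} + card ?J"
    by (rule card_Un_disjoint) auto
  ultimately have "card {1..n} = card {k \<in> {1..n}. lb k < T'} + card ?J" by (simp only:)
  then have "card ?J + card {k \<in> {1..n}. lb k < T'} = n" unfolding card_atLeastAtMost by linarith
  then have "m \<le> card ?J" using few m by linarith
  then have le: "m - card \<Lambda> \<le> card ?J" by simp
  obtain J where J: "J \<subseteq> ?J" "card J = m - card \<Lambda>" "finite J"
    by (rule obtain_subset_with_card_n[OF le])
  have disj: "r ` \<Lambda> \<inter> J = {}" using r J \<Lambda> by fastforce
  have "card (r ` \<Lambda> \<union> J) = card \<Lambda> + (m - card \<Lambda>)"
    using card_Un_disjoint[OF _ J(3) disj] fL J card_image[OF inj] by simp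
  then have "card (r ` \<Lambda> \<union> J) = m" using \<Lambda> by simp
  moreover have "lb ` (r ` \<Lambda> \<union> J) \<inter> {..<T'} = \<Lambda>"
  proof -
    have "lb ` (r ` \<Lambda>) = \<Lambda>" using r by force
    moreover have "lb ` J \<inter> {..<T'} = {}" using J by auto
    ultimately show ?thesis using \<Lambda> by (auto simp: image_Un Int_Un_distrib2)
  qed
  moreover have "r ` \<Lambda> \<union> J \<subseteq> {1..n}" using r J by blast
  ultimately show ?thesis by blast
qed

lemma space_L2_borel: "space L2_borel = L2_space"
  unfolding L2_borel_def by (rule space_measure_of) (auto simp: L2_open_def)

text \<open>A vector of labels takes finitely many values. The decoder factors through such vectors,
  and the scheme through them and \<open>nearest\<close>; this makes arbitrary choices in their
  definitions measurable.\<close>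

lemma labels_measurable:
  fixes lab :: "real ^ 'd::finite \<Rightarrow> nat"
  assumes I: "finite I" and lab: "lab \<in> measurable borel (count_space UNIV)" and T: "\<And>x. lab x < T"
  shows "(\<lambda>x. \<lambda>k\<in>I. lab (x k)) \<in> measurable (PiM I (\<lambda>_. borel)) (count_space (PiE I (\<lambda>_. {..<T})))"
proof -
  have "(\<lambda>x. \<lambda>k\<in>I. lab (x k)) -` {a} \<inter> space (PiM I (\<lambda>_. borel)) \<in> sets (PiM I (\<lambda>_. borel))"
    if a: "a \<in> PiE I (\<lambda>_. {..<T})" for a
  proof -
    have "{x \<in> space (PiM I (\<lambda>_. borel)). lab (x k) = a k} \<in> sets (PiM I (\<lambda>_. borel))" if k: "k \<in> I" for k
    proof -
      have "(\<lambda>x. lab (x k)) \<in> measurable (PiM I (\<lambda>_. borel)) (count_space UNIV)"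
        by (rule measurable_compose[OF measurable_component_singleton[OF k] lab])
      from measurable_sets[OF this, of "{a k}"] show ?thesis
        by (simp add: vimage_def Int_def conj_commute)
    qed
    then have "{x \<in> space (PiM I (\<lambda>_. borel)). \<forall>k\<in>I. lab (x k) = a k} \<in> sets (PiM I (\<lambda>_. borel))"
      by (intro sets.sets_Collect_finite_All I)
    also have "{x \<in> space (PiM I (\<lambda>_. borel)). \<forall>k\<in>I. lab (x k) = a k} =
      (\<lambda>x. \<lambda>k\<in>I. lab (x k)) -` {a} \<inter> space (PiM I (\<lambda>_. borel))"
    proof (intro equalityI subsetI)
      fix x assume x: "x \<in> {x \<in> space (PiM I (\<lambda>_. borel)). \<forall>k\<in>I. lab (x k) = a k}"
      have "(\<lambda>k\<in>I. lab (x k)) = a"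
      proof
        fix k show "(\<lambda>k\<in>I. lab (x k)) k = a k" using x PiE_arb[OF a, of k] by (cases "k \<in> I") auto
      qed
      then show "x \<in> (\<lambda>x. \<lambda>k\<in>I. lab (x k)) -` {a} \<inter> space (PiM I (\<lambda>_. borel))" using x by simp
    qed (auto dest: fun_cong)
    finally show ?thesis .
  qed
  moreover have "finite (PiE I (\<lambda>_. {..<T}))" using I by (intro finite_PiE) auto
  ultimately show ?thesis
    using T by (auto simp: measurable_count_space_eq2)
qed

text \<open>The decoder looks only at the set of kept points, so the listing drops out.\<close>

lemma coreset_points_image:
  assumes "finite A" "card A = m"
  shows "coreset_points x A ` {1..m} = x ` A"
proof -
  have "coreset_points x A ` {1..m} = (\<lambda>j. x (sorted_list_of_set A ! (j - 1))) ` {1..m}"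
    using assms by (auto simp: coreset_points_def)
  also have "\<dots> = x ` (\<lambda>j. sorted_list_of_set A ! (j - 1)) ` {1..m}" by (simp add: image_image)
  also have "(\<lambda>j. sorted_list_of_set A ! (j - 1)) ` {1..m} = (!) (sorted_list_of_set A) ` {..<m}"
  proof -
    have "{..<m} = (\<lambda>j. j - 1) ` {1..m}"
    proof (intro equalityI subsetI)
      fix j assume "j \<in> {..<m}"
      then have "j = Suc j - 1" "Suc j \<in> {1..m}" by auto
      then show "j \<in> (\<lambda>j. j - 1) ` {1..m}" by (rule image_eqI)
    qed auto
    then show ?thesis by (simp add: image_image)
  qed
  also have "\<dots> = set (sorted_list_of_set A)" using assms by (auto simp: set_conv_nth)
  finally show ?thesis using assms by simp
qed

lemma one_minus_power_le_exp: "0 \<le> p \<Longrightarrow> p \<le> 1 \<Longrightarrow> (1 - p) ^ n \<le> exp (- (real n * p))" for p :: real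
proof -
  assume p: "0 \<le> p" "p \<le> 1"
  have "(1 - p) ^ n \<le> exp (- p) ^ n" using p exp_ge_add_one_self[of "- p"] by (intro power_mono) auto
  then show ?thesis by (simp add: exp_of_nat_mult[symmetric])
qed

text \<open>
  \<open>enc\<close> encodes the index of a member of the net as a set of labels; the coreset realizes exactly
  that set among the labels below \<open>T'\<close> and is filled up with points of other labels.
\<close>

locale net_estimator =
  fixes \<beta> L :: real and \<phi> :: "nat \<Rightarrow> real ^ 'd::finite \<Rightarrow> real" and r q :: nat
    and g :: "nat \<Rightarrow> real ^ 'd \<Rightarrow> real" and s \<rho> B R :: real
    and lab :: "real ^ 'd \<Rightarrow> nat" and enc :: "nat \<Rightarrow> nat set" and n m T T' :: nat
  assumes \<beta>: "\<beta> > 0" and L: "L > 0" and q: "q \<ge> 1"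
    and \<phi>: "orthonormal \<phi> r"
    and app: "\<And>f. f \<in> holder_densities \<beta> L \<Longrightarrow> L2_norm (\<lambda>x. f x - proj \<phi> r f x) \<le> s"
    and B: "\<And>f x. f \<in> (holder_densities \<beta> L :: (real ^ 'd \<Rightarrow> real) set) \<Longrightarrow> f x \<le> B"
    and R: "\<And>f. f \<in> (holder_densities \<beta> L :: (real ^ 'd \<Rightarrow> real) set) \<Longrightarrow> L2_norm f \<le> R"
    and g: "\<And>w. w < q \<Longrightarrow> g w \<in> holder_densities \<beta> L"
    and net: "\<And>f. f \<in> holder_densities \<beta> L \<Longrightarrow> \<exists>w<q. L2_norm (\<lambda>x. f x - g w x) \<le> \<rho>"
    and lab: "lab \<in> measurable borel (count_space UNIV)" and labT: "\<And>x. lab x < T"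
    and labp: "\<And>f l. f \<in> holder_densities \<beta> L \<Longrightarrow> l < T \<Longrightarrow>
      1 / (2 * real T) \<le> measure (dens f) {x. lab x = l} \<and> measure (dens f) {x. lab x = l} \<le> 2 / real T"
    and enc: "inj_on enc {..<q}" "\<And>w. w < q \<Longrightarrow> enc w \<subseteq> {..<T'} \<and> card (enc w) \<le> m"
    and T': "T' \<le> T" and m: "2 * m \<le> n" "n \<ge> 1"
begin

section \<open>Encoder, decoder and their risk\<close>

abbreviation "F \<equiv> holder_densities \<beta> L :: (real ^ 'd \<Rightarrow> real) set"

lemma F_L2: "f \<in> F \<Longrightarrow> f \<in> L2_space"
  using holder_class_L2[OF \<beta> L] holder_densitiesD(1) by blast

text \<open>The empirical mean of \<open>\<phi> i\<close>, an unbiased estimate of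
  \<open>ip f (\<phi> i)\<close>.\<close>

definition coef :: "(nat \<Rightarrow> real ^ 'd) \<Rightarrow> nat \<Rightarrow> real" where
  "coef x i = (\<Sum>k\<in>{1..n}. \<phi> i (x k)) / real n"

definition dist_to :: "nat \<Rightarrow> (nat \<Rightarrow> real ^ 'd) \<Rightarrow> real" where
  "dist_to w x = L2_set (\<lambda>i. ip (g w) (\<phi> i) - coef x i) {..<r}"

text \<open>\<open>LEAST\<close> breaks ties measurably.\<close>

definition nearest :: "(nat \<Rightarrow> real ^ 'd) \<Rightarrow> nat" where
  "nearest x = (LEAST w. w < q \<and> (\<forall>v<q. dist_to w x \<le> dist_to v x))"

text \<open>Sets that are no code words are sent to member 0 of the net, so that every output lies
  in the class; on bad samples this bounds the loss.\<close>

definition decode :: "nat set \<Rightarrow> real ^ 'd \<Rightarrow> real" where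
  "decode \<Lambda> = g (if \<Lambda> \<in> enc ` {..<q} then inv_into {..<q} enc \<Lambda> else 0)"

definition est :: "(nat \<Rightarrow> real ^ 'd) \<Rightarrow> real ^ 'd \<Rightarrow> real" where
  "est y = decode (lab ` y ` {1..m} \<inter> {..<T'})"

text \<open>The default \<open>{1..m}\<close> is a legal index set for samples that do not realize
  the code word. The argument is the vector of labels, not the sample: for each of the finitely many
  vectors \<open>SOME\<close> makes a fixed choice, so \<open>sel\<close> is measurable.\<close>

definition pick :: "(nat \<Rightarrow> nat) \<Rightarrow> nat set \<Rightarrow> nat set" where
  "pick lb \<Lambda> = (if \<exists>A\<subseteq>{1..n}. card A = m \<and> lb ` A \<inter> {..<T'} = \<Lambda>
     then SOME A. A \<subseteq> {1..n} \<and> card A = m \<and> lb ` A \<inter> {..<T'} = \<Lambda> else {1..m})"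

definition sel :: "(nat \<Rightarrow> real ^ 'd) \<Rightarrow> nat set" where
  "sel x = pick (\<lambda>k\<in>{1..n}. lab (x k)) (enc (nearest x))"

definition sch :: "(nat \<Rightarrow> real ^ 'd) \<Rightarrow> nat set measure" where
  "sch x = return (count_space {A. A \<subseteq> {1..n} \<and> card A = m}) (sel x)"

lemma nearest: "nearest x < q \<and> (\<forall>v<q. dist_to (nearest x) x \<le> dist_to v x)"
proof -
  let ?S = "(\<lambda>w. dist_to w x) ` {..<q}"
  have "{..<q} \<noteq> {}" using q by (simp add: lessThan_empty_iff)
  then have "Min ?S \<in> ?S" by (intro Min_in) auto
  then obtain w where w: "w < q" "Min ?S = dist_to w x" by auto
  have "\<forall>v<q. dist_to w x \<le> dist_to v x"
    unfolding w(2)[symmetric] by (auto intro!: Min_le)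
  with w(1) have "\<exists>w. w < q \<and> (\<forall>v<q. dist_to w x \<le> dist_to v x)" by blast
  then show ?thesis unfolding nearest_def by (rule LeastI_ex)
qed

lemma proj_diff_norm:
  "L2_norm (\<lambda>z. proj \<phi> r f z - proj \<phi> r h z) = L2_set (\<lambda>i. ip f (\<phi> i) - ip h (\<phi> i)) {..<r}"
proof -
  have "(\<lambda>z. proj \<phi> r f z - proj \<phi> r h z) = comb \<phi> r (\<lambda>i. ip f (\<phi> i) - ip h (\<phi> i))"
    by (auto simp: proj_def comb_diff)
  then show ?thesis
    using comb_norm_power2[OF \<phi>, of "\<lambda>i. ip f (\<phi> i) - ip h (\<phi> i)"]
    by (simp add: L2_set_def real_sqrt_unique[symmetric])
qed

lemma coef_dist_le:
  assumes f: "f \<in> L2_space" and h: "h \<in> L2_space"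
  shows "L2_set (\<lambda>i. ip f (\<phi> i) - ip h (\<phi> i)) {..<r} \<le> L2_norm (\<lambda>z. f z - h z)"
proof -
  have "(\<Sum>i<r. (ip f (\<phi> i) - ip h (\<phi> i))\<^sup>2) = (\<Sum>i<r. (ip (\<lambda>z. f z - h z) (\<phi> i))\<^sup>2)"
    using f h orthonormal_L2[OF \<phi>] by (intro sum.cong) (auto simp: ip_diff_left)
  also have "\<dots> \<le> (L2_norm (\<lambda>z. f z - h z))\<^sup>2" by (rule bessel[OF \<phi> L2_diff[OF f h]])
  finally show ?thesis unfolding L2_set_def by (rule real_le_lsqrt[rotated -1]) (auto intro: sum_nonneg)
qed

text \<open>In coefficient space the selected member is at least as close to the empirical vector as
  the member near \<open>f\<close>, which costs \<rho> once and the stochastic error twice. The two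
  terms \<open>s\<close> lead back from the projections to the functions, for the selected member
  and for \<open>f\<close>.\<close>

lemma nearest_error:
  assumes f: "f \<in> F"
  shows "L2_norm (\<lambda>z. g (nearest x) z - f z) \<le> 2 * s + \<rho> + 2 * L2_set (\<lambda>i. coef x i - ip f (\<phi> i)) {..<r}"
proof -
  let ?h = "g (nearest x)" and ?e = "L2_set (\<lambda>i. coef x i - ip f (\<phi> i)) {..<r}"
  have h: "?h \<in> F" using g nearest by blast
  note L2 = F_L2[OF f] F_L2[OF h]
  obtain v where v: "v < q" "L2_norm (\<lambda>z. f z - g v z) \<le> \<rho>" using net[OF f] by blast
  have sub: "L2_set (\<lambda>i. a i - c i) {..<r} \<le> L2_set (\<lambda>i. a i - b i) {..<r} + L2_set (\<lambda>i. b i - c i) {..<r}"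
    for a b c :: "nat \<Rightarrow> real"
    using L2_set_triangle_ineq[of "\<lambda>i. a i - b i" "\<lambda>i. b i - c i" "{..<r}"] by simp
  have sym: "L2_set (\<lambda>i. a i - b i) {..<r} = L2_set (\<lambda>i. b i - a i) {..<r}" for a b :: "nat \<Rightarrow> real"
    by (simp add: L2_set_def power2_commute)
  have "L2_set (\<lambda>i. ip ?h (\<phi> i) - ip f (\<phi> i)) {..<r} \<le> dist_to (nearest x) x + ?e"
    unfolding dist_to_def by (rule sub)
  also have "dist_to (nearest x) x \<le> dist_to v x" using nearest v by blast
  also have "dist_to v x \<le> L2_set (\<lambda>i. ip (g v) (\<phi> i) - ip f (\<phi> i)) {..<r} + L2_set (\<lambda>i. ip f (\<phi> i) - coef x i) {..<r}"
    unfolding dist_to_def by (rule sub)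
  also have "L2_set (\<lambda>i. ip f (\<phi> i) - coef x i) {..<r} = ?e" by (rule sym)
  also have "L2_set (\<lambda>i. ip (g v) (\<phi> i) - ip f (\<phi> i)) {..<r} = L2_set (\<lambda>i. ip f (\<phi> i) - ip (g v) (\<phi> i)) {..<r}"
    by (rule sym)
  also have "\<dots> \<le> \<rho>" using coef_dist_le[OF F_L2[OF f] F_L2[OF g[OF v(1)]]] v(2) by linarith
  finally have pp: "L2_norm (\<lambda>z. proj \<phi> r ?h z - proj \<phi> r f z) \<le> \<rho> + 2 * ?e"
    by (simp add: proj_diff_norm)
  have "L2_norm (\<lambda>z. ?h z - f z) \<le> L2_norm (\<lambda>z. ?h z - proj \<phi> r ?h z) + L2_norm (\<lambda>z. proj \<phi> r ?h z - f z)"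
    by (rule L2_norm_diff_triangle[OF L2(2) L2_proj[OF \<phi>] L2(1)])
  also have "L2_norm (\<lambda>z. proj \<phi> r ?h z - f z) \<le> L2_norm (\<lambda>z. proj \<phi> r ?h z - proj \<phi> r f z) + L2_norm (\<lambda>z. proj \<phi> r f z - f z)"
    by (rule L2_norm_diff_triangle[OF L2_proj[OF \<phi>] L2_proj[OF \<phi>] L2(1)])
  also have "L2_norm (\<lambda>z. proj \<phi> r f z - f z) = L2_norm (\<lambda>z. f z - proj \<phi> r f z)"
    by (rule L2_norm_minus_commute)
  finally show ?thesis using pp app[OF f] app[OF h] by linarith
qed

lemma decode_in_F: "decode \<Lambda> \<in> F"
  unfolding decode_def using q inv_into_into[of \<Lambda> enc "{..<q}"] by (auto intro!: g)

lemma decode_enc: "w < q \<Longrightarrow> decode (enc w) = g w"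
  unfolding decode_def using enc(1) by (auto simp: inv_into_f_f)

lemma est_in_estimators: "est \<in> estimators m"
proof -
  have "est = (\<lambda>y. decode ((\<lambda>k\<in>{1..m}. lab (y k)) ` {1..m} \<inter> {..<T'}))"
    by (auto simp: est_def image_image)
  moreover have "(\<lambda>y. decode ((\<lambda>k\<in>{1..m}. lab (y k)) ` {1..m} \<inter> {..<T'}))
      \<in> measurable (PiM {1..m} (\<lambda>_. borel)) L2_borel"
    by (rule measurable_compose[OF labels_measurable[OF _ lab labT]])
       (auto simp: space_L2_borel decode_in_F F_L2)
  moreover have "est (\<lambda>j\<in>{1..m}. y (\<pi> j)) = est y" if "bij_betw \<pi> {1..m} {1..m}" for y \<pi>
  proof -
    have "(\<lambda>j\<in>{1..m}. y (\<pi> j)) ` {1..m} = y ` \<pi> ` {1..m}" by (simp add: image_image)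
    also have "\<pi> ` {1..m} = {1..m}" using that by (simp add: bij_betw_def)
    finally show ?thesis by (simp add: est_def)
  qed
  ultimately show ?thesis by (simp add: estimators_def)
qed

lemma pick_props: "pick lb \<Lambda> \<subseteq> {1..n} \<and> card (pick lb \<Lambda>) = m"
proof (cases "\<exists>A\<subseteq>{1..n}. card A = m \<and> lb ` A \<inter> {..<T'} = \<Lambda>")
  case True
  then have "\<exists>A. A \<subseteq> {1..n} \<and> card A = m \<and> lb ` A \<inter> {..<T'} = \<Lambda>" by blast
  from someI_ex[OF this] True show ?thesis by (simp add: pick_def)
next
  case False
  then have "pick lb \<Lambda> = {1..m}" unfolding pick_def by (rule if_not_P)
  then show ?thesis using m by simp
qed

lemma nearest_measurable: "nearest \<in> measurable (PiM {1..n} (\<lambda>_. borel)) (count_space UNIV)"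
proof -
  have phim: "(\<lambda>x. \<phi> i (x k)) \<in> borel_measurable (PiM {1..n} (\<lambda>_. borel))" if "k \<in> {1..n}" "i < r" for i k
    by (rule measurable_compose[OF measurable_component_singleton[OF that(1)] L2_measurable[OF orthonormal_L2[OF \<phi> that(2)]]])
  have coefm: "(\<lambda>x. coef x i) \<in> borel_measurable (PiM {1..n} (\<lambda>_. borel))" if "i < r" for i
    unfolding coef_def using that by (intro borel_measurable_divide borel_measurable_sum phim borel_measurable_const)
  have distm: "(\<lambda>x. dist_to w x) \<in> borel_measurable (PiM {1..n} (\<lambda>_. borel))" for w
  proof -
    have [measurable]: "(\<lambda>x. \<Sum>i<r. (ip (g w) (\<phi> i) - coef x i)\<^sup>2) \<in> borel_measurable (PiM {1..n} (\<lambda>_. borel))"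
      by (intro borel_measurable_sum borel_measurable_power borel_measurable_diff borel_measurable_const coefm) auto
    show ?thesis unfolding dist_to_def L2_set_def by measurable
  qed
  show ?thesis unfolding nearest_def
  proof (rule measurable_Least)
    fix w
    have "{x \<in> space (PiM {1..n} (\<lambda>_. borel)). \<forall>v\<in>{..<q}. dist_to w x \<le> dist_to v x} \<in> sets (PiM {1..n} (\<lambda>_. borel))"
    proof (rule sets.sets_Collect_finite_All)
      show "{x \<in> space (PiM {1..n} (\<lambda>_. borel)). dist_to w x \<le> dist_to v x} \<in> sets (PiM {1..n} (\<lambda>_. borel))" for v
        by (rule borel_measurable_le[OF distm distm])
    qed simp
    moreover have "{x \<in> S. w < q \<and> (\<forall>v<q. dist_to w x \<le> dist_to v x)} =
        (if w < q then {x \<in> S. \<forall>v\<in>{..<q}. dist_to w x \<le> dist_to v x} else {})" for S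
      by auto
    ultimately have "{x \<in> space (PiM {1..n} (\<lambda>_. borel)). w < q \<and> (\<forall>v<q. dist_to w x \<le> dist_to v x)} \<in> sets (PiM {1..n} (\<lambda>_. borel))"
      by (simp only: sets.empty_sets if_cancel split: if_split) blast
    then show "(\<lambda>x. w < q \<and> (\<forall>v<q. dist_to w x \<le> dist_to v x)) \<in> measurable (PiM {1..n} (\<lambda>_. borel)) (count_space UNIV)"
      unfolding pred_def .
  qed
qed

lemma sch_in_coreset_schemes: "sch \<in> coreset_schemes n m"
proof -
  let ?\<Omega> = "{A. A \<subseteq> {1..n} \<and> card A = m}" and ?P = "PiM {1..n} (\<lambda>_. borel :: (real ^ 'd) measure)"
  let ?E = "PiE {1..n} (\<lambda>_. {..<T})"
  have "(\<lambda>x. pick lb (enc (nearest x))) \<in> measurable ?P (count_space ?\<Omega>)" for lb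
    by (rule measurable_compose[OF nearest_measurable]) (use pick_props in auto)
  then have "(\<lambda>x. pick (\<lambda>k\<in>{1..n}. lab (x k)) (enc (nearest x))) \<in> measurable ?P (count_space ?\<Omega>)"
    by (intro measurable_compose_countable'[where f = "\<lambda>lb x. pick lb (enc (nearest x))", OF _ labels_measurable[OF _ lab labT]])
       (auto intro!: countable_finite finite_PiE)
  then have "sel \<in> measurable ?P (count_space ?\<Omega>)" by (simp add: sel_def[abs_def])
  from measurable_compose[OF this measurable_return_prob_space]
  show ?thesis by (simp add: coreset_schemes_def sch_def[abs_def])
qed

text \<open>The loss is bounded pointwise by one integrable function \<open>H\<close>. On bad
  samples, where a code label is missing or code labels fill more than half of the sample, the loss
  is at most \<open>2 * R\<close> and \<open>miss + low\<close> is at least 1; integrating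
  \<open>H\<close> thus performs the union bound and Markov's inequality at once.\<close>

lemma risk_bound:
  assumes f: "f \<in> F" and V: "V > 0" "B * real r / real n \<le> V"
  shows "coreset_risk n est sch f \<le> ennreal (2 * s + \<rho> + 2 * sqrt V +
    2 * R * (real T' * exp (- (real n / (2 * real T))) + 4 * real T' / real T))"
proof -
  let ?D = "dens f" and ?P = "PiM {1..n} (\<lambda>_. dens f)"
  interpret D: prob_space ?D by (rule prob_space_dens[OF f])
  interpret product_sigma_finite "\<lambda>_::nat. ?D" ..
  interpret P: prob_space ?P by (rule prob_space_PiM) unfold_locales
  note hf = holder_densitiesD[OF f]
  have Tpos: "T > 0" using labT[of undefined] by simp
  have R0: "0 \<le> R" using R[OF f] L2_norm_nonneg[of f] by linarith
  have B0: "0 \<le> B" using B[OF f, of undefined] hf(2)[of undefined] by linarith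
  have setl: "{x. lab x = l} \<in> sets borel" for l using measurable_sets[OF lab, of "{l}"] by (simp add: vimage_def)
  have setlt: "{x. lab x < T'} \<in> sets borel" using measurable_sets[OF lab, of "{..<T'}"] by (simp add: vimage_def)
  have nb: "n \<ge> 1" by (rule m)
  define e2 where "e2 x = (\<Sum>i<r. (coef x i - ip f (\<phi> i))\<^sup>2)" for x
  \<comment> \<open>The number of code labels that do not occur; \<open>low\<close> is twice the
    fraction of the sample with a code label.\<close>
  define miss where "miss x = (\<Sum>l<T'. \<Prod>k\<in>{1..n}. 1 - indicator {z. lab z = l} (x k) :: real)" for x :: "nat \<Rightarrow> real ^ 'd"
  define low where "low x = (\<Sum>k\<in>{1..n}. indicator {z. lab z < T'} (x k)) * (2 / real n) " for x :: "nat \<Rightarrow> real ^ 'd"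
  define H where "H x = 2 * s + \<rho> + (e2 x / sqrt V + sqrt V) + 2 * R * (miss x + low x)" for x
  have e20: "e2 x \<ge> 0" for x by (simp add: e2_def sum_nonneg)
  have miss0: "miss x \<ge> 0" for x unfolding miss_def by (intro sum_nonneg prod_nonneg) (auto simp: indicator_def)
  have low0: "low x \<ge> 0" for x by (simp add: low_def sum_nonneg)
  have pt: "(\<integral>\<^sup>+ A. ennreal (L2_norm (\<lambda>z. est (coreset_points x A) z - f z)) \<partial>sch x) \<le> ennreal (H x)" for x
  proof -
    have sx: "sel x \<in> {A. A \<subseteq> {1..n} \<and> card A = m}" unfolding sel_def using pick_props by blast
    then have fs: "finite (sel x)" by (auto intro: finite_subset)
    have est_sel: "est (coreset_points x (sel x)) = decode (lab ` x ` sel x \<inter> {..<T'})"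
      unfolding est_def using coreset_points_image[OF fs, of m x] sx by simp
    have "(\<integral>\<^sup>+ A. ennreal (L2_norm (\<lambda>z. est (coreset_points x A) z - f z)) \<partial>sch x)
        = ennreal (L2_norm (\<lambda>z. est (coreset_points x (sel x)) z - f z))"
      unfolding sch_def by (rule nn_integral_return) (use sx in auto)
    also have "L2_norm (\<lambda>z. est (coreset_points x (sel x)) z - f z) \<le> H x"
    proof (cases "(\<forall>l<T'. \<exists>k\<in>{1..n}. lab (x k) = l) \<and> 2 * card {k \<in> {1..n}. lab (x k) < T'} \<le> n")
      case True
      let ?lb = "\<lambda>k\<in>{1..n}. lab (x k)" and ?\<Lambda> = "enc (nearest x)"
      have nq: "nearest x < q" using nearest by blast
      have st: "{k \<in> {1..n}. ?lb k < T'} = {k \<in> {1..n}. lab (x k) < T'}" by auto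
      have "\<exists>A\<subseteq>{1..n}. card A = m \<and> ?lb ` A \<inter> {..<T'} = ?\<Lambda>"
      proof (rule coreset_with_labels)
        show "?\<Lambda> \<subseteq> {..<T'}" "card ?\<Lambda> \<le> m" using enc(2)[OF nq] by auto
        show "\<exists>k\<in>{1..n}. ?lb k = l" if "l < T'" for l using True that by auto
        show "2 * card {k \<in> {1..n}. ?lb k < T'} \<le> n" unfolding st using True by blast
        show "2 * m \<le> n" by (rule m)
      qed
      then have ex: "\<exists>A. A \<subseteq> {1..n} \<and> card A = m \<and> ?lb ` A \<inter> {..<T'} = ?\<Lambda>" by blast
      have "?lb ` sel x \<inter> {..<T'} = ?\<Lambda>"
        unfolding sel_def pick_def using someI_ex[OF ex] ex by simp
      moreover have "?lb ` sel x = lab ` x ` sel x" using sx by (force simp: image_image)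
      ultimately have "est (coreset_points x (sel x)) = g (nearest x)"
        using est_sel decode_enc[OF nq] by simp
      then have "L2_norm (\<lambda>z. est (coreset_points x (sel x)) z - f z) \<le> 2 * s + \<rho> + 2 * sqrt (e2 x)"
        using nearest_error[OF f, of x] by (simp add: e2_def L2_set_def)
      \<comment> \<open>The inequality of arithmetic and geometric means linearizes the square root,
        so that only the mean of \<open>e2\<close> is needed.\<close>
      also have "2 * sqrt (e2 x) \<le> e2 x / sqrt V + sqrt V"
      proof -
        have "0 \<le> (sqrt (e2 x) - sqrt V)\<^sup>2" by simp
        also have "\<dots> = e2 x - 2 * sqrt (e2 x) * sqrt V + V" using e20 V by (simp add: power2_diff)
        finally have "2 * sqrt (e2 x) * sqrt V \<le> e2 x + V" by simp
        then have "2 * sqrt (e2 x) \<le> (e2 x + V) / sqrt V" using V by (simp add: pos_le_divide_eq)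
        also have "\<dots> = e2 x / sqrt V + sqrt V" using V by (simp add: add_divide_distrib real_div_sqrt)
        finally show ?thesis .
      qed
      finally show ?thesis unfolding H_def using R0 miss0[of x] low0[of x] by (simp add: add_increasing2)
    next
      case False
      have "1 \<le> miss x + low x"
      proof (cases "\<forall>l<T'. \<exists>k\<in>{1..n}. lab (x k) = l")
        case True
        then have "\<not> 2 * card {k \<in> {1..n}. lab (x k) < T'} \<le> n" using False by blast
        then have "n \<le> 2 * card {k \<in> {1..n}. lab (x k) < T'}" by linarith
        moreover have "(\<Sum>k\<in>{1..n}. indicator {z. lab z < T'} (x k)) = real (card {k \<in> {1..n}. lab (x k) < T'})"
          by (simp add: indicator_def sum.If_cases Int_def)
        ultimately have "1 \<le> low x" using nb by (simp add: low_def field_simps)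
        then show ?thesis using miss0[of x] by linarith
      next
        case False
        then obtain l where l: "l < T'" "\<And>k. k \<in> {1..n} \<Longrightarrow> lab (x k) \<noteq> l" by blast
        have "(1::real) = (\<Prod>k\<in>{1..n}. 1 - indicator {z. lab z = l} (x k))"
          using l by (intro prod.neutral[symmetric]) auto
        also have "\<dots> \<le> miss x"
          unfolding miss_def using l
          by (intro member_le_sum[of l "{..<T'}" "\<lambda>l. \<Prod>k\<in>{1..n}. 1 - indicator {z. lab z = l} (x k)"])
            (auto intro!: prod_nonneg simp: indicator_def)
        finally show ?thesis using low0[of x] by linarith
      qed
      then have r2: "2 * R * 1 \<le> 2 * R * (miss x + low x)" using R0 by (intro mult_left_mono) auto
      let ?h = "decode (lab ` x ` sel x \<inter> {..<T'})"
      have "L2_norm (\<lambda>z. ?h z - f z) \<le> L2_norm (\<lambda>z. ?h z - 0) + L2_norm (\<lambda>z. 0 - f z)"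
        by (rule L2_norm_diff_triangle[OF F_L2[OF decode_in_F] L2_zero F_L2[OF f]])
      also have "L2_norm (\<lambda>z. 0 - f z) = L2_norm (\<lambda>z. f z - 0)" by (rule L2_norm_minus_commute)
      finally have "L2_norm (\<lambda>z. ?h z - f z) \<le> 2 * R"
        using R[OF f] R[OF decode_in_F, of "lab ` x ` sel x \<inter> {..<T'}"] by simp
      moreover have "0 \<le> s" using app[OF f] L2_norm_nonneg[of "\<lambda>x. f x - proj \<phi> r f x"] by linarith
      moreover have "0 \<le> \<rho>" using net[OF f] L2_norm_nonneg order_trans by blast
      moreover have "0 \<le> e2 x / sqrt V + sqrt V" using e20[of x] V by simp
      ultimately show ?thesis unfolding H_def est_sel using r2 by linarith
    qed
    finally show ?thesis by (simp add: ennreal_leI)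
  qed
  have phi_int: "integrable ?D (\<phi> i)" and phi_mean: "(\<integral>z. \<phi> i z \<partial>?D) = ip f (\<phi> i)"
    and phi_sq: "integrable ?D (\<lambda>z. (\<phi> i z)\<^sup>2)" and phi_sq_le: "(\<integral>z. (\<phi> i z)\<^sup>2 \<partial>?D) \<le> B" if i: "i < r" for i
  proof -
    note pL = orthonormal_L2[OF \<phi> i]
    have pm: "\<phi> i \<in> borel_measurable borel" by (rule L2_measurable[OF pL])
    show "integrable ?D (\<phi> i)"
      using L2_integrable_mult[OF F_L2[OF f] pL] hf pm by (subst integrable_density) auto
    show "(\<integral>z. \<phi> i z \<partial>?D) = ip f (\<phi> i)"
      unfolding ip_def using hf pm by (subst integral_density) auto
    have sq: "integrable lborel (\<lambda>z. (\<phi> i z)\<^sup>2)" using pL by (simp add: L2_space_def)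
    note b = integrable_dens_bounded[OF hf(5,2) B[OF f] sq]
    show "integrable ?D (\<lambda>z. (\<phi> i z)\<^sup>2)" by (rule b)
    have "integrable lborel (\<lambda>z. f z * (\<phi> i z)\<^sup>2)"
      using b(1) hf pm by (subst (asm) integrable_density) auto
    then have "(\<integral>z. f z * (\<phi> i z)\<^sup>2 \<partial>lborel) \<le> (\<integral>z. B * (\<phi> i z)\<^sup>2 \<partial>lborel)"
      by (rule integral_mono) (use sq B[OF f] in \<open>auto intro: mult_right_mono\<close>)
    also have "\<dots> = B * ip (\<phi> i) (\<phi> i)" by (simp add: ip_def power2_eq_square)
    also have "\<dots> = B" using \<phi> i by (simp add: orthonormal_def)
    finally show "(\<integral>z. (\<phi> i z)\<^sup>2 \<partial>?D) \<le> B" unfolding b(2) .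
  qed
  have e2_int: "integrable ?P e2" and e2_le: "(\<integral>x. e2 x \<partial>?P) \<le> V"
  proof -
    have t: "integrable ?P (\<lambda>x. (coef x i - ip f (\<phi> i))\<^sup>2)"
      "(\<integral>x. (coef x i - ip f (\<phi> i))\<^sup>2 \<partial>?P) \<le> B / real n" if i: "i < r" for i
    proof -
      note me = integral_mean_error_power2[OF D.prob_space_axioms nb phi_int[OF i] phi_sq[OF i], unfolded phi_mean[OF i]]
      show "integrable ?P (\<lambda>x. (coef x i - ip f (\<phi> i))\<^sup>2)" unfolding coef_def by (rule me)
      have "(\<integral>x. (coef x i - ip f (\<phi> i))\<^sup>2 \<partial>?P) \<le> (\<integral>z. (\<phi> i z)\<^sup>2 \<partial>?D) / real n" unfolding coef_def by (rule me)
      also have "\<dots> \<le> B / real n" using phi_sq_le[OF i] by (intro divide_right_mono) auto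
      finally show "(\<integral>x. (coef x i - ip f (\<phi> i))\<^sup>2 \<partial>?P) \<le> B / real n" .
    qed
    show "integrable ?P e2" unfolding e2_def using t by auto
    have "(\<integral>x. e2 x \<partial>?P) = (\<Sum>i<r. (\<integral>x. (coef x i - ip f (\<phi> i))\<^sup>2 \<partial>?P))"
      unfolding e2_def using t by (intro Bochner_Integration.integral_sum) auto
    also have "\<dots> \<le> (\<Sum>i<r. B / real n)" using t by (intro sum_mono) auto
    also have "\<dots> = B * real r / real n" by simp
    finally show "(\<integral>x. e2 x \<partial>?P) \<le> V" using V by linarith
  qed
  have ind_int: "integrable ?D (indicator A :: _ \<Rightarrow> real)" if "A \<in> sets borel" for A
    using that by (intro integrable_real_indicator) (auto simp: D.emeasure_finite less_top[symmetric])
  have miss_int: "integrable ?P miss" and miss_le: "(\<integral>x. miss x \<partial>?P) \<le> real T' * exp (- (real n / (2 * real T)))"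
  proof -
    have t: "integrable ?P (\<lambda>x. \<Prod>k\<in>{1..n}. 1 - indicator {z. lab z = l} (x k) :: real)"
      "(\<integral>x. (\<Prod>k\<in>{1..n}. 1 - indicator {z. lab z = l} (x k) :: real) \<partial>?P) \<le> exp (- (real n / (2 * real T)))"
      if l: "l < T'" for l
    proof -
      let ?h = "\<lambda>z. 1 - indicator {z. lab z = l} z :: real"
      have h: "integrable ?D ?h" using ind_int[OF setl] by simp
      show "integrable ?P (\<lambda>x. \<Prod>k\<in>{1..n}. 1 - indicator {z. lab z = l} (x k) :: real)"
        using product_integrable_prod[of "{1..n}" "\<lambda>_. ?h"] h by simp
      let ?p = "measure ?D {z. lab z = l}"
      have "(\<integral>x. (\<Prod>k\<in>{1..n}. 1 - indicator {z. lab z = l} (x k) :: real) \<partial>?P) = (\<integral>z. ?h z \<partial>?D) ^ n"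
        using product_integral_prod[of "{1..n}" "\<lambda>_. ?h"] h by simp
      also have "(\<integral>z. ?h z \<partial>?D) = 1 - ?p"
        using ind_int[OF setl] setl D.prob_space by simp
      also have "(1 - ?p) ^ n \<le> exp (- (real n * ?p))"
        by (rule one_minus_power_le_exp) auto
      also have "\<dots> \<le> exp (- (real n / (2 * real T)))"
        using labp[OF f, of l] l T' mult_left_mono[of "1 / (2 * real T)" ?p "real n"] by simp
      finally show "(\<integral>x. (\<Prod>k\<in>{1..n}. 1 - indicator {z. lab z = l} (x k) :: real) \<partial>?P) \<le> exp (- (real n / (2 * real T)))" .
    qed
    show "integrable ?P miss" unfolding miss_def using t by auto
    have "(\<integral>x. miss x \<partial>?P) = (\<Sum>l<T'. (\<integral>x. (\<Prod>k\<in>{1..n}. 1 - indicator {z. lab z = l} (x k) :: real) \<partial>?P))"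
      unfolding miss_def using t by (intro Bochner_Integration.integral_sum) auto
    also have "\<dots> \<le> (\<Sum>l<T'. exp (- (real n / (2 * real T))))" using t by (intro sum_mono) auto
    finally show "(\<integral>x. miss x \<partial>?P) \<le> real T' * exp (- (real n / (2 * real T)))" by simp
  qed
  have low_int: "integrable ?P low" and low_le: "(\<integral>x. low x \<partial>?P) \<le> 4 * real T' / real T"
  proof -
    have t: "integrable ?P (\<lambda>x. indicator {z. lab z < T'} (x k) :: real)"
      "(\<integral>x. indicator {z. lab z < T'} (x k) \<partial>?P) = measure ?D {z. lab z < T'}" if k: "k \<in> {1..n}" for k
      using product_integral_one[OF D.prob_space_axioms _ k ind_int[OF setlt]] setlt by auto
    show "integrable ?P low" unfolding low_def
      by (intro integrable_mult_left Bochner_Integration.integrable_sum t)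
    have "(\<integral>x. low x \<partial>?P) = (\<Sum>k\<in>{1..n}. measure ?D {z. lab z < T'}) * (2 / real n)"
    proof -
      have "(\<integral>x. low x \<partial>?P) = (\<integral>x. (\<Sum>k\<in>{1..n}. indicator {z. lab z < T'} (x k)) \<partial>?P) * (2 / real n)"
        unfolding low_def by (rule integral_mult_left_zero)
      also have "(\<integral>x. (\<Sum>k\<in>{1..n}. indicator {z. lab z < T'} (x k) :: real) \<partial>?P) =
          (\<Sum>k\<in>{1..n}. (\<integral>x. indicator {z. lab z < T'} (x k) \<partial>?P))"
        by (rule Bochner_Integration.integral_sum) (rule t)
      also have "\<dots> = (\<Sum>k\<in>{1..n}. measure ?D {z. lab z < T'})" by (intro sum.cong refl t)
      finally show ?thesis .
    qed
    also have "\<dots> = 2 * measure ?D {z. lab z < T'}" using nb by simp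
    also have "{z. lab z < T'} = (\<Union>l\<in>{..<T'}. {z. lab z = l})" by auto
    also have "measure ?D \<dots> = (\<Sum>l<T'. measure ?D {z. lab z = l})"
      by (rule D.finite_measure_finite_Union) (use setl in \<open>auto simp: disjoint_family_on_def\<close>)
    also have "\<dots> \<le> (\<Sum>l<T'. 2 / real T)" using labp[OF f] T' by (intro sum_mono) auto
    finally show "(\<integral>x. low x \<partial>?P) \<le> 4 * real T' / real T" by simp
  qed
  have H_int: "integrable ?P H"
    unfolding H_def using e2_int miss_int low_int by (simp del: One_nat_def)
  have H0: "0 \<le> H x" for x
  proof -
    have "0 \<le> s" using app[OF f] L2_norm_nonneg[of "\<lambda>x. f x - proj \<phi> r f x"] by linarith
    moreover have "0 \<le> \<rho>" using net[OF f] L2_norm_nonneg order_trans by blast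
    ultimately show ?thesis unfolding H_def using e20[of x] V R0 miss0[of x] low0[of x] by (intro add_nonneg_nonneg mult_nonneg_nonneg) auto
  qed
  have "coreset_risk n est sch f \<le> (\<integral>\<^sup>+ x. ennreal (H x) \<partial>?P)"
    unfolding coreset_risk_def by (rule nn_integral_mono) (rule pt)
  also have "\<dots> = ennreal (\<integral>x. H x \<partial>?P)"
    by (rule nn_integral_eq_integral[OF H_int]) (use H0 in auto)
  also have "(\<integral>x. H x \<partial>?P) = 2 * s + \<rho> + ((\<integral>x. e2 x \<partial>?P) / sqrt V + sqrt V)
      + 2 * R * ((\<integral>x. miss x \<partial>?P) + (\<integral>x. low x \<partial>?P))"
    unfolding H_def using e2_int miss_int low_int P.prob_space by (simp del: One_nat_def)
  also have "\<dots> \<le> 2 * s + \<rho> + (V / sqrt V + sqrt V) +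
    2 * R * (real T' * exp (- (real n / (2 * real T))) + 4 * real T' / real T)"
    using e2_le miss_le low_le R0 V by (intro add_mono mult_left_mono divide_right_mono) auto
  also have "V / sqrt V = sqrt V" using V by (simp add: real_div_sqrt)
  finally show ?thesis by (simp add: ennreal_leI algebra_simps)
qed

end

subsection \<open>The upper bound\<close>

text \<open>The free parameters are the resolution \<open>i\<close> of the projection, the
  resolution \<open>j\<close> of the net, the number \<open>T\<close> of labels, the number
  \<open>T'\<close> of those that carry the code, and the size \<open>m'\<close> of a code word. The
  binomial condition says that there are enough code words for the net. \<open>K\<close> and
  \<open>A\<close> depend on the class only.\<close>

lemma upper_bound_parameters:
  assumes \<beta>: "\<beta> > 0" and L: "L > 0" and ne: "holder_densities \<beta> L \<noteq> ({} :: (real ^ 'd::finite \<Rightarrow> real) set)"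
  shows "\<exists>K>0. \<exists>A>0. \<forall>n m m' T T' i j :: nat. 1 \<le> n \<longrightarrow> 2 * m \<le> n \<longrightarrow> m' \<le> m \<longrightarrow> 1 \<le> T \<longrightarrow> T' \<le> T \<longrightarrow>
    exp (K * 2 ^ (j * CARD('d))) \<le> real (T' choose m') \<longrightarrow>
    coreset_minimax_risk TYPE('d) \<beta> L n m \<le> ennreal (A * (2 powr (- \<beta> * real i) + 2 powr (- \<beta> * real j)
      + sqrt (2 ^ (i * CARD('d)) / real n) + real T' * exp (- (real n / (2 * real T))) + real T' / real T))"
proof -
  let ?F = "holder_densities \<beta> L :: (real ^ 'd \<Rightarrow> real) set"
  let ?d = "CARD('d)"
  obtain M C where M: "M > 0" and C: "C > 0" and app: "\<And>j::nat. \<exists>(\<phi> :: nat \<Rightarrow> real ^ 'd \<Rightarrow> real) r.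
    orthonormal \<phi> r \<and> real r \<le> M * 2 ^ (j * ?d) \<and>
    (\<forall>f\<in>holder_class \<beta> L. L2_norm (\<lambda>x. f x - proj \<phi> r f x) \<le> C * 2 powr (- \<beta> * real j))"
    using holder_class_subspaces[OF \<beta> L, where 'd = 'd] by blast
  obtain B where B: "B > 0" and bB: "\<And>f x. f \<in> (holder_class \<beta> L :: (real ^ 'd \<Rightarrow> real) set) \<Longrightarrow> \<bar>f x\<bar> \<le> B"
    using holder_class_bounded[OF \<beta> L, where 'd = 'd] by blast
  define R where "R = B * sqrt (measure lborel (unit_box :: (real ^ 'd) set)) + 1"
  have Rpos: "R > 0" unfolding R_def using B by (intro add_nonneg_pos mult_nonneg_nonneg) auto
  have FH: "f \<in> holder_class \<beta> L" if "f \<in> ?F" for f using holder_densitiesD(1)[OF that] .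
  have R: "L2_norm f \<le> R" if f: "f \<in> ?F" for f
  proof -
    have "L2_norm f \<le> B * sqrt (measure lborel (unit_box :: (real ^ 'd) set))"
      by (rule L2_bounded_support(2)) (use holder_densitiesD(5)[OF f] bB[OF FH[OF f]] FH[OF f] in \<open>auto simp: holder_class_iff\<close>)
    then show ?thesis by (simp add: R_def)
  qed
  \<comment> \<open>One constant for the approximation error and for the norm, as
    \<open>entropy_bound\<close> requires.\<close>
  define C1 where "C1 = max C R"
  have C1: "C1 > 0" using C by (simp add: C1_def)
  have app1: "\<exists>(\<phi> :: nat \<Rightarrow> real ^ 'd \<Rightarrow> real) r.
    orthonormal \<phi> r \<and> real r \<le> M * 2 ^ (j * ?d) \<and>
    (\<forall>f\<in>?F. L2_norm (\<lambda>x. f x - proj \<phi> r f x) \<le> C1 * 2 powr (- \<beta> * real j))" for j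
  proof -
    obtain \<phi> :: "nat \<Rightarrow> real ^ 'd \<Rightarrow> real" and r where o: "orthonormal \<phi> r" "real r \<le> M * 2 ^ (j * ?d)"
      and a: "\<And>f. f \<in> holder_class \<beta> L \<Longrightarrow> L2_norm (\<lambda>x. f x - proj \<phi> r f x) \<le> C * 2 powr (- \<beta> * real j)"
      using app[of j] by blast
    have "C * 2 powr (- \<beta> * real j) \<le> C1 * 2 powr (- \<beta> * real j)" by (intro mult_right_mono) (auto simp: C1_def)
    then show ?thesis using o a FH order_trans by blast
  qed
  have FL2: "?F \<subseteq> L2_space" using holder_class_L2[OF \<beta> L] FH by blast
  have "\<exists>K>0. \<forall>j::nat. \<exists>G. finite G \<and> G \<subseteq> ?F \<and> real (card G) \<le> exp (K * 2 ^ (j * ?d)) \<and>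
    (\<forall>f\<in>?F. \<exists>g\<in>G. L2_norm (\<lambda>x. f x - g x) \<le> 4 * C1 * 2 powr (- \<beta> * real j))"
  proof (rule entropy_bound[OF _ \<beta> M C1 FL2 _ app1])
    show "1 \<le> ?d" by (simp add: Suc_le_eq)
    show "L2_norm f \<le> C1" if "f \<in> ?F" for f using R[OF that] by (simp add: C1_def)
  qed
  then obtain K where K: "K > 0" and nets: "\<And>j::nat. \<exists>G. finite G \<and> G \<subseteq> ?F \<and> real (card G) \<le> exp (K * 2 ^ (j * ?d)) \<and>
    (\<forall>f\<in>?F. \<exists>g\<in>G. L2_norm (\<lambda>x. f x - g x) \<le> 4 * C1 * 2 powr (- \<beta> * real j))" by blast
  define A where "A = 2 * C1 + 4 * C1 + 2 * sqrt (B * M) + 2 * R + 8 * R"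
  have sqBM: "sqrt (B * M) > 0" using B M by simp
  have A: "A > 0" unfolding A_def using C1 Rpos sqBM by linarith
  have "coreset_minimax_risk TYPE('d) \<beta> L n m \<le> ennreal (A * (2 powr (- \<beta> * real i) + 2 powr (- \<beta> * real j)
      + sqrt (2 ^ (i * CARD('d)) / real n) + real T' * exp (- (real n / (2 * real T))) + real T' / real T))"
    if n: "1 \<le> n" and m: "2 * m \<le> n" "m' \<le> m" and T: "1 \<le> T" "T' \<le> T"
      and bits: "exp (K * 2 ^ (j * ?d)) \<le> real (T' choose m')" for n m m' T T' i j :: nat
  proof -
    obtain \<phi> :: "nat \<Rightarrow> real ^ 'd \<Rightarrow> real" and r where o: "orthonormal \<phi> r" and r: "real r \<le> M * 2 ^ (i * ?d)"
      and a: "\<And>f. f \<in> ?F \<Longrightarrow> L2_norm (\<lambda>x. f x - proj \<phi> r f x) \<le> C1 * 2 powr (- \<beta> * real i)"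
      using app1[of i] by blast
    obtain G where G: "finite G" "G \<subseteq> ?F" "real (card G) \<le> exp (K * 2 ^ (j * ?d))"
      and net: "\<And>f. f \<in> ?F \<Longrightarrow> \<exists>g\<in>G. L2_norm (\<lambda>x. f x - g x) \<le> 4 * C1 * 2 powr (- \<beta> * real j)"
      using nets[of j] by blast
    obtain g where g: "bij_betw g {..<card G} G"
      using ex_bij_betw_nat_finite[OF G(1)] by (metis atLeast0LessThan)
    have gG: "g w \<in> G" if "w < card G" for w using g that by (auto simp: bij_betw_def)
    have "G \<noteq> {}" using ne net by blast
    then have q: "card G \<ge> 1" using G(1) by (simp add: Suc_le_eq card_gt_0_iff)
    have netg: "\<exists>w<card G. L2_norm (\<lambda>x. f x - g w x) \<le> 4 * C1 * 2 powr (- \<beta> * real j)" if f: "f \<in> ?F" for f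
    proof -
      obtain h where h: "h \<in> G" "L2_norm (\<lambda>x. f x - h x) \<le> 4 * C1 * 2 powr (- \<beta> * real j)"
        using net[OF f] by blast
      then have "h \<in> g ` {..<card G}" using g by (simp add: bij_betw_def)
      then show ?thesis using h by blast
    qed
    let ?\<L> = "{\<Lambda>. \<Lambda> \<subseteq> {..<T'} \<and> card \<Lambda> = m'}"
    have "card {..<card G} \<le> card ?\<L>"
      using order_trans[OF G(3) bits] n_subsets[of "{..<T'}" m'] by simp
    moreover have "finite ?\<L>" by (rule finite_subset[of _ "Pow {..<T'}"]) auto
    ultimately obtain enc where enc: "enc ` {..<card G} \<subseteq> ?\<L>" "inj_on enc {..<card G}"
      using card_le_inj[of "{..<card G}" ?\<L>] by blast
    obtain lab :: "real ^ 'd \<Rightarrow> nat" where lab: "lab \<in> measurable borel (count_space UNIV)" "\<And>x. lab x < T"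
      "\<And>f l. f \<in> ?F \<Longrightarrow> l < T \<Longrightarrow> 1 / (2 * real T) \<le> measure (dens f) {x. lab x = l} \<and>
      measure (dens f) {x. lab x = l} \<le> 2 / real T"
      using uniform_labels[OF \<beta> L T(1), where 'd = 'd] by blast
    interpret E: net_estimator \<beta> L \<phi> r "card G" g "C1 * 2 powr (- \<beta> * real i)" "4 * C1 * 2 powr (- \<beta> * real j)"
      B R lab enc n m T T'
    proof
      show "f x \<le> B" if "f \<in> ?F" for f x using bB[OF FH[OF that], of x] by linarith
      show "enc w \<subseteq> {..<T'} \<and> card (enc w) \<le> m" if "w < card G" for w using enc(1) that m by auto
    qed (use \<beta> L q o a R gG G(2) netg lab enc(2) T(2) m n in auto)
    define V where "V = B * M * (2 ^ (i * ?d) / real n)"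
    have V: "V > 0" using B M n by (simp add: V_def)
    have Vr: "B * real r / real n \<le> V"
      using mult_left_mono[OF r, of "B / real n"] B by (simp add: V_def mult_ac)
    let ?b = "2 * (C1 * 2 powr (- \<beta> * real i)) + 4 * C1 * 2 powr (- \<beta> * real j) + 2 * sqrt V +
      2 * R * (real T' * exp (- (real n / (2 * real T))) + 4 * real T' / real T)"
    have "coreset_minimax_risk TYPE('d) \<beta> L n m \<le> (SUP f\<in>?F. coreset_risk n E.est E.sch f)"
      unfolding coreset_minimax_risk_def
      by (rule INF_lower2[of "(E.est, E.sch)"]) (auto simp: E.est_in_estimators E.sch_in_coreset_schemes)
    also have "\<dots> \<le> ennreal ?b" by (rule SUP_least) (rule E.risk_bound[OF _ V Vr])
    also have "\<dots> \<le> ennreal (A * (2 powr (- \<beta> * real i) + 2 powr (- \<beta> * real j)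
      + sqrt (2 ^ (i * CARD('d)) / real n) + real T' * exp (- (real n / (2 * real T))) + real T' / real T))"
    proof (rule ennreal_leI)
      let ?a1 = "2 powr (- \<beta> * real i)" and ?a2 = "2 powr (- \<beta> * real j)" and ?a3 = "sqrt (2 ^ (i * CARD('d)) / real n)"
        and ?a4 = "real T' * exp (- (real n / (2 * real T)))" and ?a5 = "real T' / real T"
      have sV: "sqrt V = sqrt (B * M) * ?a3" unfolding V_def by (rule real_sqrt_mult)
      have "?b = (2 * C1) * ?a1 + (4 * C1) * ?a2 + (2 * sqrt (B * M)) * ?a3 + (2 * R) * ?a4 + (8 * R) * ?a5"
        unfolding sV by (simp add: algebra_simps)
      also have "\<dots> \<le> A * ?a1 + A * ?a2 + A * ?a3 + A * ?a4 + A * ?a5"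
        unfolding A_def using C1 Rpos sqBM by (intro add_mono mult_right_mono) auto
      finally show "?b \<le> A * (?a1 + ?a2 + ?a3 + ?a4 + ?a5)" by (simp add: algebra_simps)
    qed
    finally show ?thesis .
  qed
  then show ?thesis using K A by blast
qed

section \<open>Balancing the parameters\<close>

lemma dyadic_scale:
  assumes "y \<ge> (1::real)"
  shows "\<exists>i::nat. 2 ^ i \<le> y \<and> y < 2 ^ Suc i"
proof -
  define i where "i = nat \<lfloor>log 2 y\<rfloor>"
  have "0 \<le> log 2 y" using assms by simp
  then have i: "real i \<le> log 2 y" "log 2 y < real i + 1" unfolding i_def by linarith+
  have "2 powr real i \<le> 2 powr (log 2 y)" "2 powr (log 2 y) < 2 powr (real (Suc i))"
    using i by auto
  moreover have "2 powr (log 2 y) = y" using assms by simp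
  ultimately show ?thesis by (intro exI[of _ i]) (simp only: powr_realpow zero_less_numeral)
qed

lemma dyadic_scale_powr:
  assumes y: "y \<ge> (1::real)" and \<beta>: "\<beta> > 0" and i: "y < 2 ^ Suc i"
  shows "2 powr (- \<beta> * real i) \<le> 2 powr \<beta> * y powr (- \<beta>)"
proof -
  have "y powr \<beta> \<le> (2 powr real (Suc i)) powr \<beta>"
    using y \<beta> i by (intro powr_mono2) (auto simp: powr_realpow simp del: of_nat_Suc)
  also have "\<dots> = 2 powr \<beta> * 2 powr (\<beta> * real i)"
    by (simp add: powr_powr powr_add[symmetric] algebra_simps)
  finally have "y powr \<beta> \<le> 2 powr \<beta> * 2 powr (\<beta> * real i)" .
  then show ?thesis using y by (simp add: powr_minus field_simps)
qed

text \<open>Here \<open>e\<close> is the exponent of the full-data rate. \<open>T'\<close> must be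
  small against \<open>T\<close> and large against the code length: up to a logarithm it is smaller
  than \<open>T\<close> by the factor \<open>n powr (- 3/2 * e)\<close>, so \<open>T' / T\<close> is
  at most \<open>n powr (- e)\<close>; and it exceeds the code length by nearly
  \<open>n powr (e / 2)\<close>, so each point of a code word is worth a factor of at least
  \<open>n powr (e / 4)\<close> in the number of code words.\<close>

lemma upper_bound_at:
  fixes \<beta> e \<kappa> K A :: real and n m d :: nat
  assumes \<beta>: "\<beta> > 0" and d: "d \<ge> 1" and K: "K > 0" and A: "A > 0"
    and e: "e = \<beta> / (2 * \<beta> + real d)" and \<kappa>: "\<kappa> = e / (4 * K)"
    and main: "\<And>m' T T' i j :: nat. m' \<le> m \<Longrightarrow> 1 \<le> T \<Longrightarrow> T' \<le> T \<Longrightarrow>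
      exp (K * 2 ^ (j * d)) \<le> real (T' choose m') \<Longrightarrow>
      risk \<le> ennreal (A * (2 powr (- \<beta> * real i) + 2 powr (- \<beta> * real j)
      + sqrt (2 ^ (i * d) / real n) + real T' * exp (- (real n / (2 * real T))) + real T' / real T))"
    and m1: "m \<ge> 1"
    and n2: "real n \<ge> 2" "ln (real n) \<ge> 2" "\<kappa> * ln (real n) \<ge> 1"
    and a1: "8 * ln (real n) \<le> real n powr (e / 2)"
    and a2: "real n / (4 * ln (real n)) - 1 \<ge> real n / (8 * ln (real n))"
    and a3: "real n powr (1 - 3/2 * e) - 1 \<ge> real n powr (1 - 7/4 * e)"
    and a5: "real n powr (1 - 2 * e) \<ge> 2"
  shows "risk \<le> ennreal (A * (2 powr \<beta> + 2 powr \<beta> * \<kappa> powr (- \<beta> / real d) + 3) *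
    (real n powr (- e) + (real m * ln (real n)) powr (- \<beta> / real d)))"
proof -
  let ?n = "real n" and ?D = "real d"
  have D: "?D \<ge> 1" using d by simp
  have den: "2 * \<beta> + ?D > 0" using \<beta> D by linarith
  have e0: "e > 0" using \<beta> den by (simp add: e)
  have e1: "e < 1/2" using \<beta> D den by (simp add: e field_simps)
  have g: "1 - 2 * e = ?D / (2 * \<beta> + ?D)" using den by (simp add: e field_simps)
  have \<kappa>0: "\<kappa> > 0" using e0 K by (simp add: \<kappa>)
  \<comment> \<open>A given label is then missed with probability at most
    \<open>n powr (- 2)\<close>, which survives the union over all code labels.\<close>
  define T where "T = nat \<lfloor>?n / (4 * ln ?n)\<rfloor>"
  define T' where "T' = nat \<lfloor>?n powr (1 - 3/2 * e)\<rfloor>"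
  define N where "N = nat \<lfloor>?n powr (1 - 2 * e)\<rfloor>"
  \<comment> \<open>Since \<open>1 - 2 * e\<close> equals \<open>d / (2 * \<beta> + d)\<close>, a
    code of length \<open>N\<close> already reaches precision of order \<open>n powr (- e)\<close>;
    longer ones could not improve the order of the sum of the two rates.\<close>
  define m' where "m' = min m N"
  have T: "real T \<le> ?n / (4 * ln ?n)" "real T \<ge> ?n / (8 * ln ?n)"
  proof -
    have "0 \<le> ?n / (4 * ln ?n)" using n2 by simp
    then show "real T \<le> ?n / (4 * ln ?n)" "real T \<ge> ?n / (8 * ln ?n)" using a2 unfolding T_def by linarith+
  qed
  have Tpos: "real T > 0" using n2 by (intro less_le_trans[OF _ T(2)]) auto
  have T'u: "real T' \<le> ?n powr (1 - 3/2 * e)" unfolding T'_def by simp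
  have T'l: "real T' \<ge> ?n powr (1 - 7/4 * e)"
  proof -
    have "real T' \<ge> ?n powr (1 - 3/2 * e) - 1" unfolding T'_def by linarith
    then show ?thesis using a3 by linarith
  qed
  have N: "real N \<le> ?n powr (1 - 2 * e)" "real N \<ge> ?n powr (1 - 2 * e) / 2"
    using a5 unfolding N_def by linarith+
  have N1: "N \<ge> 1" using N(2) a5 by linarith
  have m'1: "m' \<ge> 1" using N1 m1 by (simp add: m'_def)
  have rT: "real T' / real T \<le> ?n powr (- e)"
  proof -
    have "real T' / real T \<le> ?n powr (1 - 3/2 * e) / (?n / (8 * ln ?n))"
      using T'u T n2 Tpos by (intro frac_le) auto
    also have "?n powr (1 - 3/2 * e) = ?n * ?n powr (- (3/2) * e)"
      using n2 powr_add[of ?n 1 "- (3/2) * e"] by simp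
    also have "?n * ?n powr (- (3/2) * e) / (?n / (8 * ln ?n)) = (8 * ln ?n) * ?n powr (- (3/2) * e)"
      using n2 by simp
    also have "\<dots> \<le> ?n powr (e / 2) * ?n powr (- (3/2) * e)"
      using a1 by (intro mult_right_mono) auto
    also have "\<dots> = ?n powr (- e)" by (simp add: powr_add[symmetric] field_simps)
    finally show ?thesis .
  qed
  have T'T: "T' \<le> T"
  proof -
    have "real T' / real T \<le> 1"
      using rT n2 e0 powr_mono[of "- e" 0 ?n] by simp
    then show ?thesis using Tpos by simp
  qed
  have missed: "real T' * exp (- (?n / (2 * real T))) \<le> ?n powr (- e)"
  proof -
    have "2 * ln ?n \<le> ?n / (2 * real T)"
      using T(1) Tpos n2 by (simp add: field_simps)
    then have "exp (- (?n / (2 * real T))) \<le> exp (- 2 * ln ?n)" by simp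
    also have "\<dots> = ?n powr (- 2)" using n2 by (simp add: powr_def)
    finally have "real T' * exp (- (?n / (2 * real T))) \<le> ?n powr (1 - 3/2 * e) * ?n powr (- 2)"
      using T'u by (intro mult_mono) auto
    also have "\<dots> = ?n powr (- 1 - 3/2 * e)" by (simp add: powr_add[symmetric])
    also have "\<dots> \<le> ?n powr (- e)" using n2 e0 by (intro powr_mono) auto
    finally show ?thesis .
  qed
  define y where "y = ?n powr (1 / (2 * \<beta> + ?D))"
  have y1: "y \<ge> 1" unfolding y_def using n2 den by (intro ge_one_powr_ge_zero) auto
  obtain i where i: "2 ^ i \<le> y" "y < 2 ^ Suc i" using dyadic_scale[OF y1] by blast
  have bias: "2 powr (- \<beta> * real i) \<le> 2 powr \<beta> * ?n powr (- e)"
    using dyadic_scale_powr[OF y1 \<beta> i(2)] by (simp add: y_def powr_powr e)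
  have var: "sqrt (2 ^ (i * d) / ?n) \<le> ?n powr (- e)"
  proof -
    have "(2::real) ^ (i * d) = (2 ^ i) ^ d" by (simp add: power_mult)
    also have "\<dots> \<le> y ^ d" using i by (intro power_mono) auto
    also have "\<dots> = ?n powr (1 - 2 * e)"
      using n2 d by (simp add: y_def g powr_powr powr_realpow[symmetric])
    finally have "2 ^ (i * d) / ?n \<le> ?n powr (1 - 2 * e) / ?n" by (intro divide_right_mono) auto
    also have "\<dots> = (?n powr (- e))\<^sup>2"
      using n2 powr_add[of ?n 1 "- 2 * e"] powr_add[of ?n "- e" "- e"] by (simp add: power2_eq_square)
    finally have "sqrt (2 ^ (i * d) / ?n) \<le> sqrt ((?n powr (- e))\<^sup>2)" by (rule real_sqrt_le_mono)
    then show ?thesis by simp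
  qed
  \<comment> \<open>By the choice of \<kappa>, \<open>K * X\<close> equals
    \<open>m' * (e / 4 * ln n)\<close>, the logarithm of a lower bound for the number of code words;
    a net with \<open>2 ^ (j * d) \<le> X\<close> can therefore be indexed.\<close>
  define X where "X = \<kappa> * (real m' * ln ?n)"
  have X1: "X \<ge> 1"
  proof -
    have "1 \<le> 1 * (\<kappa> * ln ?n)" using n2 by simp
    also have "\<dots> \<le> real m' * (\<kappa> * ln ?n)" using m'1 n2 by (intro mult_right_mono) auto
    finally show ?thesis by (simp add: X_def mult_ac)
  qed
  define z where "z = X powr (1 / ?D)"
  have z1: "z \<ge> 1" unfolding z_def using X1 D by (intro ge_one_powr_ge_zero) auto
  obtain j where j: "2 ^ j \<le> z" "z < 2 ^ Suc j" using dyadic_scale[OF z1] by blast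
  have code: "2 powr (- \<beta> * real j) \<le> 2 powr \<beta> * \<kappa> powr (- \<beta> / ?D) *
      (?n powr (- e) + (real m * ln ?n) powr (- \<beta> / ?D))"
  proof -
    have "2 powr (- \<beta> * real j) \<le> 2 powr \<beta> * X powr (- \<beta> / ?D)"
      using dyadic_scale_powr[OF z1 \<beta> j(2)] by (simp add: z_def powr_powr)
    also have "X powr (- \<beta> / ?D) = \<kappa> powr (- \<beta> / ?D) * (real m' * ln ?n) powr (- \<beta> / ?D)"
      unfolding X_def by (rule powr_mult)
    also have "(real m' * ln ?n) powr (- \<beta> / ?D) \<le> ?n powr (- e) + (real m * ln ?n) powr (- \<beta> / ?D)"
    proof (cases "m \<le> N")
      case True
      then show ?thesis by (simp add: m'_def)
    next
      case False
      then have "m' = N" by (simp add: m'_def)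
      have "?n powr (1 - 2 * e) / 2 * 2 \<le> real N * ln ?n" using N n2 by (intro mult_mono) auto
      then have "(real N * ln ?n) powr (- \<beta> / ?D) \<le> (?n powr (1 - 2 * e)) powr (- \<beta> / ?D)"
        using \<beta> D n2 by (intro powr_mono2') auto
      also have "\<dots> = ?n powr (- e)"
      proof -
        have "(1 - 2 * e) * (- \<beta> / ?D) = - e" unfolding g e using D den by (simp add: field_simps)
        then show ?thesis by (simp add: powr_powr)
      qed
      finally show ?thesis using \<open>m' = N\<close> by (simp add: add_increasing2)
    qed
    finally show ?thesis by (simp add: mult_left_mono mult.assoc)
  qed
  have bits: "exp (K * 2 ^ (j * d)) \<le> real (T' choose m')"
  proof -
    have "(2::real) ^ (j * d) = (2 ^ j) ^ d" by (simp add: power_mult)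
    also have "\<dots> \<le> z ^ d" using j by (intro power_mono) auto
    also have "\<dots> = X" using X1 d by (simp add: z_def powr_powr powr_realpow[symmetric])
    finally have "exp (K * 2 ^ (j * d)) \<le> exp (K * X)" using K by simp
    also have "K * X = real m' * (e / 4 * ln ?n)" using K by (simp add: X_def \<kappa>)
    also have "exp \<dots> = exp (e / 4 * ln ?n) ^ m'" by (rule exp_of_nat_mult)
    also have "exp (e / 4 * ln ?n) = ?n powr (e / 4)" using n2 by (simp add: powr_def)
    also have "(?n powr (e / 4)) ^ m' \<le> (real T' / real m') ^ m'"
    proof (intro power_mono)
      have "real m' \<le> ?n powr (1 - 2 * e)" using N by (simp add: m'_def)
      then have "?n powr (e / 4) * real m' \<le> ?n powr (e / 4) * ?n powr (1 - 2 * e)" by (intro mult_left_mono) auto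
      also have "\<dots> = ?n powr (1 - 7/4 * e)" by (simp add: powr_add[symmetric] field_simps)
      also have "\<dots> \<le> real T'" by (rule T'l)
      finally show "?n powr (e / 4) \<le> real T' / real m'" using m'1 by (simp add: pos_le_divide_eq)
    qed simp
    also have "\<dots> \<le> real (T' choose m')"
    proof (rule binomial_ge_n_over_k_pow_k)
      have "real m' \<le> ?n powr (1 - 2 * e)" using N by (simp add: m'_def)
      also have "\<dots> \<le> ?n powr (1 - 7/4 * e)" using n2 e0 by (intro powr_mono) auto
      also have "\<dots> \<le> real T'" by (rule T'l)
      finally show "m' \<le> T'" by simp
    qed
    finally show ?thesis .
  qed
  have "T \<ge> 1" using Tpos by simp
  from main[OF _ this T'T bits, of i]
  have "risk \<le> ennreal (A * (2 powr (- \<beta> * real i) + 2 powr (- \<beta> * real j)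
      + sqrt (2 ^ (i * d) / real n) + real T' * exp (- (real n / (2 * real T))) + real T' / real T))"
    by (simp add: m'_def)
  also have "\<dots> \<le> ennreal (A * (2 powr \<beta> + 2 powr \<beta> * \<kappa> powr (- \<beta> / real d) + 3) *
    (?n powr (- e) + (real m * ln ?n) powr (- \<beta> / real d)))"
  proof (rule ennreal_leI)
    let ?r = "?n powr (- e) + (real m * ln ?n) powr (- \<beta> / real d)"
    have ner: "?n powr (- e) \<le> ?r" by simp
    have "2 powr \<beta> * ?n powr (- e) \<le> 2 powr \<beta> * ?r" using ner by (intro mult_left_mono) auto
    with bias have b1: "2 powr (- \<beta> * real i) \<le> 2 powr \<beta> * ?r" by linarith
    have "2 powr (- \<beta> * real i) + 2 powr (- \<beta> * real j)
      + sqrt (2 ^ (i * d) / real n) + real T' * exp (- (real n / (2 * real T))) + real T' / real T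
      \<le> 2 powr \<beta> * ?r + 2 powr \<beta> * \<kappa> powr (- \<beta> / real d) * ?r + ?r + ?r + ?r"
      using b1 code var missed rT ner by (intro add_mono) linarith+
    also have "\<dots> = (2 powr \<beta> + 2 powr \<beta> * \<kappa> powr (- \<beta> / real d) + 3) * ?r"
      by (simp add: algebra_simps)
    finally show "A * (2 powr (- \<beta> * real i) + 2 powr (- \<beta> * real j)
      + sqrt (2 ^ (i * d) / real n) + real T' * exp (- (real n / (2 * real T))) + real T' / real T)
      \<le> A * (2 powr \<beta> + 2 powr \<beta> * \<kappa> powr (- \<beta> / real d) + 3) * ?r"
      using A by (simp add: mult.assoc)
  qed
  finally show ?thesis .
qed

lemma upper_bound:
  assumes \<beta>: "\<beta> > 0" and L: "L > 0" and ne: "holder_densities \<beta> L \<noteq> ({} :: (real ^ 'd::finite \<Rightarrow> real) set)"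
  shows "\<exists>C>0. \<forall>m :: nat \<Rightarrow> nat. (\<lambda>n. real (m n)) \<in> o(\<lambda>n. real n) \<longrightarrow>
    (\<forall>\<^sub>F n in sequentially. 1 \<le> m n) \<longrightarrow>
    (\<forall>\<^sub>F n in sequentially. coreset_minimax_risk TYPE('d) \<beta> L n (m n) \<le>
      ennreal (C * (real n powr (- \<beta> / (2 * \<beta> + real CARD('d)))
        + (real (m n) * ln (real n)) powr (- \<beta> / real CARD('d)))))"
proof -
  let ?d = "CARD('d)"
  obtain K A where K: "K > 0" and A: "A > 0" and main: "\<And>n m m' T T' i j :: nat. 1 \<le> n \<Longrightarrow> 2 * m \<le> n \<Longrightarrow> m' \<le> m \<Longrightarrow> 1 \<le> T \<Longrightarrow> T' \<le> T \<Longrightarrow>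
    exp (K * 2 ^ (j * ?d)) \<le> real (T' choose m') \<Longrightarrow>
    coreset_minimax_risk TYPE('d) \<beta> L n m \<le> ennreal (A * (2 powr (- \<beta> * real i) + 2 powr (- \<beta> * real j)
      + sqrt (2 ^ (i * ?d) / real n) + real T' * exp (- (real n / (2 * real T))) + real T' / real T))"
    using upper_bound_parameters[OF assms] by blast
  have d: "?d \<ge> 1" by (simp add: Suc_le_eq)
  define e where "e = \<beta> / (2 * \<beta> + real ?d)"
  define \<kappa> where "\<kappa> = e / (4 * K)"
  have den: "2 * \<beta> + real ?d > 0" using \<beta> by (simp add: add_pos_pos)
  have e0: "e > 0" and e1: "e < 1/2" using \<beta> den by (simp_all add: e_def field_simps)
  have \<kappa>0: "\<kappa> > 0" using e0 K by (simp add: \<kappa>_def)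
  define C where "C = A * (2 powr \<beta> + 2 powr \<beta> * \<kappa> powr (- \<beta> / real ?d) + 3)"
  have C: "C > 0" unfolding C_def using A by (intro mult_pos_pos add_nonneg_pos add_nonneg_nonneg) auto
  have ev: "\<forall>\<^sub>F n in sequentially. real n \<ge> 2" "\<forall>\<^sub>F n in sequentially. ln (real n) \<ge> 2"
    "\<forall>\<^sub>F n in sequentially. \<kappa> * ln (real n) \<ge> 1"
    "\<forall>\<^sub>F n in sequentially. 8 * ln (real n) \<le> real n powr (e / 2)"
    "\<forall>\<^sub>F n in sequentially. real n / (4 * ln (real n)) - 1 \<ge> real n / (8 * ln (real n))"
    "\<forall>\<^sub>F n in sequentially. real n powr (1 - 3/2 * e) - 1 \<ge> real n powr (1 - 7/4 * e)"
    "\<forall>\<^sub>F n in sequentially. real n powr (1 - 2 * e) \<ge> 2"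
    using e0 e1 \<kappa>0 by real_asymp+
  have "\<forall>\<^sub>F n in sequentially. coreset_minimax_risk TYPE('d) \<beta> L n (m n) \<le>
      ennreal (C * (real n powr (- \<beta> / (2 * \<beta> + real ?d)) + (real (m n) * ln (real n)) powr (- \<beta> / real ?d)))"
    if mo: "(\<lambda>n. real (m n)) \<in> o(\<lambda>n. real n)" and m1: "\<forall>\<^sub>F n in sequentially. 1 \<le> m n" for m :: "nat \<Rightarrow> nat"
  proof -
    have "\<forall>\<^sub>F n in sequentially. norm (real (m n)) \<le> 1/2 * norm (real n)"
      using mo by (rule landau_o.smallD) simp
    then show ?thesis using m1 ev
    proof eventually_elim
      case (elim n)
      \<comment> \<open>Here m = o(n) enters: the coreset can be padded from half of the
        sample.\<close>
      have "2 * m n \<le> n" using elim(1) by simp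
      moreover have "1 \<le> n" using elim(3) by simp
      ultimately have "coreset_minimax_risk TYPE('d) \<beta> L n (m n) \<le> ennreal (A * (2 powr \<beta> + 2 powr \<beta> * \<kappa> powr (- \<beta> / real ?d) + 3) *
        (real n powr (- e) + (real (m n) * ln (real n)) powr (- \<beta> / real ?d)))"
        using elim by (intro upper_bound_at[OF \<beta> d K A e_def \<kappa>_def] main) auto
      then show ?case by (simp add: C_def e_def)
    qed
  qed
  then show ?thesis using C by blast
qed

subsection \<open>Bump functions\<close>

lemma power_dvd_pderiv:
  fixes p q :: "real poly"
  assumes "q ^ Suc n dvd p"
  shows "q ^ n dvd pderiv p"
proof -
  obtain s where "p = q ^ Suc n * s" using assms by (auto elim: dvdE)
  then have "pderiv p = q ^ Suc n * pderiv s + s * (smult (of_nat (Suc n)) (q ^ n) * pderiv q)"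
    by (simp only: pderiv_mult pderiv_power_Suc)
  also have "\<dots> = q ^ n * (q * pderiv s + smult (of_nat (Suc n)) (s * pderiv q))"
    by (simp add: algebra_simps)
  finally show ?thesis by simp
qed

text \<open>The end conditions make the polynomial and the zero function agree to first order at 0
  and 1, so the pieces glue to a differentiable function.\<close>

lemma truncated_poly_derivative:
  fixes p :: "real poly"
  assumes "poly p 0 = 0" "poly p 1 = 0" "poly (pderiv p) 0 = 0" "poly (pderiv p) 1 = 0"
  shows "((\<lambda>t. if t \<in> {0..1} then poly p t else 0) has_real_derivative
    (if t \<in> {0..1} then poly (pderiv p) t else 0)) (at t)"
proof -
  have cl: "closure (- {0..1::real}) = - {0<..<1}"
    by (simp add: closure_complement)
  have "((\<lambda>t. if t \<in> {0..1} then poly p t else 0) has_derivative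
      (if t \<in> {0..1} then (\<lambda>h. poly (pderiv p) t * h) else (\<lambda>h. 0))) (at t within ({0..1} \<union> - {0..1}))"
  proof (rule has_derivative_If_within_closures[where f' = "\<lambda>t h. poly (pderiv p) t * h" and g' = "\<lambda>t h. 0"])
    show "(poly p has_derivative (*) (poly (pderiv p) t)) (at t within {0..1} \<union> closure {0..1} \<inter> closure (- {0..1}))"
      using poly_DERIV[of p t] unfolding has_field_derivative_def by (rule has_derivative_at_withinI)
    assume "t \<in> closure {0..1}" "t \<in> closure (- {0..1})"
    then have "t = 0 \<or> t = 1" unfolding cl by auto
    then show "poly p t = 0" "(\<lambda>h. poly (pderiv p) t * h) = (\<lambda>h. 0)" using assms by auto
  qed auto
  moreover have "{0..1} \<union> - {0..1} = (UNIV :: real set)" by auto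
  moreover have "(if t \<in> {0..1} then (\<lambda>h. poly (pderiv p) t * h) else (\<lambda>h. 0)) =
      (*) (if t \<in> {0..1} then poly (pderiv p) t else 0)" by (auto simp: fun_eq_iff)
  ultimately show ?thesis unfolding has_field_derivative_def by (simp only:)
qed

text \<open>Only finitely many derivatives are needed, so a polynomial with zeros of high order at 0
  and 1, cut off outside, serves as a bump. The factor \<open>1 - 2 * t\<close> makes it odd about
  1/2: perturbations then have integral zero, and the result stays a density. The price is a sign
  change, so the lower bound holds on part of the left half only.\<close>

lemma smooth_bump:
  "\<exists>(b :: nat \<Rightarrow> real \<Rightarrow> real) B \<kappa>. B > 0 \<and> \<kappa> > 0 \<and>
    (\<forall>l\<le>K. \<forall>t. (b l has_real_derivative b (Suc l) t) (at t)) \<and>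
    (\<forall>l\<le>Suc K. \<forall>t. \<bar>b l t\<bar> \<le> B) \<and>
    (\<forall>l\<le>Suc K. \<forall>t. t \<notin> {0<..<1} \<longrightarrow> b l t = 0) \<and>
    (\<forall>t. b 0 (1 - t) = - b 0 t) \<and> (\<forall>t. 1/8 \<le> t \<longrightarrow> t \<le> 3/8 \<longrightarrow> \<kappa> \<le> b 0 t)"
proof -
  \<comment> \<open>A zero of order \<open>K + 3\<close> survives \<open>K + 2\<close>
    derivatives.\<close>
  define r where "r = K + 3"
  define p :: "real poly" where "p = [:0, 1:] ^ r * [:1, -1:] ^ r * [:1, -2:]"
  define P where "P l = (pderiv ^^ l) p" for l
  define b where "b l t = (if t \<in> {0..1} then poly (P l) t else 0)" for l t
  have dv: "[:0, 1:] ^ n dvd P l \<and> [:1, -1:] ^ n dvd P l" if "n + l = r" for n l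
    using that
  proof (induction l arbitrary: n)
    case 0
    have "[:0, 1:] ^ r dvd p" "[:1, -1:] ^ r dvd p"
      unfolding p_def mult.assoc by (rule dvd_triv_left, intro dvd_mult dvd_triv_left)
    then show ?case using 0 by (simp only: P_def funpow_0 add_0_right simp_thms)
  next
    case (Suc l)
    then have "Suc n + l = r" by simp
    from Suc.IH[OF this] have "[:0, 1:] ^ Suc n dvd P l \<and> [:1, -1:] ^ Suc n dvd P l" .
    then show ?case using power_dvd_pderiv unfolding P_def funpow.simps o_apply by blast
  qed
  have z: "poly (P l) 0 = 0 \<and> poly (P l) 1 = 0" if l: "l \<le> K + 2" for l
  proof -
    have "Suc (K + 2 - l) + l = r" using l by (simp add: r_def)
    then obtain n where n: "Suc n + l = r" by blast
    have "[:0, 1:] dvd P l" "[:1, -1:] dvd P l"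
      using dv[OF n] by (auto intro: dvd_trans[OF dvd_triv_left])
    then obtain k1 k2 where "P l = [:0, 1:] * k1" "P l = [:1, -1:] * k2" unfolding dvd_def by blast
    then have "poly (P l) 0 = poly ([:0, 1:] * k1) 0" "poly (P l) 1 = poly ([:1, -1:] * k2) 1" by simp_all
    then show ?thesis by (simp only: poly_mult) simp
  qed
  have PS: "P (Suc l) = pderiv (P l)" for l by (simp add: P_def)
  have der: "(b l has_real_derivative b (Suc l) t) (at t)" if "l \<le> K" for l t
  proof -
    have "(b l has_real_derivative (if t \<in> {0..1} then poly (pderiv (P l)) t else 0)) (at t)"
      unfolding b_def[abs_def]
      by (rule truncated_poly_derivative) (use z[of l] z[of "Suc l"] that in \<open>auto simp: PS\<close>)
    then show ?thesis by (simp only: b_def PS)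
  qed
  have "\<exists>C. \<forall>t. \<bar>b l t\<bar> \<le> C" for l
  proof -
    have "compact (poly (P l) ` {0..1})"
      by (intro compact_continuous_image continuous_intros) auto
    then obtain C where "\<And>t. t \<in> {0..1} \<Longrightarrow> \<bar>poly (P l) t\<bar> \<le> C"
      using compact_imp_bounded bounded_iff by (metis image_eqI real_norm_def)
    then have "\<bar>b l t\<bar> \<le> max C 0" for t by (auto simp: b_def le_max_iff_disj)
    then show ?thesis by blast
  qed
  then obtain C where C: "\<And>l t. \<bar>b l t\<bar> \<le> C l" by metis
  define B where "B = 1 + (\<Sum>l\<le>Suc K. \<bar>C l\<bar>)"
  have bB: "\<bar>b l t\<bar> \<le> B" if "l \<le> Suc K" for l t
  proof -
    have "\<bar>C l\<bar> \<le> (\<Sum>l\<le>Suc K. \<bar>C l\<bar>)" by (rule member_le_sum) (use that in auto)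
    then show ?thesis using C[of l t] unfolding B_def by linarith
  qed
  have B: "B > 0" unfolding B_def by (intro add_pos_nonneg sum_nonneg) auto
  have p: "poly p t = t ^ r * (1 - t) ^ r * (1 - 2 * t)" for t by (simp add: p_def algebra_simps)
  have odd: "b 0 (1 - t) = - b 0 t" for t
    by (auto simp: b_def P_def p algebra_simps)
  \<comment> \<open>Here \<open>t\<close> and \<open>1 - t\<close> are at least 1/8 and
    \<open>1 - 2 * t\<close> is at least 1/4.\<close>
  have low: "(1/8) ^ r * (1/8) ^ r * (1/4) \<le> b 0 t" if "1/8 \<le> t" "t \<le> 3/8" for t
  proof -
    have "(1/8) ^ r * (1/8) ^ r * (1/4) \<le> t ^ r * (1 - t) ^ r * (1 - 2 * t)"
      using that by (intro mult_mono power_mono) auto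
    then show ?thesis using that by (simp add: b_def P_def p)
  qed
  have van: "b l t = 0" if "l \<le> Suc K" "t \<notin> {0<..<1}" for l t
  proof -
    have "t \<notin> {0..1} \<or> t = 0 \<or> t = 1" using that(2) by auto
    then show ?thesis using z[of l] that(1) by (auto simp: b_def)
  qed
  have "(1/8) ^ r * (1/8) ^ r * (1/4) > (0::real)" by simp
  with B der bB van odd low show ?thesis by blast
qed

text \<open>\<open>b l\<close> stands for the derivative of order \<open>l\<close> of the bump,
  \<open>u c\<close> for the lower corner and \<open>h\<close> for the width of cell
  \<open>c\<close>. By \<open>disj\<close> the open cells are disjoint, so at each point at most one
  summand is active and no bound depends on the number of cells.\<close>

locale bump_family =
  fixes b :: "nat \<Rightarrow> real \<Rightarrow> real" and K :: nat and B :: real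
    and I :: "'c set" and u :: "'c \<Rightarrow> real ^ 'd::finite" and h :: real
  assumes der: "\<And>l t. l \<le> K \<Longrightarrow> (b l has_real_derivative b (Suc l) t) (at t)"
    and bd: "\<And>l t. l \<le> Suc K \<Longrightarrow> \<bar>b l t\<bar> \<le> B"
    and van: "\<And>l t. l \<le> Suc K \<Longrightarrow> t \<notin> {0<..<1} \<Longrightarrow> b l t = 0"
    and h: "h > 0" and I: "finite I"
    and disj: "\<And>c c' x. c \<in> I \<Longrightarrow> c' \<in> I \<Longrightarrow> (\<And>i. (x $ i - u c $ i) / h \<in> {0<..<1}) \<Longrightarrow>
      (\<And>i. (x $ i - u c' $ i) / h \<in> {0<..<1}) \<Longrightarrow> c = c'"
begin

text \<open>The vector \<open>s\<close> counts derivatives in each coordinate. The powers of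
  \<open>1 / h\<close> from the chain rule are kept in the coefficients of \<open>bumps\<close>, so
  a partial derivative of \<open>bumps\<close> is again of that form.\<close>

definition tensor :: "('d \<Rightarrow> nat) \<Rightarrow> 'c \<Rightarrow> real ^ 'd \<Rightarrow> real" where
  "tensor s c x = (\<Prod>i\<in>UNIV. b (s i) ((x $ i - u c $ i) / h))"

definition bumps :: "('c \<Rightarrow> real) \<Rightarrow> ('d \<Rightarrow> nat) \<Rightarrow> real ^ 'd \<Rightarrow> real" where
  "bumps a s x = (\<Sum>c\<in>I. a c * tensor s c x)"

lemma tensor_nonzero:
  assumes "\<And>i. s i \<le> Suc K" "tensor s c x \<noteq> 0"
  shows "(x $ i - u c $ i) / h \<in> {0<..<1}"
proof (rule ccontr)
  assume "(x $ i - u c $ i) / h \<notin> {0<..<1}"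
  then have "b (s i) ((x $ i - u c $ i) / h) = 0" using van assms(1) by blast
  then have "tensor s c x = 0" unfolding tensor_def by (metis UNIV_I finite prod_zero)
  then show False using assms by simp
qed

lemma tensor_bound:
  assumes "\<And>i. s i \<le> Suc K"
  shows "\<bar>tensor s c x\<bar> \<le> B ^ CARD('d)"
proof -
  have "\<bar>tensor s c x\<bar> = (\<Prod>i\<in>UNIV. \<bar>b (s i) ((x $ i - u c $ i) / h)\<bar>)"
    by (simp add: tensor_def abs_prod)
  also have "\<dots> \<le> (\<Prod>i\<in>(UNIV :: 'd set). B)"
    using bd assms by (intro prod_mono) auto
  finally show ?thesis by simp
qed

lemma bumps_single:
  assumes s: "\<And>i. s i \<le> Suc K" and c: "c \<in> I" "\<And>i. (x $ i - u c $ i) / h \<in> {0<..<1}"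
  shows "bumps a s x = a c * tensor s c x"
proof -
  have "bumps a s x = (\<Sum>c'\<in>{c}. a c' * tensor s c' x)"
    unfolding bumps_def
  proof (rule sum.mono_neutral_right[OF I])
    show "\<forall>c'\<in>I - {c}. a c' * tensor s c' x = 0"
    proof
      fix c' assume c': "c' \<in> I - {c}"
      have "tensor s c' x = 0"
      proof (rule ccontr)
        assume "tensor s c' x \<noteq> 0"
        from disj[OF c(1) _ c(2) tensor_nonzero[OF s this]] c' show False by auto
      qed
      then show "a c' * tensor s c' x = 0" by simp
    qed
  qed (use c in auto)
  then show ?thesis by simp
qed

lemma bumps_outside:
  assumes s: "\<And>i. s i \<le> Suc K" and "\<not> (\<exists>c\<in>I. \<forall>i. (x $ i - u c $ i) / h \<in> {0<..<1})"
  shows "bumps a s x = 0"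
  unfolding bumps_def
proof (intro sum.neutral ballI)
  fix c assume c: "c \<in> I"
  have "tensor s c x = 0"
  proof (rule ccontr)
    assume "tensor s c x \<noteq> 0"
    from tensor_nonzero[OF s this] c assms(2) show False by blast
  qed
  then show "a c * tensor s c x = 0" by simp
qed

lemma bumps_bound:
  assumes s: "\<And>i. s i \<le> Suc K" and a: "\<And>c. c \<in> I \<Longrightarrow> \<bar>a c\<bar> \<le> A" and A: "0 \<le> A"
  shows "\<bar>bumps a s x\<bar> \<le> A * B ^ CARD('d)"
proof -
  have B: "0 \<le> B" using bd[of 0 0] by linarith
  show ?thesis
  proof (cases "\<exists>c\<in>I. \<forall>i. (x $ i - u c $ i) / h \<in> {0<..<1}")
    case True
    then obtain c where c: "c \<in> I" "\<And>i. (x $ i - u c $ i) / h \<in> {0<..<1}" by blast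
    show ?thesis unfolding bumps_single[OF s c] abs_mult
      by (intro mult_mono a c tensor_bound s) (use A B in auto)
  next
    case False
    show ?thesis unfolding bumps_outside[OF s False] using A B by simp
  qed
qed

lemma tensor_differentiable:
  assumes s: "\<And>i. s i \<le> K"
  shows "tensor s c differentiable (at x)"
proof -
  have "\<exists>f'. ((\<lambda>x. b (s i) ((x $ i - u c $ i) / h)) has_derivative f') (at x)" for i
  proof -
    have "((\<lambda>x. (x $ i - u c $ i) / h) has_derivative (\<lambda>y. y $ i / h)) (at x)"
      using h by (auto intro!: derivative_eq_intros bounded_linear.has_derivative[OF bounded_linear_vec_nth] simp: divide_inverse)
    from has_derivative_compose[OF this, of "b (s i)"] der[OF s[of i]]
    show ?thesis unfolding has_field_derivative_def by blast
  qed
  then obtain f' where f': "\<And>i. ((\<lambda>x. b (s i) ((x $ i - u c $ i) / h)) has_derivative f' i) (at x)" by metis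
  show ?thesis unfolding tensor_def[abs_def] differentiable_def
    by (rule exI, rule has_derivative_prod, rule f')
qed

lemma bumps_differentiable:
  assumes s: "\<And>i. s i \<le> K"
  shows "bumps a s differentiable (at x)"
  unfolding bumps_def[abs_def]
  by (intro differentiable_sum I ballI differentiable_mult tensor_differentiable s) auto

lemma tensor_line_derivative:
  assumes s: "s j \<le> K"
  shows "((\<lambda>t. tensor s c (x + t *\<^sub>R axis j 1)) has_real_derivative
    tensor (s(j := Suc (s j))) c x / h) (at 0)"
proof -
  let ?R = "\<Prod>i\<in>UNIV - {j}. b (s i) ((x $ i - u c $ i) / h)"
  have e: "tensor s c (x + t *\<^sub>R axis j 1) = b (s j) ((x $ j + t - u c $ j) / h) * ?R" for t
  proof -
    have "tensor s c (x + t *\<^sub>R axis j 1) = b (s j) (((x + t *\<^sub>R axis j 1) $ j - u c $ j) / h) *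
        (\<Prod>i\<in>UNIV - {j}. b (s i) (((x + t *\<^sub>R axis j 1) $ i - u c $ i) / h))"
      unfolding tensor_def by (rule prod.remove) auto
    also have "(\<Prod>i\<in>UNIV - {j}. b (s i) (((x + t *\<^sub>R axis j 1) $ i - u c $ i) / h)) = ?R"
      by (intro prod.cong) (auto simp: axis_def)
    finally show ?thesis by (simp add: axis_def)
  qed
  have e2: "tensor (s(j := Suc (s j))) c x = b (Suc (s j)) ((x $ j - u c $ j) / h) * ?R"
    unfolding tensor_def by (subst prod.remove[of UNIV j]) auto
  have "((\<lambda>t. b (s j) ((x $ j + t - u c $ j) / h)) has_real_derivative
      b (Suc (s j)) ((x $ j + 0 - u c $ j) / h) * (1 / h)) (at 0)"
    by (rule DERIV_chain2[OF der[OF s]]) (use h in \<open>auto intro!: derivative_eq_intros\<close>)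
  from DERIV_cmult_right[OF this, of ?R] show ?thesis
    unfolding e e2 by (simp add: mult_ac)
qed

lemma partial_deriv_bumps:
  assumes s: "s j \<le> K"
  shows "partial_deriv j (bumps a s) = bumps (\<lambda>c. a c / h) (s(j := Suc (s j)))"
proof
  fix x
  have "((\<lambda>t. bumps a s (x + t *\<^sub>R axis j 1)) has_real_derivative
      (\<Sum>c\<in>I. a c * (tensor (s(j := Suc (s j))) c x / h))) (at 0)"
    unfolding bumps_def by (intro DERIV_sum DERIV_cmult tensor_line_derivative s)
  then show "partial_deriv j (bumps a s) x = bumps (\<lambda>c. a c / h) (s(j := Suc (s j))) x"
    unfolding partial_deriv_def by (subst DERIV_imp_deriv) (auto simp: bumps_def)
qed

lemma times_differentiable_bumps:
  "(\<And>i. s i + l \<le> Suc K) \<Longrightarrow> times_differentiable l (bumps a s)"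
proof (induction l arbitrary: a s)
  case (Suc l)
  have s: "s i \<le> K" for i using Suc.prems[of i] by linarith
  have le: "(s(j := Suc (s j))) i + l \<le> Suc K" for i j
    using Suc.prems[of i] Suc.prems[of j] by (cases "i = j") auto
  have "times_differentiable l (partial_deriv j (bumps a s))" for j
    unfolding partial_deriv_bumps[OF s] by (rule Suc.IH[OF le])
  then show ?case using bumps_differentiable[OF s] by simp
qed simp

lemma iter_partial_bumps:
  "length is \<le> Suc K \<Longrightarrow> \<exists>s. (\<forall>i. s i \<le> length is) \<and>
    iter_partial is (bumps a (\<lambda>_. 0)) = bumps (\<lambda>c. a c / h ^ length is) s"
proof (induction "is")
  case Nil
  then show ?case by (intro exI[of _ "\<lambda>_. 0"]) auto
next
  case (Cons j "is")
  then obtain s where s: "\<And>i. s i \<le> length is"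
    and e: "iter_partial is (bumps a (\<lambda>_. 0)) = bumps (\<lambda>c. a c / h ^ length is) s" by auto
  have "s j \<le> K" using s[of j] Cons.prems by simp
  then have "iter_partial (j # is) (bumps a (\<lambda>_. 0)) = bumps (\<lambda>c. a c / h ^ length is / h) (s(j := Suc (s j)))"
    unfolding iter_partial_Cons e by (rule partial_deriv_bumps)
  moreover have "a c / h ^ length is / h = a c / h ^ length (j # is)" for c by (simp add: mult.commute)
  ultimately have e': "iter_partial (j # is) (bumps a (\<lambda>_. 0)) = bumps (\<lambda>c. a c / h ^ length (j # is)) (s(j := Suc (s j)))"
    by (simp only:)
  have le: "(s(j := Suc (s j))) i \<le> length (j # is)" for i using s[of i] s[of j] by simp
  show ?case by (rule exI[of _ "s(j := Suc (s j))"], rule conjI, rule allI, rule le, rule e')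
qed

lemma bumps_lipschitz:
  assumes s: "\<And>i. s i \<le> K" and a: "\<And>c. c \<in> I \<Longrightarrow> \<bar>a c\<bar> \<le> A" and A: "0 \<le> A"
  shows "\<bar>bumps a s x - bumps a s y\<bar> \<le> real CARD('d) * (A * B ^ CARD('d)) * (norm (x - y) / h)"
proof -
  let ?v = "x - y"
  define D where "D t = (\<Sum>i\<in>UNIV. ?v $ i * partial_deriv i (bumps a s) (y + t *\<^sub>R ?v))" for t :: real
  have "((\<lambda>t. bumps a s (y + t *\<^sub>R ?v)) has_real_derivative D t) (at t)" for t
    unfolding D_def by (rule line_derivative) (rule bumps_differentiable[OF s])
  then obtain t :: real where t: "bumps a s (y + 1 *\<^sub>R ?v) - bumps a s (y + 0 *\<^sub>R ?v) = (1 - 0) * D t"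
    using MVT2[of 0 1 "\<lambda>t. bumps a s (y + t *\<^sub>R ?v)" D] by auto
  have "\<bar>D t\<bar> \<le> (\<Sum>i\<in>UNIV. \<bar>?v $ i * partial_deriv i (bumps a s) (y + t *\<^sub>R ?v)\<bar>)"
    unfolding D_def by (rule sum_abs)
  also have "\<dots> \<le> (\<Sum>i\<in>(UNIV :: 'd set). norm ?v * (A / h * B ^ CARD('d)))"
  proof (intro sum_mono)
    fix i :: 'd
    have "\<bar>partial_deriv i (bumps a s) (y + t *\<^sub>R ?v)\<bar> \<le> A / h * B ^ CARD('d)"
      unfolding partial_deriv_bumps[OF s]
    proof (rule bumps_bound)
      show "(s(i := Suc (s i))) i' \<le> Suc K" for i' using s[of i'] s[of i] by simp
      show "\<bar>a c / h\<bar> \<le> A / h" if "c \<in> I" for c using a[OF that] h by (simp add: abs_divide divide_right_mono)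
      show "0 \<le> A / h" using A h by simp
    qed
    then show "\<bar>?v $ i * partial_deriv i (bumps a s) (y + t *\<^sub>R ?v)\<bar> \<le> norm ?v * (A / h * B ^ CARD('d))"
      unfolding abs_mult by (intro mult_mono component_le_norm_cart) auto
  qed
  also have "\<dots> = real CARD('d) * (A * B ^ CARD('d)) * (norm (x - y) / h)" by simp
  finally show ?thesis using t by simp
qed

text \<open>Within distance \<open>h\<close> the Lipschitz bound is stronger than the Hoelder bound;
  beyond it twice the supremum suffices. With amplitude \<open>A\<close> of order
  \<open>h powr (real K + \<alpha>)\<close> the constant no longer depends on
  \<open>h\<close>.\<close>

lemma bumps_holder:
  assumes a: "\<And>c. c \<in> I \<Longrightarrow> \<bar>a c\<bar> \<le> A" and A: "0 \<le> A" and \<alpha>: "0 < \<alpha>" "\<alpha> \<le> 1"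
  shows "holder_derivs K \<alpha> (2 * real CARD('d) * A * B ^ CARD('d) / h powr (real K + \<alpha>)) (bumps a (\<lambda>_. 0))"
  unfolding holder_derivs_def
proof (intro conjI allI impI)
  show "times_differentiable K (bumps a (\<lambda>_. 0))" by (rule times_differentiable_bumps) simp
  fix "is" :: "'d list" and x y :: "real ^ 'd" assume l: "length is = K"
  let ?d = "real CARD('d)"
  have d1: "?d \<ge> 1" by (simp add: Suc_le_eq)
  have B: "0 \<le> B" using bd[of 0 0] by linarith
  obtain s where s: "\<And>i. s i \<le> K" and e: "iter_partial is (bumps a (\<lambda>_. 0)) = bumps (\<lambda>c. a c / h ^ K) s"
    using iter_partial_bumps[of "is" a] l by auto
  have a': "\<bar>a c / h ^ K\<bar> \<le> A / h ^ K" if "c \<in> I" for c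
    using a[OF that] h by (simp add: abs_divide divide_right_mono)
  have A': "0 \<le> A / h ^ K" using A h by simp
  define M where "M = A / h ^ K * B ^ CARD('d)"
  have M: "0 \<le> M" unfolding M_def by (intro mult_nonneg_nonneg A' zero_le_power B)
  let ?g = "bumps (\<lambda>c. a c / h ^ K) s" and ?z = "norm (x - y) / h"
  have z: "0 \<le> ?z" using h by simp
  have "\<bar>?g x - ?g y\<bar> \<le> 2 * ?d * M * ?z powr \<alpha>"
  proof (cases "?z \<le> 1")
    case True
    have "?z \<le> ?z powr \<alpha>"
    proof (cases "?z = 0")
      case False
      then have "?z powr 1 \<le> ?z powr \<alpha>" using True z \<alpha> by (intro powr_mono') auto
      then show ?thesis using z False h by simp
    next
      case True
      then show ?thesis by (simp only: powr_zero_eq_one powr_0 order_refl)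
    qed
    have "\<bar>?g x - ?g y\<bar> \<le> ?d * M * ?z" unfolding M_def by (rule bumps_lipschitz[OF s a' A'])
    also have "\<dots> \<le> 2 * ?d * M * ?z powr \<alpha>"
      using \<open>?z \<le> ?z powr \<alpha>\<close> M d1 z by (intro mult_mono) auto
    finally show ?thesis .
  next
    case False
    have s': "s i \<le> Suc K" for i using s[of i] by simp
    have gM: "\<bar>?g w\<bar> \<le> M" for w unfolding M_def by (rule bumps_bound[OF s' a' A'])
    have "\<bar>?g x - ?g y\<bar> \<le> M + M" using gM[of x] gM[of y] by linarith
    also have "\<dots> = 2 * 1 * M * 1" by simp
    also have "\<dots> \<le> 2 * ?d * M * ?z powr \<alpha>"
      using False M d1 \<alpha> by (intro mult_mono) (auto intro: ge_one_powr_ge_zero)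
    finally show ?thesis .
  qed
  also have "2 * ?d * M * ?z powr \<alpha> = 2 * ?d * A * B ^ CARD('d) / h powr (real K + \<alpha>) * norm (x - y) powr \<alpha>"
    using h by (simp add: M_def powr_divide powr_add powr_realpow)
  finally show "\<bar>iter_partial is (bumps a (\<lambda>_. 0)) x - iter_partial is (bumps a (\<lambda>_. 0)) y\<bar>
      \<le> 2 * ?d * A * B ^ CARD('d) / h powr (real K + \<alpha>) * norm (x - y) powr \<alpha>"
    unfolding e .
qed

lemma bumps_measurable [measurable]: "bumps a (\<lambda>_. 0) \<in> borel_measurable borel"
  by (intro borel_measurable_continuous_onI continuous_at_imp_continuous_on ballI
      differentiable_imp_continuous_within bumps_differentiable) simp

end

section \<open>Sums of Hoelder functions\<close>

lemma partial_deriv_add: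
  fixes f g :: "real ^ 'd::finite \<Rightarrow> real"
  assumes "\<And>x. f differentiable (at x)" "\<And>x. g differentiable (at x)"
  shows "partial_deriv i (\<lambda>x. f x + g x) = (\<lambda>x. partial_deriv i f x + partial_deriv i g x)"
proof
  fix x
  have d: "((\<lambda>t. F (x + t *\<^sub>R axis i 1)) has_real_derivative partial_deriv i F x) (at 0)"
    if F: "\<And>x. F differentiable (at x)" for F :: "real ^ 'd \<Rightarrow> real"
  proof -
    have "(\<Sum>j\<in>UNIV. axis i (1::real) $ j * q j) = q i" for q :: "'d \<Rightarrow> real"
      by (simp add: axis_def mult_delta_left)
    from this[of "\<lambda>j. partial_deriv j F x"] show ?thesis
      using line_derivative[of F x 0 "axis i 1"] F by simp
  qed
  from DERIV_add[OF d[OF assms(1)] d[OF assms(2)]]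
  show "partial_deriv i (\<lambda>x. f x + g x) x = partial_deriv i f x + partial_deriv i g x"
    unfolding partial_deriv_def by (rule DERIV_imp_deriv)
qed

lemma times_differentiable_add:
  "times_differentiable k f \<Longrightarrow> times_differentiable k g \<Longrightarrow> times_differentiable k (\<lambda>x. f x + g x)"
proof (induction k arbitrary: f g)
  case (Suc k)
  then have "partial_deriv i (\<lambda>x. f x + g x) = (\<lambda>x. partial_deriv i f x + partial_deriv i g x)" for i
    by (intro partial_deriv_add) auto
  then show ?case using Suc by auto
qed simp

lemma iter_partial_add:
  "times_differentiable k f \<Longrightarrow> times_differentiable k g \<Longrightarrow> length is \<le> k \<Longrightarrow>
    iter_partial is (\<lambda>x. f x + g x) = (\<lambda>x. iter_partial is f x + iter_partial is g x)"
proof (induction "is" arbitrary: k f g rule: rev_induct)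
  case (snoc i "is")
  then obtain k' where k: "k = Suc k'" by (cases k) auto
  have "partial_deriv i (\<lambda>x. f x + g x) = (\<lambda>x. partial_deriv i f x + partial_deriv i g x)"
    using snoc.prems k by (intro partial_deriv_add) auto
  then show ?case
    unfolding iter_partial_snoc using snoc.prems k by (simp add: snoc.IH[of k'])
qed simp

text \<open>This is how a base density with constant \<open>L'\<close> leaves the room
  \<open>L - L'\<close> for the bumps.\<close>

lemma holder_derivs_add:
  fixes f g :: "real ^ 'd::finite \<Rightarrow> real"
  assumes f: "holder_derivs k \<alpha> L f" and g: "holder_derivs k \<alpha> M g"
  shows "holder_derivs k \<alpha> (L + M) (\<lambda>x. f x + g x)"
  unfolding holder_derivs_def
proof (intro conjI allI impI)
  show "times_differentiable k (\<lambda>x. f x + g x)"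
    using f g by (intro times_differentiable_add) (auto simp: holder_derivs_def)
  fix "is" :: "'d list" and x y :: "real ^ 'd" assume l: "length is = k"
  have "iter_partial is (\<lambda>x. f x + g x) = (\<lambda>x. iter_partial is f x + iter_partial is g x)"
    using f g l by (intro iter_partial_add[of k]) (auto simp: holder_derivs_def)
  moreover have "\<bar>iter_partial is f x - iter_partial is f y\<bar> \<le> L * norm (x - y) powr \<alpha>"
    "\<bar>iter_partial is g x - iter_partial is g y\<bar> \<le> M * norm (x - y) powr \<alpha>"
    using f g l by (auto simp: holder_derivs_def)
  ultimately show "\<bar>iter_partial is (\<lambda>x. f x + g x) x - iter_partial is (\<lambda>x. f x + g x) y\<bar>
      \<le> (L + M) * norm (x - y) powr \<alpha>"
    by (simp add: distrib_right)
qed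

lemma holder_derivs_mono:
  "holder_derivs k \<alpha> L f \<Longrightarrow> L \<le> M \<Longrightarrow> holder_derivs k \<alpha> M f"
  unfolding holder_derivs_def by (blast intro: order_trans[OF _ mult_right_mono[OF _ powr_ge_zero]])

subsection \<open>Perturbations of a density\<close>

text \<open>Reflecting one coordinate about the center of a cell changes the sign of the bump there,
  which forces its integral to be zero. The map is affine and diagonal in the standard basis, with
  all diagonal entries 1 or -1.\<close>

lemma integral_reflect_coordinate:
  fixes g :: "real ^ 'd::finite \<Rightarrow> real"
  assumes g: "g \<in> borel_measurable borel"
  shows "(\<integral>x. g (\<chi> i. if i = j then 2 * t - x $ i else x $ i) \<partial>lborel) = (\<integral>x. g x \<partial>lborel)"
proof -
  let ?e = "axis j (1::real) :: real ^ 'd"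
  define c where "c v = (if v = ?e then -1 else 1 :: real)" for v :: "real ^ 'd"
  define T where "T x = (2 * t) *\<^sub>R ?e + (\<Sum>v\<in>Basis. (c v * (x \<bullet> v)) *\<^sub>R v)" for x :: "real ^ 'd"
  have e: "?e \<in> Basis" by (auto simp: Basis_vec_def)
  have Tm: "T \<in> borel_measurable borel" unfolding T_def by measurable
  have T: "T x = (\<chi> i. if i = j then 2 * t - x $ i else x $ i)" for x
  proof -
    have "(\<Sum>v\<in>Basis. (c v * (x \<bullet> v)) *\<^sub>R v) = (\<Sum>v\<in>Basis. (x \<bullet> v) *\<^sub>R v - (if v = ?e then (2 * (x \<bullet> v)) *\<^sub>R v else 0))"
      by (intro sum.cong) (auto simp: c_def scaleR_2[symmetric] algebra_simps simp flip: scaleR_left_distrib)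
    also have "\<dots> = x - (2 * (x \<bullet> ?e)) *\<^sub>R ?e"
      using e by (simp add: sum_subtractf euclidean_representation)
    also have "x \<bullet> ?e = x $ j" by (simp add: inner_axis)
    finally have "T x = (2 * t) *\<^sub>R ?e + (x - (2 * x $ j) *\<^sub>R ?e)" by (simp only: T_def)
    then show ?thesis by (simp add: vec_eq_iff axis_def)
  qed
  have "lborel = density (distr lborel borel T) (\<lambda>_. (\<Prod>v\<in>Basis. \<bar>c v\<bar>))"
    unfolding T_def by (rule lborel_affine_euclidean) (simp add: c_def)
  also have "(\<Prod>v\<in>Basis. \<bar>c v\<bar>) = 1" by (intro prod.neutral) (auto simp: c_def)
  finally have "lborel = distr lborel borel T" by (simp add: density_1 one_ennreal_def[symmetric])
  then have "(\<integral>x. g x \<partial>lborel) = (\<integral>x. g x \<partial>distr lborel borel T)" by simp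
  also have "\<dots> = (\<integral>x. g (T x) \<partial>lborel)" by (rule integral_distr) (use Tm g in auto)
  finally show ?thesis by (simp add: T)
qed

lemma integrable_bounded_support:
  fixes f :: "'a::euclidean_space \<Rightarrow> real"
  assumes m: "f \<in> borel_measurable borel" and b: "\<And>x. \<bar>f x\<bar> \<le> B" and z: "\<And>x. x \<notin> cbox c d \<Longrightarrow> f x = 0"
  shows "integrable lborel f" "\<bar>\<integral>x. f x \<partial>lborel\<bar> \<le> B * measure lborel (cbox c d)"
proof -
  have le: "\<bar>f x\<bar> \<le> B * indicator (cbox c d) x" for x
    using b[of x] z[of x] by (auto simp: indicator_def)
  have i: "integrable lborel (\<lambda>x. B * indicator (cbox c d) x :: real)"
    by (intro integrable_mult_right integrable_real_indicator emeasure_bounded_finite) auto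
  show int: "integrable lborel f"
    by (rule Bochner_Integration.integrable_bound[OF i]) (use m order_trans[OF le abs_ge_self] in auto)
  have "\<bar>\<integral>x. f x \<partial>lborel\<bar> \<le> (\<integral>x. \<bar>f x\<bar> \<partial>lborel)" by (rule integral_abs_bound)
  also have "\<dots> \<le> (\<integral>x. B * indicator (cbox c d) x \<partial>lborel)"
    by (rule integral_mono) (use le i int in auto)
  finally show "\<bar>\<integral>x. f x \<partial>lborel\<bar> \<le> B * measure lborel (cbox c d)" by simp
qed

text \<open>The perturbations are confined to this cube: division by the density is harmless there,
  and small perturbations keep it nonnegative.\<close>

lemma density_positive_cube:
  fixes f :: "real ^ 'd::finite \<Rightarrow> real"
  assumes \<beta>: "\<beta> > 0" and f: "f \<in> holder_densities \<beta> L"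
  shows "\<exists>q \<rho> \<delta>. 0 < \<rho> \<and> \<rho> \<le> 1 \<and> 0 < \<delta> \<and> (\<forall>x. (\<forall>i. q $ i \<le> x $ i \<and> x $ i \<le> q $ i + \<rho>) \<longrightarrow> \<delta> \<le> f x)"
proof -
  note hf = holder_densitiesD[OF f]
  have "\<exists>q. f q > 0"
  proof (rule ccontr)
    assume "\<not> (\<exists>q. f q > 0)"
    then have "f x = 0" for x using hf(2)[of x] by (metis less_eq_real_def)
    then have "f = (\<lambda>_. 0)" by auto
    then show False using hf(4) by simp
  qed
  then obtain q where q: "f q > 0" by blast
  have "isCont f q" using holder_class_continuous[OF \<beta> hf(1)] by (simp add: continuous_on_eq_continuous_at)
  then obtain e where e: "e > 0" "\<And>x. dist x q < e \<Longrightarrow> dist (f x) (f q) < f q / 2"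
    unfolding continuous_at_eps_delta using q by (metis half_gt_zero)
  define \<rho> where "\<rho> = min 1 (e / (2 * real CARD('d)))"
  have \<rho>: "0 < \<rho>" "\<rho> \<le> 1" using e by (auto simp: \<rho>_def)
  have "f q / 2 \<le> f x" if x: "\<forall>i. q $ i \<le> x $ i \<and> x $ i \<le> q $ i + \<rho>" for x
  proof -
    have "dist x q \<le> (\<Sum>i\<in>UNIV. \<bar>(x - q) $ i\<bar>)" unfolding dist_norm by (rule norm_le_l1_cart)
    also have "\<dots> \<le> (\<Sum>i\<in>(UNIV :: 'd set). \<rho>)"
    proof (intro sum_mono)
      fix i show "\<bar>(x - q) $ i\<bar> \<le> \<rho>" using spec[OF x, of i] by simp
    qed
    also have "\<dots> = real CARD('d) * \<rho>" by simp
    also have "\<dots> \<le> real CARD('d) * (e / (2 * real CARD('d)))" by (intro mult_left_mono) (auto simp: \<rho>_def)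
    also have "\<dots> < e" using e by simp
    finally have "dist (f x) (f q) < f q / 2" by (rule e)
    then show ?thesis unfolding dist_real_def by linarith
  qed
  then show ?thesis using \<rho> q by (intro exI[of _ q] exI[of _ \<rho>] exI[of _ "f q / 2"]) auto
qed

text \<open>\<open>F \<theta>\<close> adds to \<open>f0\<close> a bump of height of order
  \<open>h powr \<beta>\<close> on each cell in \<theta>, the largest order that the Hoelder
  condition allows at width \<open>h\<close>. Therefore the chi-square divergence from
  \<open>f0\<close> is at most, and the squared distance between two hypotheses at least, of order
  \<open>N powr (- 2 * \<beta>)\<close>, the latter scaled by the fraction of cells in which they
  differ. \<open>LR\<close> is the likelihood ratio with respect to \<open>f0\<close>.\<close>

lemma perturbations:
  fixes f0 :: "real ^ 'd::finite \<Rightarrow> real"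
  assumes \<beta>: "\<beta> > 0" and L: "L' < L" and f0: "f0 \<in> holder_densities \<beta> L'"
  shows "\<exists>a1>0. \<exists>a2>0. \<forall>N\<ge>(1::nat). \<exists>(I :: ('d \<Rightarrow> nat) set) F LR. finite I \<and> card I = N ^ CARD('d) \<and>
    (\<forall>\<theta>. \<theta> \<subseteq> I \<longrightarrow> F \<theta> \<in> holder_densities \<beta> L \<and> LR \<theta> \<in> borel_measurable borel \<and>
      (\<forall>x. 0 \<le> LR \<theta> x \<and> LR \<theta> x \<le> 2 \<and> F \<theta> x = f0 x * LR \<theta> x) \<and>
      integrable lborel (\<lambda>x. f0 x * (LR \<theta> x)\<^sup>2) \<and>
      (\<integral>x. f0 x * (LR \<theta> x)\<^sup>2 \<partial>lborel) \<le> 1 + a2 * real N powr (- 2 * \<beta>)) \<and>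
    (\<forall>\<theta> \<theta>'. \<theta> \<subseteq> I \<longrightarrow> \<theta>' \<subseteq> I \<longrightarrow>
      a1 * (real (card (sym_diff \<theta> \<theta>')) / real (card I)) * real N powr (- 2 * \<beta>) \<le> (L2_norm (\<lambda>x. F \<theta> x - F \<theta>' x))\<^sup>2)"
proof -
  let ?K = "strict_floor \<beta>" and ?d = "CARD('d)"
  note hf = holder_densitiesD[OF f0]
  obtain q \<rho> \<delta> where \<rho>: "0 < \<rho>" "\<rho> \<le> 1" and \<delta>: "0 < \<delta>"
    and cube: "\<And>x. (\<And>i. q $ i \<le> x $ i \<and> x $ i \<le> q $ i + \<rho>) \<Longrightarrow> \<delta> \<le> f0 x"
    using density_positive_cube[OF \<beta> f0] by blast
  obtain b B \<kappa> where B: "B > 0" and \<kappa>: "\<kappa> > 0"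
    and bump: "\<forall>l\<le>?K. \<forall>t. (b l has_real_derivative b (Suc l) t) (at t)"
      "\<forall>l\<le>Suc ?K. \<forall>t. \<bar>b l t\<bar> \<le> B" "\<forall>l\<le>Suc ?K. \<forall>t. t \<notin> {0<..<1} \<longrightarrow> b l t = 0"
      "\<forall>t. b 0 (1 - t) = - b 0 t" "\<forall>t. 1/8 \<le> t \<longrightarrow> t \<le> 3/8 \<longrightarrow> \<kappa> \<le> b 0 t"
    using smooth_bump[of ?K] by blast
  have der: "\<And>l t. l \<le> ?K \<Longrightarrow> (b l has_real_derivative b (Suc l) t) (at t)"
    and bd: "\<And>l t. l \<le> Suc ?K \<Longrightarrow> \<bar>b l t\<bar> \<le> B"
    and van: "\<And>l t. l \<le> Suc ?K \<Longrightarrow> t \<notin> {0<..<1} \<Longrightarrow> b l t = 0"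
    and odd: "\<And>t. b 0 (1 - t) = - b 0 t" and low: "\<And>t. 1/8 \<le> t \<Longrightarrow> t \<le> 3/8 \<Longrightarrow> \<kappa> \<le> b 0 t"
    using bump by blast+
  have d1: "real ?d \<ge> 1" by (simp add: Suc_le_eq)
  have Bd: "B ^ ?d > 0" using B by simp
  \<comment> \<open>The first bound keeps the Hoelder constant of the perturbation within
    \<open>L - L'\<close>; the second keeps its size at most \<delta> and so the likelihood ratio
    between 0 and 2.\<close>
  define a where "a = min ((L - L') / (2 * real ?d * B ^ ?d)) (\<delta> / B ^ ?d)"
  have a: "a > 0" using L Bd \<delta> d1 by (simp add: a_def)
  have aL: "2 * real ?d * a * B ^ ?d \<le> L - L'"
  proof -
    have "a \<le> (L - L') / (2 * real ?d * B ^ ?d)" by (simp add: a_def)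
    then show ?thesis using Bd d1 by (simp add: pos_le_divide_eq mult_ac)
  qed
  have a\<delta>: "a * B ^ ?d \<le> \<delta>"
  proof -
    have "a \<le> \<delta> / B ^ ?d" by (simp add: a_def)
    then show ?thesis using Bd by (simp add: pos_le_divide_eq)
  qed
  define Q where "Q = cbox q (\<chi> i. q $ i + \<rho>)"
  \<comment> \<open>Each cell in which two hypotheses differ contributes a cube of side
    \<open>h / 4\<close> on which every factor of the bump is at least \<kappa>; over the full grid
    these cubes have total volume \<open>(\<rho> / 4) ^ CARD('d)\<close>.\<close>
  define a1 where "a1 = a\<^sup>2 * (\<kappa> ^ ?d)\<^sup>2 * \<rho> powr (2 * \<beta>) * (\<rho> / 4) ^ ?d"
  define a2 where "a2 = (a * B ^ ?d)\<^sup>2 * \<rho> powr (2 * \<beta>) / \<delta> * (measure lborel Q + 1)"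
  have a1: "a1 > 0" using a \<kappa> \<rho> by (simp add: a1_def)
  have a2: "a2 > 0" unfolding a2_def using a B Bd \<rho> \<delta> by (intro mult_pos_pos divide_pos_pos add_nonneg_pos) auto
  have "\<exists>(I :: ('d \<Rightarrow> nat) set) F LR. finite I \<and> card I = N ^ CARD('d) \<and>
    (\<forall>\<theta>. \<theta> \<subseteq> I \<longrightarrow> F \<theta> \<in> holder_densities \<beta> L \<and> LR \<theta> \<in> borel_measurable borel \<and>
      (\<forall>x. 0 \<le> LR \<theta> x \<and> LR \<theta> x \<le> 2 \<and> F \<theta> x = f0 x * LR \<theta> x) \<and>
      integrable lborel (\<lambda>x. f0 x * (LR \<theta> x)\<^sup>2) \<and>
      (\<integral>x. f0 x * (LR \<theta> x)\<^sup>2 \<partial>lborel) \<le> 1 + a2 * real N powr (- 2 * \<beta>)) \<and>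
    (\<forall>\<theta> \<theta>'. \<theta> \<subseteq> I \<longrightarrow> \<theta>' \<subseteq> I \<longrightarrow>
      a1 * (real (card (sym_diff \<theta> \<theta>')) / real (card I)) * real N powr (- 2 * \<beta>) \<le> (L2_norm (\<lambda>x. F \<theta> x - F \<theta>' x))\<^sup>2)"
    if N: "N \<ge> 1" for N :: nat
  proof -
    define h where "h = \<rho> / real N"
    have hh: "h > 0" "h \<le> 1" "real N * h = \<rho>" using \<rho> N by (auto simp: h_def field_simps)
    define I where "I = (UNIV :: 'd set) \<rightarrow> {0..<N}"
    define u where "u c = (\<chi> i. q $ i + h * real (c i))" for c :: "'d \<Rightarrow> nat"
    have fI: "finite I" and cI: "card I = N ^ ?d"
      using finite_PiE[of "UNIV :: 'd set" "\<lambda>_. {0..<N}"] card_PiE[of "UNIV :: 'd set" "\<lambda>_. {0..<N}"]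
      by (simp_all add: I_def PiE_UNIV_domain)
    have cellD: "real (c i) < (x $ i - q $ i) / h \<and> (x $ i - q $ i) / h < real (c i) + 1"
      if "(x $ i - u c $ i) / h \<in> {0<..<1}" for c i and x :: "real ^ 'd"
      using that hh by (simp add: u_def field_simps)
    interpret bump_family b ?K B I u h
    proof
      show "c = c'" if c: "\<And>i. (x $ i - u c $ i) / h \<in> {0<..<1}" and c': "\<And>i. (x $ i - u c' $ i) / h \<in> {0<..<1}" for c c' x
      proof
        fix i show "c i = c' i" using cellD[OF c, of i] cellD[OF c', of i] by linarith
      qed
    qed (use der bd van hh fI in auto)
    define A where "A = a * h powr \<beta>"
    have hb: "h powr \<beta> \<le> 1" using hh \<beta> by (simp add: powr_le1)
    have A: "A > 0" using a hh by (simp add: A_def)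
    have A\<delta>: "A * B ^ ?d \<le> \<delta>"
    proof -
      have "A * B ^ ?d = (a * B ^ ?d) * h powr \<beta>" by (simp add: A_def)
      also have "\<dots> \<le> (a * B ^ ?d) * 1" using hb a Bd by (intro mult_left_mono) auto
      finally show ?thesis using a\<delta> by simp
    qed
    have A2: "A\<^sup>2 = a\<^sup>2 * \<rho> powr (2 * \<beta>) * real N powr (- 2 * \<beta>)"
    proof -
      have "(h powr \<beta>)\<^sup>2 = h powr (2 * \<beta>)" by (simp add: power2_eq_square powr_add[symmetric])
      also have "\<dots> = \<rho> powr (2 * \<beta>) / real N powr (2 * \<beta>)" using \<rho> by (simp add: h_def powr_divide)
      also have "\<dots> = \<rho> powr (2 * \<beta>) * real N powr (- 2 * \<beta>)" by (simp add: powr_minus divide_inverse)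
      finally show ?thesis by (simp add: A_def power_mult_distrib mult.assoc)
    qed
    define coefs where "coefs \<theta> c = A * indicator \<theta> c" for \<theta> and c :: "'d \<Rightarrow> nat"
    define g where "g \<theta> = bumps (coefs \<theta>) (\<lambda>_. 0)" for \<theta>
    have cA: "\<bar>coefs \<theta> c\<bar> \<le> A" for \<theta> c using A by (simp add: coefs_def indicator_def)
    have gm: "g \<theta> \<in> borel_measurable borel" for \<theta> unfolding g_def by measurable
    have gb: "\<bar>g \<theta> x\<bar> \<le> A * B ^ ?d" for \<theta> x
      unfolding g_def by (rule bumps_bound) (use cA A in auto)
    have gQ: "x \<in> Q \<and> \<delta> \<le> f0 x" if nz: "g \<theta> x \<noteq> 0" for \<theta> x
    proof -
      have "\<exists>c\<in>I. \<forall>i. (x $ i - u c $ i) / h \<in> {0<..<1}"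
        using bumps_outside[of "\<lambda>_. 0" x "coefs \<theta>"] nz unfolding g_def by auto
      then obtain c where c: "c \<in> I" "\<And>i. (x $ i - u c $ i) / h \<in> {0<..<1}" by blast
      have in_cube: "q $ i \<le> x $ i \<and> x $ i \<le> q $ i + \<rho>" for i
      proof -
        have "c i < N" using c(1) by (auto simp: I_def)
        then have ci: "real (c i) + 1 \<le> real N" by linarith
        have b1: "0 \<le> (x $ i - q $ i) / h" and b2: "(x $ i - q $ i) / h \<le> real N"
          using cellD[OF c(2), of i] ci by linarith+
        have "x $ i - q $ i \<le> real N * h" using b2 hh(1) by (simp add: pos_divide_le_eq)
        moreover have "0 \<le> x $ i - q $ i" using b1 hh(1) by (simp add: zero_le_divide_iff)
        ultimately show ?thesis using hh(3) by linarith
      qed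
      then show ?thesis using cube by (auto simp: Q_def mem_box_cart)
    qed
    have g0: "g \<theta> x = 0" if "x \<notin> Q" for \<theta> x using gQ that by blast
    have g_int: "integrable lborel (g \<theta>)" for \<theta>
      by (rule integrable_bounded_support(1)[OF gm gb]) (use g0 in \<open>auto simp: Q_def\<close>)
    have g_mean: "(\<integral>x. g \<theta> x \<partial>lborel) = 0" for \<theta>
    proof -
      have tz: "(\<integral>x. tensor (\<lambda>_. 0) c x \<partial>lborel) = 0 \<and> integrable lborel (tensor (\<lambda>_. 0) c)" for c
      proof -
        \<comment> \<open>One odd factor suffices, so any coordinate may be reflected.\<close>
        obtain j :: 'd where True by blast
        have tm: "tensor (\<lambda>_. 0) c \<in> borel_measurable borel"
          by (intro borel_measurable_continuous_onI continuous_at_imp_continuous_on ballI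
            differentiable_imp_continuous_within tensor_differentiable) simp
        have r: "tensor (\<lambda>_. 0) c (\<chi> i. if i = j then 2 * (u c $ j + h / 2) - x $ i else x $ i) = - tensor (\<lambda>_. 0) c x" for x
        proof -
          have "(2 * (u c $ j + h / 2) - x $ j - u c $ j) / h = 1 - (x $ j - u c $ j) / h"
            using hh by (simp add: field_simps)
          then have bj: "b 0 ((2 * (u c $ j + h / 2) - x $ j - u c $ j) / h) = - b 0 ((x $ j - u c $ j) / h)"
            by (simp only: odd)
          have R: "(\<Prod>i\<in>UNIV - {j}. b 0 ((((\<chi> i. if i = j then 2 * (u c $ j + h / 2) - x $ i else x $ i) :: real ^ 'd) $ i - u c $ i) / h))
            = (\<Prod>i\<in>UNIV - {j}. b 0 ((x $ i - u c $ i) / h))"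
            by (intro prod.cong) auto
          have "tensor (\<lambda>_. 0) c (\<chi> i. if i = j then 2 * (u c $ j + h / 2) - x $ i else x $ i)
            = b 0 ((2 * (u c $ j + h / 2) - x $ j - u c $ j) / h) * (\<Prod>i\<in>UNIV - {j}. b 0 ((x $ i - u c $ i) / h))"
            unfolding tensor_def R[symmetric] by (subst prod.remove[of UNIV j]) auto
          also have "\<dots> = - (b 0 ((x $ j - u c $ j) / h) * (\<Prod>i\<in>UNIV - {j}. b 0 ((x $ i - u c $ i) / h)))"
            by (simp only: bj mult_minus_left)
          also have "b 0 ((x $ j - u c $ j) / h) * (\<Prod>i\<in>UNIV - {j}. b 0 ((x $ i - u c $ i) / h)) = tensor (\<lambda>_. 0) c x"
            unfolding tensor_def by (subst prod.remove[of UNIV j]) auto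
          finally show ?thesis .
        qed
        have "(\<integral>x. tensor (\<lambda>_. 0) c x \<partial>lborel) = (\<integral>x. - tensor (\<lambda>_. 0) c x \<partial>lborel)"
          using integral_reflect_coordinate[OF tm, of j "u c $ j + h / 2"] unfolding r by simp
        then have z: "(\<integral>x. tensor (\<lambda>_. 0) c x \<partial>lborel) = 0" by simp
        have "integrable lborel (tensor (\<lambda>_. 0) c)"
        proof (rule integrable_bounded_support(1)[OF tm tensor_bound])
          show "tensor (\<lambda>_. 0) c x = 0" if x: "x \<notin> cbox (u c) (\<chi> i. u c $ i + h)" for x
          proof (rule ccontr)
            assume nz: "tensor (\<lambda>_. 0) c x \<noteq> 0"
            have "(x $ i - u c $ i) / h \<in> {0<..<1}" for i by (rule tensor_nonzero[OF _ nz]) simp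
            then have "u c $ i \<le> x $ i \<and> x $ i \<le> u c $ i + h" for i
              using hh(1) by (simp add: pos_divide_less_eq zero_less_divide_iff less_imp_le) (smt (verit))
            then show False using x by (auto simp: mem_box_cart)
          qed
        qed simp
        with z show ?thesis by blast
      qed
      have "(\<integral>x. g \<theta> x \<partial>lborel) = (\<Sum>c\<in>I. (\<integral>x. coefs \<theta> c * tensor (\<lambda>_. 0) c x \<partial>lborel))"
        unfolding g_def bumps_def using tz by (intro Bochner_Integration.integral_sum) auto
      also have "\<dots> = 0" using tz by simp
      finally show ?thesis .
    qed
    define F where "F \<theta> x = f0 x + g \<theta> x" for \<theta> x
    \<comment> \<open>Where \<open>f0\<close> vanishes so does \<open>g \<theta>\<close>, and
      division by zero yields the wanted value 1.\<close>
    define LR where "LR \<theta> x = 1 + g \<theta> x / f0 x" for \<theta> x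
    have LRm: "LR \<theta> \<in> borel_measurable borel" for \<theta> unfolding LR_def using gm hf(5) by measurable
    have LRb: "0 \<le> LR \<theta> x \<and> LR \<theta> x \<le> 2 \<and> F \<theta> x = f0 x * LR \<theta> x" for \<theta> x
    proof (cases "g \<theta> x = 0")
      case True then show ?thesis by (simp add: LR_def F_def)
    next
      case False
      then have f: "\<delta> \<le> f0 x" using gQ by blast
      then have "\<bar>g \<theta> x\<bar> \<le> f0 x" using gb[of \<theta> x] A\<delta> by linarith
      then have "\<bar>g \<theta> x / f0 x\<bar> \<le> 1" using f \<delta> by (simp add: abs_divide)
      then have "0 \<le> 1 + g \<theta> x / f0 x \<and> 1 + g \<theta> x / f0 x \<le> 2" by linarith
      moreover have "f0 x + g \<theta> x = f0 x * (1 + g \<theta> x / f0 x)" using f \<delta> by (simp add: distrib_left)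
      ultimately show ?thesis unfolding LR_def F_def by blast
    qed
    have FH: "F \<theta> \<in> holder_densities \<beta> L" for \<theta>
    proof -
      have hd: "holder_derivs ?K (\<beta> - real ?K) L' f0" and z: "\<And>x. x \<notin> unit_box \<Longrightarrow> f0 x = 0"
        using hf(1) unfolding holder_class_iff by auto
      have "holder_derivs ?K (\<beta> - real ?K) (2 * real ?d * A * B ^ ?d / h powr (real ?K + (\<beta> - real ?K))) (g \<theta>)"
        unfolding g_def by (rule bumps_holder) (use cA A strict_floor_bounds[OF \<beta>] in auto)
      then have "holder_derivs ?K (\<beta> - real ?K) (L - L') (g \<theta>)"
        by (rule holder_derivs_mono) (use aL hh in \<open>simp add: A_def\<close>)
      from holder_derivs_add[OF hd this] have "holder_derivs ?K (\<beta> - real ?K) L (F \<theta>)"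
        by (simp add: F_def[abs_def])
      moreover have "F \<theta> x = 0" if x: "x \<notin> unit_box" for x
      proof -
        have "g \<theta> x = 0" using gQ[of \<theta> x] z[OF x] \<delta> by (cases "g \<theta> x = 0") auto
        then show ?thesis using z[OF x] by (simp add: F_def)
      qed
      ultimately have "F \<theta> \<in> holder_class \<beta> L" unfolding holder_class_iff by blast
      moreover have "0 \<le> F \<theta> x" for x using LRb[of \<theta> x] hf(2)[of x] by (metis mult_nonneg_nonneg)
      moreover have "has_bochner_integral lborel (F \<theta>) (1 + 0)"
        unfolding F_def using hf(3,4) g_int[of \<theta>] g_mean[of \<theta>]
        by (intro has_bochner_integral_add) (auto simp: has_bochner_integral_iff)
      ultimately show ?thesis by (simp add: holder_densities_def)
    qed
    have chi: "integrable lborel (\<lambda>x. f0 x * (LR \<theta> x)\<^sup>2) \<and>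
      (\<integral>x. f0 x * (LR \<theta> x)\<^sup>2 \<partial>lborel) \<le> 1 + a2 * real N powr (- 2 * \<beta>)" for \<theta>
    proof -
      \<comment> \<open>The linear term integrates to zero; only the quadratic one, of the order of
        the square of \<open>A\<close>, is left.\<close>
      have e: "f0 x * (LR \<theta> x)\<^sup>2 = f0 x + 2 * g \<theta> x + (g \<theta> x)\<^sup>2 / f0 x" for x
      proof (cases "g \<theta> x = 0")
        case True then show ?thesis by (simp add: LR_def)
      next
        case False
        then have "f0 x \<noteq> 0" using gQ[of \<theta> x] \<delta> by auto
        then show ?thesis by (simp add: LR_def power2_eq_square field_simps)
      qed
      let ?C = "(A * B ^ ?d)\<^sup>2 / \<delta>"
      have r: "\<bar>(g \<theta> x)\<^sup>2 / f0 x\<bar> \<le> ?C" for x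
      proof (cases "g \<theta> x = 0")
        case True then show ?thesis using \<delta> by simp
      next
        case False
        then have f: "\<delta> \<le> f0 x" using gQ by blast
        have "\<bar>g \<theta> x\<bar>\<^sup>2 \<le> (A * B ^ ?d)\<^sup>2" by (intro power_mono gb) auto
        then show ?thesis using f \<delta> by (simp add: abs_divide) (intro frac_le, auto)
      qed
      have rm: "(\<lambda>x. (g \<theta> x)\<^sup>2 / f0 x) \<in> borel_measurable borel" using gm hf(5) by measurable
      have rz: "(g \<theta> x)\<^sup>2 / f0 x = 0" if "x \<notin> cbox q (\<chi> i. q $ i + \<rho>)" for x
        using g0[of x \<theta>] that by (simp add: Q_def)
      have ri: "integrable lborel (\<lambda>x. (g \<theta> x)\<^sup>2 / f0 x)"
        "\<bar>\<integral>x. (g \<theta> x)\<^sup>2 / f0 x \<partial>lborel\<bar> \<le> ?C * measure lborel Q"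
        unfolding Q_def by (rule integrable_bounded_support[OF rm r rz]; assumption)+
      have "(\<integral>x. f0 x * (LR \<theta> x)\<^sup>2 \<partial>lborel) = 1 + 2 * 0 + (\<integral>x. (g \<theta> x)\<^sup>2 / f0 x \<partial>lborel)"
        unfolding e using hf(3,4) g_int[of \<theta>] g_mean[of \<theta>] ri(1) by simp
      also have "(\<integral>x. (g \<theta> x)\<^sup>2 / f0 x \<partial>lborel) \<le> ?C * measure lborel Q" using ri(2) by linarith
      also have "\<dots> \<le> ?C * (measure lborel Q + 1)" using \<delta> by (intro mult_left_mono) auto
      also have "\<dots> = a2 * real N powr (- 2 * \<beta>)"
        by (simp add: a2_def power_mult_distrib A2)
      finally have "(\<integral>x. f0 x * (LR \<theta> x)\<^sup>2 \<partial>lborel) \<le> 1 + a2 * real N powr (- 2 * \<beta>)" by simp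
      moreover have "integrable lborel (\<lambda>x. f0 x * (LR \<theta> x)\<^sup>2)"
        unfolding e using hf(3) g_int[of \<theta>] ri(1) by simp
      ultimately show ?thesis by blast
    qed
    have sep: "a1 * (real (card (sym_diff \<theta> \<theta>')) / real (card I)) * real N powr (- 2 * \<beta>) \<le> (L2_norm (\<lambda>x. F \<theta> x - F \<theta>' x))\<^sup>2"
      if \<theta>: "\<theta> \<subseteq> I" "\<theta>' \<subseteq> I" for \<theta> \<theta>'
    proof -
      let ?\<Delta> = "sym_diff \<theta> \<theta>'"
      define S where "S c = cbox (\<chi> i. u c $ i + h / 8) (\<chi> i. u c $ i + 3 * h / 8)" for c
      have inS: "(x $ i - u c $ i) / h \<in> {1/8..3/8}" if "x \<in> S c" for x c i
      proof -
        have "u c $ i + h / 8 \<le> x $ i" "x $ i \<le> u c $ i + 3 * h / 8"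
          using that by (auto simp: S_def mem_box_cart)
        then have "1/8 * h \<le> x $ i - u c $ i" "x $ i - u c $ i \<le> 3/8 * h" by linarith+
        then have "1/8 \<le> (x $ i - u c $ i) / h" "(x $ i - u c $ i) / h \<le> 3/8"
          by (simp_all only: pos_le_divide_eq[OF hh(1)] pos_divide_le_eq[OF hh(1)])
        then show ?thesis by simp
      qed
      have inS': "(x $ i - u c $ i) / h \<in> {0<..<1}" if "x \<in> S c" for x c i
        using inS[OF that, of i] unfolding atLeastAtMost_iff greaterThanLessThan_iff by linarith
      have mS: "measure lborel (S c) = (h / 4) ^ ?d" for c
      proof -
        have "u c \<in> UNIV" "(\<chi> i. u c $ i + h / 8) \<in> S c" using hh(1) by (auto simp: S_def mem_box_cart)
        then have "S c \<noteq> {}" by blast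
        then show ?thesis unfolding S_def by (subst content_cbox_cart) (auto simp: field_simps)
      qed
      have f\<Delta>: "finite ?\<Delta>" using \<theta> fI by (auto intro: finite_subset)
      have pt: "(\<Sum>c\<in>?\<Delta>. (A * \<kappa> ^ ?d)\<^sup>2 * indicator (S c) x) \<le> (F \<theta> x - F \<theta>' x)\<^sup>2" for x
      proof (cases "\<exists>c\<in>?\<Delta>. x \<in> S c")
        case False
        then have "(\<Sum>c\<in>?\<Delta>. (A * \<kappa> ^ ?d)\<^sup>2 * indicator (S c) x) = 0" by (intro sum.neutral) auto
        then show ?thesis by simp
      next
        case True
        then obtain c where c: "c \<in> ?\<Delta>" "x \<in> S c" by blast
        then have cI: "c \<in> I" using \<theta> by auto
        have "(\<Sum>c'\<in>?\<Delta>. (A * \<kappa> ^ ?d)\<^sup>2 * indicator (S c') x) = (\<Sum>c'\<in>{c}. (A * \<kappa> ^ ?d)\<^sup>2 * indicator (S c') x)"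
        proof (rule sum.mono_neutral_right[OF f\<Delta>])
          show "\<forall>c'\<in>?\<Delta> - {c}. (A * \<kappa> ^ ?d)\<^sup>2 * indicator (S c') x = 0"
          proof
            fix c' assume c': "c' \<in> ?\<Delta> - {c}"
            then have "c' \<in> I" using \<theta> by auto
            then have "x \<notin> S c'" using disj[OF cI _ inS'[OF c(2)] inS'] c' by blast
            then show "(A * \<kappa> ^ ?d)\<^sup>2 * indicator (S c') x = 0" by simp
          qed
        qed (use c in auto)
        also have "\<dots> = (A * \<kappa> ^ ?d)\<^sup>2" using c by simp
        also have "\<dots> \<le> (A * tensor (\<lambda>_. 0) c x)\<^sup>2"
        proof -
          have "\<kappa> ^ ?d = (\<Prod>i\<in>(UNIV :: 'd set). \<kappa>)" by simp
          also have "\<dots> \<le> tensor (\<lambda>_. 0) c x"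
            unfolding tensor_def
          proof (intro prod_mono conjI)
            fix i show "\<kappa> \<le> b 0 ((x $ i - u c $ i) / h)"
              using inS[OF c(2), of i] unfolding atLeastAtMost_iff by (intro low) blast+
          qed (use \<kappa> in simp)
          finally show ?thesis using A \<kappa> by (intro power_mono mult_left_mono) auto
        qed
        also have "(A * tensor (\<lambda>_. 0) c x)\<^sup>2 = (F \<theta> x - F \<theta>' x)\<^sup>2"
        proof -
          have "g \<theta>'' x = coefs \<theta>'' c * tensor (\<lambda>_. 0) c x" for \<theta>''
            unfolding g_def by (rule bumps_single[OF _ cI inS'[OF c(2)]]) simp
          then have "F \<theta> x - F \<theta>' x = (indicator \<theta> c - indicator \<theta>' c) * (A * tensor (\<lambda>_. 0) c x)"
            by (simp add: F_def coefs_def algebra_simps)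
          moreover have "(indicator \<theta> c - indicator \<theta>' c)\<^sup>2 = (1::real)" using c(1) by auto
          ultimately show ?thesis by (simp add: power_mult_distrib)
        qed
        finally show ?thesis .
      qed
      have Si: "integrable lborel (\<lambda>x. indicator (S c) x :: real)" for c
        unfolding S_def by (intro integrable_real_indicator emeasure_bounded_finite) auto
      have Fi: "integrable lborel (\<lambda>x. (F \<theta> x - F \<theta>' x)\<^sup>2)"
      proof -
        have "(\<lambda>x. g \<theta> x - g \<theta>' x) \<in> L2_space"
          by (intro L2_diff L2_bounded_support(1)[OF gm gb]) (use g0 in \<open>auto simp: Q_def\<close>)
        then show ?thesis by (simp add: L2_space_def F_def)
      qed
      have "a1 * (real (card ?\<Delta>) / real (card I)) * real N powr (- 2 * \<beta>) = (\<Sum>c\<in>?\<Delta>. (A * \<kappa> ^ ?d)\<^sup>2 * (h / 4) ^ ?d)"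
        by (simp add: a1_def power_mult_distrib A2 cI h_def power_divide mult_ac)
      also have "\<dots> = (\<integral>x. (\<Sum>c\<in>?\<Delta>. (A * \<kappa> ^ ?d)\<^sup>2 * indicator (S c) x) \<partial>lborel)"
        using Si by (subst Bochner_Integration.integral_sum) (auto simp: mS)
      also have "\<dots> \<le> (\<integral>x. (F \<theta> x - F \<theta>' x)\<^sup>2 \<partial>lborel)"
        using Si by (intro integral_mono Fi pt) auto
      also have "\<dots> = (L2_norm (\<lambda>x. F \<theta> x - F \<theta>' x))\<^sup>2" by (simp add: L2_norm_def)
      finally show ?thesis .
    qed
    show ?thesis
      by (rule exI[of _ I], rule exI[of _ F], rule exI[of _ LR]) (use fI cI FH LRm LRb chi sep in blast)
  qed
  then show ?thesis using a1 a2 by blast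
qed

subsection \<open>Change of measure\<close>

text \<open>The product of the densities is the density of the product measure; since measures on a
  finite product are determined by rectangles, Fubini for products of functions is enough.\<close>

lemma nn_integral_PiM_density:
  fixes w :: "'a \<Rightarrow> ennreal"
  assumes D: "prob_space D" and w: "w \<in> borel_measurable D" and Dw: "prob_space (density D w)" and I: "finite I"
    and v: "v \<in> borel_measurable (PiM I (\<lambda>_. D))"
  shows "(\<integral>\<^sup>+x. v x \<partial>PiM I (\<lambda>_. density D w)) = (\<integral>\<^sup>+x. (\<Prod>i\<in>I. w (x i)) * v x \<partial>PiM I (\<lambda>_. D))"
proof -
  interpret D: prob_space D by fact
  interpret Dw: prob_space "density D w" by fact
  interpret P: product_sigma_finite "\<lambda>_. D" ..
  interpret Pw: product_sigma_finite "\<lambda>_. density D w" ..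
  let ?W = "\<lambda>x. \<Prod>i\<in>I. w (x i)"
  have Wm: "?W \<in> borel_measurable (PiM I (\<lambda>_. D))"
    by (intro borel_measurable_prod_ennreal measurable_compose[OF measurable_component_singleton[where M = "\<lambda>_. D"] w])
  have "density (PiM I (\<lambda>_. D)) ?W = PiM I (\<lambda>_. density D w)"
  proof (rule Pw.PiM_eqI[OF I])
    show "sets (density (PiM I (\<lambda>_. D)) ?W) = sets (PiM I (\<lambda>_. density D w))"
      by (simp cong: sets_PiM_cong)
    fix A assume "\<And>i. i \<in> I \<Longrightarrow> A i \<in> sets (density D w)"
    then have A: "\<And>i. i \<in> I \<Longrightarrow> A i \<in> sets D" by simp
    have "emeasure (density (PiM I (\<lambda>_. D)) ?W) (PiE I A) = (\<integral>\<^sup>+x. ?W x * indicator (PiE I A) x \<partial>PiM I (\<lambda>_. D))"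
      by (rule emeasure_density[OF Wm]) (use A I in \<open>auto intro: sets_PiM_I_finite\<close>)
    also have "\<dots> = (\<integral>\<^sup>+x. (\<Prod>i\<in>I. w (x i) * indicator (A i) (x i)) \<partial>PiM I (\<lambda>_. D))"
    proof (rule nn_integral_cong)
      fix x assume x: "x \<in> space (PiM I (\<lambda>_. D))"
      have "indicator (PiE I A) x = (\<Prod>i\<in>I. indicator (A i) (x i) :: ennreal)"
        using x I by (auto simp: space_PiM PiE_iff indicator_def prod_zero_iff)
      then show "?W x * indicator (PiE I A) x = (\<Prod>i\<in>I. w (x i) * indicator (A i) (x i))"
        by (simp add: prod.distrib)
    qed
    also have "\<dots> = (\<Prod>i\<in>I. \<integral>\<^sup>+x. w x * indicator (A i) x \<partial>D)"
      by (rule P.product_nn_integral_prod[OF I]) (use A w in auto)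
    also have "\<dots> = (\<Prod>i\<in>I. emeasure (density D w) (A i))"
      using A w by (intro prod.cong) (auto simp: emeasure_density)
    finally show "emeasure (density (PiM I (\<lambda>_. D)) ?W) (PiE I A) = (\<Prod>i\<in>I. emeasure (density D w) (A i))" .
  qed
  then show ?thesis using nn_integral_density[OF Wm v] by simp
qed

text \<open>Taking symmetric differences with \<open>\<theta>0\<close> moves the center to the empty
  set. There a Chernoff weight is used: \<open>(4/3) ^ card I * ((3/4) ^ 8) ^ card \<eta>\<close> is
  at least 1 on the ball, while its sum over all subsets is a power of
  \<open>4/3 * ((3/4) ^ 8 + 1)\<close>, which is below 3/2. A base below 2 is what makes the ball
  exponentially small.\<close>

lemma card_hamming_ball:
  assumes I: "finite I" and \<theta>0: "\<theta>0 \<subseteq> I"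
  shows "real (card {\<theta>. \<theta> \<subseteq> I \<and> 8 * card (sym_diff \<theta> \<theta>0) \<le> card I}) \<le> (3/2) ^ card I"
proof -
  let ?B = "{\<theta>. \<theta> \<subseteq> I \<and> 8 * card (sym_diff \<theta> \<theta>0) \<le> card I}" and ?Z = "{\<eta>. \<eta> \<subseteq> I \<and> 8 * card \<eta> \<le> card I}"
  have f0: "finite ?Z" by (rule finite_subset[of _ "Pow I"]) (use I in auto)
  have inj: "inj_on (\<lambda>\<theta>. sym_diff \<theta> \<theta>0) ?B"
  proof (rule inj_onI)
    fix \<theta> \<theta>' assume "sym_diff \<theta> \<theta>0 = sym_diff \<theta>' \<theta>0"
    then show "\<theta> = \<theta>'" by blast
  qed
  have img: "(\<lambda>\<theta>. sym_diff \<theta> \<theta>0) ` ?B \<subseteq> ?Z"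
  proof (rule image_subsetI)
    fix \<theta> assume "\<theta> \<in> ?B"
    then show "sym_diff \<theta> \<theta>0 \<in> ?Z" using \<theta>0 by blast
  qed
  have "card ?B \<le> card ?Z" by (rule card_inj_on_le[OF inj img f0])
  then have "real (card ?B) \<le> (\<Sum>\<eta>\<in>?Z. 1)" by simp
  also have "\<dots> \<le> (\<Sum>\<eta>\<in>?Z. (4/3) ^ card I * ((3/4) ^ 8) ^ card \<eta>)"
  proof (rule sum_mono)
    fix \<eta> assume e: "\<eta> \<in> ?Z"
    have "(4/3 :: real) ^ card I * ((3/4) ^ 8) ^ card \<eta> = (4/3) ^ (8 * card \<eta> + (card I - 8 * card \<eta>)) * (3/4) ^ (8 * card \<eta>)"
      using e by (simp add: power_mult)
    also have "\<dots> = (4/3 * (3/4)) ^ (8 * card \<eta>) * (4/3) ^ (card I - 8 * card \<eta>)"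
      by (simp only: power_add power_mult_distrib mult_ac)
    also have "\<dots> = (4/3) ^ (card I - 8 * card \<eta>)" by simp
    also have "1 \<le> \<dots>" by (rule one_le_power) simp
    finally show "1 \<le> (4/3 :: real) ^ card I * ((3/4) ^ 8) ^ card \<eta>" .
  qed
  also have "\<dots> \<le> (\<Sum>\<eta>\<in>Pow I. (4/3) ^ card I * ((3/4) ^ 8) ^ card \<eta>)"
    by (rule sum_mono2) (use I in auto)
  also have "\<dots> = (4/3) ^ card I * (\<Sum>\<eta>\<in>Pow I. (\<Prod>i\<in>\<eta>. (3/4) ^ 8) * (\<Prod>i\<in>I - \<eta>. 1))"
    by (simp add: sum_distrib_left)
  also have "(\<Sum>\<eta>\<in>Pow I. (\<Prod>i\<in>\<eta>. (3/4 :: real) ^ 8) * (\<Prod>i\<in>I - \<eta>. 1)) = (\<Prod>i\<in>I. (3/4) ^ 8 + 1)"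
    by (rule prod_add[OF I, symmetric])
  also have "(4/3 :: real) ^ card I * (\<Prod>i\<in>I. (3/4) ^ 8 + 1) = (4/3 * ((3/4) ^ 8 + 1)) ^ card I"
    by (simp only: prod_constant power_mult_distrib)
  also have "\<dots> \<le> (3/2) ^ card I" by (rule power_mono) (simp_all add: power_divide)
  finally show ?thesis .
qed

text \<open>For a fixed index set the listing is a reindexing along an injection, and a product of
  equal factors is mapped by it to a product of the same factors.\<close>

lemma coreset_points_measurable:
  assumes A: "A \<subseteq> {1..n}" "card A = m"
  shows "(\<lambda>x. coreset_points x A) \<in> measurable (PiM {1..n} (\<lambda>_. M)) (PiM {1..m} (\<lambda>_. M))"
    and "prob_space M \<Longrightarrow> distr (PiM {1..n} (\<lambda>_. M)) (PiM {1..m} (\<lambda>_. M)) (\<lambda>x. coreset_points x A) = PiM {1..m} (\<lambda>_. M)"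
proof -
  define f where "f j = sorted_list_of_set A ! (j - 1)" for j :: nat
  have fin: "finite A" using A finite_subset by blast
  have len: "length (sorted_list_of_set A) = m" using A by simp
  have fA: "f j \<in> A" if "j \<in> {1..m}" for j
  proof -
    have "f j \<in> set (sorted_list_of_set A)" unfolding f_def by (rule nth_mem) (use that len in auto)
    then show ?thesis using fin by simp
  qed
  have inj: "inj_on f {1..m}"
  proof (rule inj_onI)
    fix j k assume jk: "j \<in> {1..m}" "k \<in> {1..m}" "f j = f k"
    have lt: "j - 1 < m" "k - 1 < m" using jk by auto
    have "j - 1 = k - 1"
      using jk(3) lt nth_eq_iff_index_eq[OF distinct_sorted_list_of_set[of A], of "j - 1" "k - 1"]
      unfolding f_def len by blast
    then show "j = k" using jk by auto
  qed
  have cp: "coreset_points x A = (\<lambda>j\<in>{1..m}. x (f j))" for x :: "nat \<Rightarrow> 'a"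
    using A by (simp add: coreset_points_def f_def)
  have fI: "f \<in> {1..m} \<rightarrow> {1..n}" using fA A by auto
  show "(\<lambda>x. coreset_points x A) \<in> measurable (PiM {1..n} (\<lambda>_. M)) (PiM {1..m} (\<lambda>_. M))"
    unfolding cp by (intro measurable_restrict measurable_component_singleton) (use fI in auto)
  show "distr (PiM {1..n} (\<lambda>_. M)) (PiM {1..m} (\<lambda>_. M)) (\<lambda>x. coreset_points x A) = PiM {1..m} (\<lambda>_. M)" if "prob_space M"
    unfolding cp using distr_PiM_reindex[OF _ inj fI, of "\<lambda>_. M"] that by simp
qed

subsection \<open>The lower bound\<close>

text \<open>\<gamma> bounds the chi-square divergence of one observation. The radius
  \<open>r\<close> is such that hypotheses within \<open>2 * r\<close> of each other differ in at
  most one eighth of the cells, the radius in \<open>card_hamming_ball\<close>.\<close>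

locale coreset_lower =
  fixes \<beta> L L' :: real and n m :: nat and fhat :: "(nat \<Rightarrow> real ^ 'd::finite) \<Rightarrow> real ^ 'd \<Rightarrow> real"
    and S :: "(nat \<Rightarrow> real ^ 'd) \<Rightarrow> nat set measure" and I :: "'i set"
    and F LR :: "'i set \<Rightarrow> real ^ 'd \<Rightarrow> real" and f0 :: "real ^ 'd \<Rightarrow> real" and r \<gamma> :: real
  assumes \<beta>: "\<beta> > 0" and L: "L > 0" and fhat: "fhat \<in> estimators m" and S: "S \<in> coreset_schemes n m"
    and I: "finite I" and F: "\<And>\<theta>. \<theta> \<subseteq> I \<Longrightarrow> F \<theta> \<in> holder_densities \<beta> L" and f0: "f0 \<in> holder_densities \<beta> L'"
    and LRm: "\<And>\<theta>. \<theta> \<subseteq> I \<Longrightarrow> LR \<theta> \<in> borel_measurable borel"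
    and LR: "\<And>\<theta> x. \<theta> \<subseteq> I \<Longrightarrow> 0 \<le> LR \<theta> x \<and> LR \<theta> x \<le> 2 \<and> F \<theta> x = f0 x * LR \<theta> x"
    and LR2: "\<And>\<theta>. \<theta> \<subseteq> I \<Longrightarrow> integrable lborel (\<lambda>x. f0 x * (LR \<theta> x)\<^sup>2)"
      "\<And>\<theta>. \<theta> \<subseteq> I \<Longrightarrow> (\<integral>x. f0 x * (LR \<theta> x)\<^sup>2 \<partial>lborel) \<le> 1 + \<gamma>"
    and r: "r > 0" and sep: "\<And>\<theta> \<theta>'. \<theta> \<subseteq> I \<Longrightarrow> \<theta>' \<subseteq> I \<Longrightarrow> L2_norm (\<lambda>x. F \<theta> x - F \<theta>' x) < 2 * r \<Longrightarrow>
      8 * card (sym_diff \<theta> \<theta>') \<le> card I"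
begin

abbreviation "\<Omega> \<equiv> {A. A \<subseteq> {1..n} \<and> card A = m}"

abbreviation "X \<equiv> PiM {1..n} (\<lambda>_. borel :: (real ^ 'd) measure)"

abbreviation "Y \<equiv> PiM {1..m} (\<lambda>_. borel :: (real ^ 'd) measure)"

definition near :: "'i set \<Rightarrow> (nat \<Rightarrow> real ^ 'd) set" where
  "near \<theta> = {y \<in> space Y. L2_norm (\<lambda>z. fhat y z - F \<theta> z) < r}"

text \<open>The conditional probability, given the sample, that the estimate is within
  \<open>r\<close> of hypothesis \<theta>. There are finitely many index sets, so the integral over
  the scheme is a sum and its measurability in \<open>x\<close> is elementary.\<close>

definition hit :: "'i set \<Rightarrow> (nat \<Rightarrow> real ^ 'd) \<Rightarrow> ennreal" where
  "hit \<theta> x = (\<Sum>A\<in>\<Omega>. emeasure (S x) {A} * indicator (near \<theta>) (coreset_points x A))"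

lemma finite_\<Omega>: "finite \<Omega>"
  by (rule finite_subset[of _ "Pow {1..n}"]) auto

lemma F_L2: "\<theta> \<subseteq> I \<Longrightarrow> F \<theta> \<in> L2_space"
  using holder_class_L2[OF \<beta> L] holder_densitiesD(1)[OF F] by blast

lemma fhat_measurable: "fhat \<in> measurable Y L2_borel"
  using fhat by (simp add: estimators_def)

lemma fhat_L2: "y \<in> space Y \<Longrightarrow> fhat y \<in> L2_space"
  using measurable_space[OF fhat_measurable] by (simp add: space_L2_borel)

lemma near_sets:
  assumes \<theta>: "\<theta> \<subseteq> I"
  shows "near \<theta> \<in> sets Y"
proof -
  let ?U = "{g \<in> L2_space. L2_norm (\<lambda>z. g z - F \<theta> z) < r}"
  have "L2_open ?U"
    unfolding L2_open_def
  proof (intro conjI ballI)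
    fix g assume g: "g \<in> ?U"
    show "\<exists>e>0. \<forall>h\<in>L2_space. L2_norm (\<lambda>x. h x - g x) < e \<longrightarrow> h \<in> ?U"
    proof (intro exI[of _ "r - L2_norm (\<lambda>z. g z - F \<theta> z)"] conjI ballI impI)
      fix h assume h: "h \<in> L2_space" "L2_norm (\<lambda>x. h x - g x) < r - L2_norm (\<lambda>z. g z - F \<theta> z)"
      have "L2_norm (\<lambda>z. h z - F \<theta> z) \<le> L2_norm (\<lambda>x. h x - g x) + L2_norm (\<lambda>z. g z - F \<theta> z)"
        using g h F_L2[OF \<theta>] by (intro L2_norm_diff_triangle) auto
      then show "h \<in> ?U" using h by simp
    qed (use g in simp)
  qed auto
  then have "?U \<in> sets L2_borel"
    unfolding L2_borel_def by (subst sets_measure_of) (auto simp: L2_open_def)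
  from measurable_sets[OF fhat_measurable this]
  have "fhat -` ?U \<inter> space Y \<in> sets Y" .
  moreover have "fhat -` ?U \<inter> space Y = near \<theta>" unfolding near_def using fhat_L2 by blast
  ultimately show ?thesis by simp
qed

text \<open>Hypotheses close to one and the same estimate are close to each other, so they all lie
  in a Hamming ball around any one of them. No probability is involved, whence the bound carries
  over to every coreset.\<close>

lemma near_multiplicity:
  assumes y: "y \<in> space Y"
  shows "(\<Sum>\<theta>\<in>Pow I. indicator (near \<theta>) y) \<le> ennreal ((3/2) ^ card I)"
proof -
  let ?N = "{\<theta> \<in> Pow I. y \<in> near \<theta>}"
  have "real (card ?N) \<le> (3/2) ^ card I"
  proof (cases "?N = {}")
    case False
    then obtain \<theta>0 where t0: "\<theta>0 \<subseteq> I" "y \<in> near \<theta>0" by blast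
    have "?N \<subseteq> {\<theta>. \<theta> \<subseteq> I \<and> 8 * card (sym_diff \<theta> \<theta>0) \<le> card I}"
    proof
      fix \<theta> assume "\<theta> \<in> ?N"
      then have t: "\<theta> \<subseteq> I" "y \<in> near \<theta>" by auto
      have "L2_norm (\<lambda>x. F \<theta> x - F \<theta>0 x) \<le> L2_norm (\<lambda>z. F \<theta> z - fhat y z) + L2_norm (\<lambda>z. fhat y z - F \<theta>0 z)"
        by (rule L2_norm_diff_triangle[OF F_L2[OF t(1)] fhat_L2[OF y] F_L2[OF t0(1)]])
      also have "L2_norm (\<lambda>z. F \<theta> z - fhat y z) = L2_norm (\<lambda>z. fhat y z - F \<theta> z)" by (rule L2_norm_minus_commute)
      finally have "L2_norm (\<lambda>x. F \<theta> x - F \<theta>0 x) < 2 * r" using t t0 by (simp add: near_def)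
      then show "\<theta> \<in> {\<theta>. \<theta> \<subseteq> I \<and> 8 * card (sym_diff \<theta> \<theta>0) \<le> card I}" using sep[OF t(1) t0(1)] t by simp
    qed
    moreover have "finite {\<theta>. \<theta> \<subseteq> I \<and> 8 * card (sym_diff \<theta> \<theta>0) \<le> card I}"
      by (rule finite_subset[of _ "Pow I"]) (use I in auto)
    ultimately have "card ?N \<le> card {\<theta>. \<theta> \<subseteq> I \<and> 8 * card (sym_diff \<theta> \<theta>0) \<le> card I}" by (rule card_mono[rotated])
    then show ?thesis using card_hamming_ball[OF I t0(1)] by linarith
  next
    case True
    then show ?thesis by (simp only: card.empty of_nat_0) simp
  qed
  moreover have "(\<Sum>\<theta>\<in>Pow I. indicator (near \<theta>) y) = ennreal (real (card ?N))"
  proof -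
    have "(\<Sum>\<theta>\<in>Pow I. indicator (near \<theta>) y :: ennreal) = (\<Sum>\<theta>\<in>?N. 1)"
      using I by (intro sum.mono_neutral_cong_right) (auto simp: indicator_def)
    then show ?thesis by (simp add: ennreal_of_nat_eq_real_of_nat)
  qed
  ultimately show ?thesis by (simp add: ennreal_leI)
qed

lemma S_prob:
  assumes x: "x \<in> space X"
  shows "prob_space (S x)" "sets (S x) = Pow \<Omega>" "space (S x) = \<Omega>"
proof -
  have "S x \<in> space (prob_algebra (count_space \<Omega>))"
    using measurable_space[of S X "prob_algebra (count_space \<Omega>)" x] S x by (simp add: coreset_schemes_def)
  then have *: "prob_space (S x)" "sets (S x) = sets (count_space \<Omega>)" by (auto simp: space_prob_algebra)
  from sets_eq_imp_space_eq[OF *(2)] * show "prob_space (S x)" "sets (S x) = Pow \<Omega>" "space (S x) = \<Omega>" by auto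
qed

lemma S_measurable:
  assumes "A \<in> \<Omega>"
  shows "(\<lambda>x. emeasure (S x) {A}) \<in> borel_measurable X"
proof -
  have "S \<in> measurable X (subprob_algebra (count_space \<Omega>))"
    using S unfolding coreset_schemes_def by (rule measurable_prob_algebraD)
  moreover have "(\<lambda>M. emeasure M {A}) \<in> borel_measurable (subprob_algebra (count_space \<Omega>))"
    by (rule measurable_emeasure_subprob_algebra) (use assms in auto)
  ultimately show ?thesis by (rule measurable_compose)
qed

lemma S_integral:
  assumes x: "x \<in> space X"
  shows "(\<integral>\<^sup>+A. \<psi> A \<partial>S x) = (\<Sum>A\<in>\<Omega>. emeasure (S x) {A} * \<psi> A)"
proof -
  note s = S_prob[OF x]
  have "(\<integral>\<^sup>+A. \<psi> A \<partial>S x) = (\<integral>\<^sup>+A. (\<Sum>B\<in>\<Omega>. \<psi> B * indicator {B} A) \<partial>S x)"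
  proof (rule nn_integral_cong)
    fix A assume "A \<in> space (S x)"
    then have A: "A \<in> \<Omega>" using s by simp
    have "(\<Sum>B\<in>\<Omega>. \<psi> B * indicator {B} A) = (\<Sum>B\<in>{A}. \<psi> B * indicator {B} A)"
      by (rule sum.mono_neutral_right[OF finite_\<Omega>]) (use A in \<open>auto simp: indicator_def\<close>)
    then show "\<psi> A = (\<Sum>B\<in>\<Omega>. \<psi> B * indicator {B} A)" by simp
  qed
  also have "\<dots> = (\<Sum>B\<in>\<Omega>. \<integral>\<^sup>+A. \<psi> B * indicator {B} A \<partial>S x)"
  proof (rule nn_integral_sum)
    fix B assume "B \<in> \<Omega>"
    then have "{B} \<in> sets (S x)" using s(2) by blast
    then show "(\<lambda>A. \<psi> B * indicator {B} A) \<in> borel_measurable (S x)"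
      by (intro borel_measurable_times_ennreal borel_measurable_const borel_measurable_indicator)
  qed
  also have "\<dots> = (\<Sum>B\<in>\<Omega>. \<psi> B * emeasure (S x) {B})"
  proof (rule sum.cong[OF refl])
    fix B assume "B \<in> \<Omega>"
    then have "{B} \<in> sets (S x)" using s(2) by blast
    then show "(\<integral>\<^sup>+A. \<psi> B * indicator {B} A \<partial>S x) = \<psi> B * emeasure (S x) {B}"
      by (rule nn_integral_cmult_indicator)
  qed
  finally show ?thesis by (simp add: mult.commute)
qed

lemma S_total: "x \<in> space X \<Longrightarrow> (\<Sum>A\<in>\<Omega>. emeasure (S x) {A}) = 1"
  using S_integral[of x "\<lambda>_. 1"] prob_space.emeasure_space_1[OF S_prob(1)] by simp

lemma coreset_points_space: "x \<in> space X \<Longrightarrow> A \<in> \<Omega> \<Longrightarrow> coreset_points x A \<in> space Y"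
  using measurable_space[OF coreset_points_measurable(1)[of A n m borel]] by simp

lemma hit_measurable:
  assumes \<theta>: "\<theta> \<subseteq> I"
  shows "hit \<theta> \<in> borel_measurable X"
  unfolding hit_def
proof (intro borel_measurable_sum borel_measurable_times_ennreal S_measurable)
  fix A assume A: "A \<in> \<Omega>"
  then show "A \<in> \<Omega>" .
  show "(\<lambda>x. indicator (near \<theta>) (coreset_points x A) :: ennreal) \<in> borel_measurable X"
    by (rule measurable_compose[OF coreset_points_measurable(1) borel_measurable_indicator[OF near_sets[OF \<theta>]]]) (use A in auto)
qed

lemma hit_le_1: "x \<in> space X \<Longrightarrow> hit \<theta> x \<le> 1"
proof -
  assume x: "x \<in> space X"
  have "hit \<theta> x \<le> (\<Sum>A\<in>\<Omega>. emeasure (S x) {A} * 1)"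
    unfolding hit_def by (intro sum_mono mult_left_mono) (auto simp: indicator_def)
  then show ?thesis using S_total[OF x] by simp
qed

lemma hit_sum:
  assumes x: "x \<in> space X"
  shows "(\<Sum>\<theta>\<in>Pow I. hit \<theta> x) \<le> ennreal ((3/2) ^ card I)"
proof -
  have "(\<Sum>\<theta>\<in>Pow I. hit \<theta> x) = (\<Sum>A\<in>\<Omega>. emeasure (S x) {A} * (\<Sum>\<theta>\<in>Pow I. indicator (near \<theta>) (coreset_points x A)))"
    unfolding hit_def by (subst sum.swap) (simp add: sum_distrib_left)
  also have "\<dots> \<le> (\<Sum>A\<in>\<Omega>. emeasure (S x) {A} * ennreal ((3/2) ^ card I))"
    by (intro sum_mono mult_left_mono near_multiplicity coreset_points_space x) auto
  also have "\<dots> = ennreal ((3/2) ^ card I)"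
    using S_total[OF x] by (simp add: sum_distrib_right[symmetric])
  finally show ?thesis .
qed

section \<open>Success probabilities under the hypotheses\<close>

abbreviation "Pr f k \<equiv> PiM {1..k} (\<lambda>_::nat. dens (f :: real ^ 'd \<Rightarrow> real))"

lemma sets_Pr: "sets (Pr f k) = sets (PiM {1..k} (\<lambda>_. borel :: (real ^ 'd) measure))"
  by (rule sets_PiM_cong) auto

lemma space_Pr: "space (Pr f k) = space (PiM {1..k} (\<lambda>_. borel :: (real ^ 'd) measure))"
  by (rule sets_eq_imp_space_eq[OF sets_Pr])

lemma measurable_Pr: "measurable (Pr f k) N = measurable (PiM {1..k} (\<lambda>_. borel :: (real ^ 'd) measure)) N"
  by (rule measurable_cong_sets[OF sets_Pr refl])

lemma prob_space_Pr: "f \<in> holder_densities \<beta>' L'' \<Longrightarrow> prob_space (Pr f k)"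
  by (rule prob_space_PiM) (rule prob_space_dens)

text \<open>Markov's inequality: with conditional probability \<open>1 - hit\<close> the loss is at
  least \<open>r\<close>. The form as a sum avoids subtraction, which is truncated for extended
  nonnegative reals.\<close>

lemma risk_plus_hit:
  assumes \<theta>: "\<theta> \<subseteq> I"
  shows "ennreal r \<le> coreset_risk n fhat S (F \<theta>) + ennreal r * (\<integral>\<^sup>+x. hit \<theta> x \<partial>Pr (F \<theta>) n)"
proof -
  interpret P: prob_space "Pr (F \<theta>) n" by (rule prob_space_Pr[OF F[OF \<theta>]])
  define miss where "miss x = (\<Sum>A\<in>\<Omega>. emeasure (S x) {A} * indicator (space Y - near \<theta>) (coreset_points x A))" for x
  have mm: "miss \<in> borel_measurable (Pr (F \<theta>) n)"
    unfolding measurable_Pr miss_def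
  proof (intro borel_measurable_sum borel_measurable_times_ennreal S_measurable)
    fix A assume A: "A \<in> \<Omega>"
    then show "A \<in> \<Omega>" .
    show "(\<lambda>x. indicator (space Y - near \<theta>) (coreset_points x A) :: ennreal) \<in> borel_measurable X"
      by (rule measurable_compose[OF coreset_points_measurable(1) borel_measurable_indicator[OF sets.compl_sets[OF near_sets[OF \<theta>]]]]) (use A in auto)
  qed
  have hm: "hit \<theta> \<in> borel_measurable (Pr (F \<theta>) n)" unfolding measurable_Pr by (rule hit_measurable[OF \<theta>])
  have sum1: "miss x + hit \<theta> x = 1" if x: "x \<in> space X" for x
  proof -
    have "miss x + hit \<theta> x = (\<Sum>A\<in>\<Omega>. emeasure (S x) {A})"
      unfolding miss_def hit_def sum.distrib[symmetric]
    proof (intro sum.cong refl)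
      fix A assume "A \<in> \<Omega>"
      then have "coreset_points x A \<in> space Y" by (rule coreset_points_space[OF x])
      then show "emeasure (S x) {A} * indicator (space Y - near \<theta>) (coreset_points x A) +
          emeasure (S x) {A} * indicator (near \<theta>) (coreset_points x A) = emeasure (S x) {A}"
        by (cases "coreset_points x A \<in> near \<theta>") auto
    qed
    then show ?thesis using S_total[OF x] by simp
  qed
  have le: "ennreal r * miss x \<le> (\<integral>\<^sup>+ A. ennreal (L2_norm (\<lambda>z. fhat (coreset_points x A) z - F \<theta> z)) \<partial>S x)"
    if x: "x \<in> space X" for x
    unfolding S_integral[OF x] miss_def sum_distrib_left
  proof (rule sum_mono)
    fix A assume "A \<in> \<Omega>"
    then have y: "coreset_points x A \<in> space Y" by (rule coreset_points_space[OF x])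
    show "ennreal r * (emeasure (S x) {A} * indicator (space Y - near \<theta>) (coreset_points x A)) \<le>
        emeasure (S x) {A} * ennreal (L2_norm (\<lambda>z. fhat (coreset_points x A) z - F \<theta> z))"
    proof (cases "coreset_points x A \<in> near \<theta>")
      case False
      then have "r \<le> L2_norm (\<lambda>z. fhat (coreset_points x A) z - F \<theta> z)" using y by (simp add: near_def)
      then have "ennreal r \<le> ennreal (L2_norm (\<lambda>z. fhat (coreset_points x A) z - F \<theta> z))" by (rule ennreal_leI)
      then have "emeasure (S x) {A} * ennreal r \<le> emeasure (S x) {A} * ennreal (L2_norm (\<lambda>z. fhat (coreset_points x A) z - F \<theta> z))"
        by (rule mult_left_mono) simp
      then show ?thesis using False y by (simp add: mult.commute)
    qed simp
  qed
  have "ennreal r = (\<integral>\<^sup>+x. ennreal r * 1 \<partial>Pr (F \<theta>) n)" by (simp only: mult_1_right nn_integral_const P.emeasure_space_1)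
  also have "\<dots> = (\<integral>\<^sup>+x. ennreal r * miss x + ennreal r * hit \<theta> x \<partial>Pr (F \<theta>) n)"
  proof (rule nn_integral_cong)
    fix x assume "x \<in> space (Pr (F \<theta>) n)"
    then have "x \<in> space X" by (simp only: space_Pr)
    then show "ennreal r * 1 = ennreal r * miss x + ennreal r * hit \<theta> x"
      by (simp only: sum1[symmetric] distrib_left)
  qed
  also have "\<dots> = (\<integral>\<^sup>+x. ennreal r * miss x \<partial>Pr (F \<theta>) n) + (\<integral>\<^sup>+x. ennreal r * hit \<theta> x \<partial>Pr (F \<theta>) n)"
    using mm hm by (intro nn_integral_add borel_measurable_times_ennreal borel_measurable_const)
  also have "(\<integral>\<^sup>+x. ennreal r * hit \<theta> x \<partial>Pr (F \<theta>) n) = ennreal r * (\<integral>\<^sup>+x. hit \<theta> x \<partial>Pr (F \<theta>) n)"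
    by (rule nn_integral_cmult[OF hm])
  also have "(\<integral>\<^sup>+x. ennreal r * miss x \<partial>Pr (F \<theta>) n) \<le> coreset_risk n fhat S (F \<theta>)"
    unfolding coreset_risk_def by (rule nn_integral_mono) (rule le, simp only: space_Pr)
  finally show ?thesis by (simp add: add_right_mono)
qed

text \<open>If the success probabilities average at most 1/4, some hypothesis has at most 1/2, and
  there half of \<open>r\<close> is lost.\<close>

lemma risk_from_hits:
  assumes "(\<Sum>\<theta>\<in>Pow I. \<integral>\<^sup>+x. hit \<theta> x \<partial>Pr (F \<theta>) n) \<le> ennreal (2 ^ card I / 4)"
  shows "\<exists>\<theta>\<subseteq>I. ennreal (r / 2) \<le> coreset_risk n fhat S (F \<theta>)"
proof -
  have "\<exists>\<theta>\<in>Pow I. (\<integral>\<^sup>+x. hit \<theta> x \<partial>Pr (F \<theta>) n) \<le> ennreal (1/2)"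
  proof (rule ccontr)
    assume "\<not> ?thesis"
    then have "(\<Sum>\<theta>\<in>Pow I. ennreal (1/2)) \<le> (\<Sum>\<theta>\<in>Pow I. \<integral>\<^sup>+x. hit \<theta> x \<partial>Pr (F \<theta>) n)"
      by (intro sum_mono) (meson less_imp_le not_le)
    also note assms
    also have "(\<Sum>\<theta>\<in>Pow I. ennreal (1/2)) = ennreal (2 ^ card I / 2)"
    proof -
      have "(\<Sum>\<theta>\<in>Pow I. ennreal (1/2)) = ennreal (\<Sum>\<theta>\<in>Pow I. 1/2)" by (rule sum_ennreal) simp
      also have "(\<Sum>\<theta>\<in>Pow I. 1/2 :: real) = 2 ^ card I / 2" using I by (simp add: card_Pow)
      finally show ?thesis .
    qed
    finally have "(2::real) ^ card I / 2 \<le> 2 ^ card I / 4" by (subst (asm) ennreal_le_iff) auto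
    then show False by simp
  qed
  then obtain \<theta> where \<theta>: "\<theta> \<subseteq> I" and h: "(\<integral>\<^sup>+x. hit \<theta> x \<partial>Pr (F \<theta>) n) \<le> ennreal (1/2)" by blast
  have "ennreal r \<le> coreset_risk n fhat S (F \<theta>) + ennreal r * (\<integral>\<^sup>+x. hit \<theta> x \<partial>Pr (F \<theta>) n)"
    by (rule risk_plus_hit[OF \<theta>])
  also have "\<dots> \<le> coreset_risk n fhat S (F \<theta>) + ennreal r * ennreal (1/2)"
    by (intro add_left_mono mult_left_mono h) simp
  also have "ennreal r * ennreal (1/2) = ennreal (r / 2)" using ennreal_mult[of r "1/2"] r by simp
  finally have "ennreal (r / 2) + ennreal (r / 2) \<le> coreset_risk n fhat S (F \<theta>) + ennreal (r / 2)"
    using r by (simp add: ennreal_plus[symmetric] del: ennreal_plus)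
  then have "ennreal (r / 2) + ennreal (r / 2) \<le> ennreal (r / 2) + coreset_risk n fhat S (F \<theta>)"
    by (simp only: add.commute)
  then have "ennreal (r / 2) \<le> coreset_risk n fhat S (F \<theta>)"
    unfolding ennreal_add_left_cancel_le by auto
  then show ?thesis using \<theta> by blast
qed

lemma dens_F: "\<theta> \<subseteq> I \<Longrightarrow> dens (F \<theta>) = density (dens f0) (\<lambda>x. ennreal (LR \<theta> x))"
proof -
  assume \<theta>: "\<theta> \<subseteq> I"
  have "density (dens f0) (\<lambda>x. ennreal (LR \<theta> x)) = density lborel (\<lambda>x. ennreal (f0 x) * ennreal (LR \<theta> x))"
    using holder_densitiesD(5)[OF f0] LRm[OF \<theta>] by (intro density_density_eq) auto
  also have "(\<lambda>x. ennreal (f0 x) * ennreal (LR \<theta> x)) = (\<lambda>x. ennreal (F \<theta> x))"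
    using LR[OF \<theta>] holder_densitiesD(2)[OF f0] by (auto simp: ennreal_mult)
  finally show ?thesis by simp
qed

lemma change_of_measure:
  assumes \<theta>: "\<theta> \<subseteq> I" and v: "v \<in> borel_measurable (PiM {1..k} (\<lambda>_. borel :: (real ^ 'd) measure))"
  shows "(\<integral>\<^sup>+x. v x \<partial>Pr (F \<theta>) k) = (\<integral>\<^sup>+x. ennreal (\<Prod>i\<in>{1..k}. LR \<theta> (x i)) * v x \<partial>Pr f0 k)"
proof -
  have "(\<integral>\<^sup>+x. v x \<partial>Pr (F \<theta>) k) = (\<integral>\<^sup>+x. (\<Prod>i\<in>{1..k}. ennreal (LR \<theta> (x i))) * v x \<partial>Pr f0 k)"
    unfolding dens_F[OF \<theta>]
  proof (rule nn_integral_PiM_density)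
    show "prob_space (dens f0)" by (rule prob_space_dens[OF f0])
    show "prob_space (density (dens f0) (\<lambda>x. ennreal (LR \<theta> x)))"
      unfolding dens_F[OF \<theta>, symmetric] by (rule prob_space_dens[OF F[OF \<theta>]])
    show "v \<in> borel_measurable (Pr f0 k)" unfolding measurable_Pr by (rule v)
  qed (use LRm[OF \<theta>] in auto)
  then show ?thesis using LR[OF \<theta>] by (simp add: prod_ennreal)
qed

text \<open>The likelihood ratio \<Lambda> of the full sample is truncated at \<open>K\<close>.
  Below \<open>K\<close> all hypotheses are compared under the same measure, where the hits sum to
  at most \<open>(3/2) ^ card I\<close>; above \<open>K\<close> the ratio is at most its square
  divided by \<open>K\<close>, and second moments of independent factors multiply.\<close>

lemma hits_chi_square:
  assumes K: "K > 0"
  shows "(\<Sum>\<theta>\<in>Pow I. \<integral>\<^sup>+x. hit \<theta> x \<partial>Pr (F \<theta>) n) \<le> ennreal (K * (3/2) ^ card I + 2 ^ card I * (1 + \<gamma>) ^ n / K)"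
proof -
  interpret D0: prob_space "dens f0" by (rule prob_space_dens[OF f0])
  interpret P0: prob_space "Pr f0 n" by (rule prob_space_Pr[OF f0])
  interpret product_sigma_finite "\<lambda>_::nat. dens f0" ..
  have \<gamma>: "0 \<le> 1 + \<gamma>"
  proof -
    have "0 \<le> (\<integral>x. f0 x * (LR {} x)\<^sup>2 \<partial>lborel)" using holder_densitiesD(2)[OF f0] by simp
    then show ?thesis using LR2(2)[of "{}"] by simp
  qed
  define \<Lambda> where "\<Lambda> \<theta> x = (\<Prod>i\<in>{1..n}. LR \<theta> (x i))" for \<theta> and x :: "nat \<Rightarrow> real ^ 'd"
  have \<Lambda>0: "0 \<le> \<Lambda> \<theta> x" if "\<theta> \<subseteq> I" for \<theta> x unfolding \<Lambda>_def using LR[OF that] by (intro prod_nonneg) auto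
  have \<Lambda>m: "\<Lambda> \<theta> \<in> borel_measurable (Pr f0 n)" if \<theta>: "\<theta> \<subseteq> I" for \<theta>
    unfolding measurable_Pr \<Lambda>_def
    by (intro borel_measurable_prod measurable_compose[OF measurable_component_singleton[where M = "\<lambda>_. borel"] LRm[OF \<theta>]])
  have sq: "(\<integral>\<^sup>+x. ennreal ((\<Lambda> \<theta> x)\<^sup>2) \<partial>Pr f0 n) \<le> ennreal ((1 + \<gamma>) ^ n)" if \<theta>: "\<theta> \<subseteq> I" for \<theta>
  proof -
    have one: "(\<integral>\<^sup>+z. ennreal ((LR \<theta> z)\<^sup>2) \<partial>dens f0) \<le> ennreal (1 + \<gamma>)"
    proof -
      have "(\<integral>\<^sup>+z. ennreal ((LR \<theta> z)\<^sup>2) \<partial>dens f0) = (\<integral>\<^sup>+z. ennreal (f0 z) * ennreal ((LR \<theta> z)\<^sup>2) \<partial>lborel)"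
        using holder_densitiesD(5)[OF f0] LRm[OF \<theta>] by (intro nn_integral_density) auto
      also have "\<dots> = (\<integral>\<^sup>+z. ennreal (f0 z * (LR \<theta> z)\<^sup>2) \<partial>lborel)"
        using holder_densitiesD(2)[OF f0] by (simp add: ennreal_mult)
      also have "\<dots> = ennreal (\<integral>z. f0 z * (LR \<theta> z)\<^sup>2 \<partial>lborel)"
        using holder_densitiesD(2)[OF f0] by (intro nn_integral_eq_integral LR2(1)[OF \<theta>]) auto
      also have "\<dots> \<le> ennreal (1 + \<gamma>)" by (intro ennreal_leI LR2(2)[OF \<theta>])
      finally show ?thesis .
    qed
    have "(\<integral>\<^sup>+x. ennreal ((\<Lambda> \<theta> x)\<^sup>2) \<partial>Pr f0 n) = (\<integral>\<^sup>+x. (\<Prod>i\<in>{1..n}. ennreal ((LR \<theta> (x i))\<^sup>2)) \<partial>Pr f0 n)"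
      by (intro nn_integral_cong) (simp add: \<Lambda>_def prod_power_distrib[symmetric] prod_ennreal)
    also have "\<dots> = (\<Prod>i\<in>{1..n}. \<integral>\<^sup>+z. ennreal ((LR \<theta> z)\<^sup>2) \<partial>dens f0)"
      by (rule product_nn_integral_prod) (use LRm[OF \<theta>] in auto)
    also have "\<dots> \<le> (\<Prod>i\<in>{1..n}. ennreal (1 + \<gamma>))" by (intro prod_mono_ennreal one)
    also have "\<dots> = ennreal ((1 + \<gamma>) ^ n)" using \<gamma> by (simp add: ennreal_power)
    finally show ?thesis .
  qed
  have pt: "ennreal (\<Lambda> \<theta> x) * hit \<theta> x \<le> ennreal K * hit \<theta> x + ennreal (1 / K) * ennreal ((\<Lambda> \<theta> x)\<^sup>2)"
    if \<theta>: "\<theta> \<subseteq> I" and x: "x \<in> space X" for \<theta> x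
  proof (cases "\<Lambda> \<theta> x \<le> K")
    case True
    then have "ennreal (\<Lambda> \<theta> x) * hit \<theta> x \<le> ennreal K * hit \<theta> x" by (intro mult_right_mono ennreal_leI) auto
    then show ?thesis by (rule add_increasing2[rotated]) simp
  next
    case False
    have "ennreal (\<Lambda> \<theta> x) * hit \<theta> x \<le> ennreal (\<Lambda> \<theta> x) * 1" by (intro mult_left_mono hit_le_1 x) simp
    also have "\<dots> = ennreal (\<Lambda> \<theta> x)" by simp
    also have "\<dots> \<le> ennreal (1 / K * (\<Lambda> \<theta> x)\<^sup>2)"
    proof (rule ennreal_leI)
      have "\<Lambda> \<theta> x * K \<le> \<Lambda> \<theta> x * \<Lambda> \<theta> x" using False \<Lambda>0[OF \<theta>, of x] by (intro mult_left_mono) auto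
      then show "\<Lambda> \<theta> x \<le> 1 / K * (\<Lambda> \<theta> x)\<^sup>2" using K by (simp add: power2_eq_square pos_le_divide_eq)
    qed
    also have "\<dots> = ennreal (1 / K) * ennreal ((\<Lambda> \<theta> x)\<^sup>2)" using K by (intro ennreal_mult) auto
    finally show ?thesis by (rule add_increasing[rotated]) simp
  qed
  have hm: "hit \<theta> \<in> borel_measurable (Pr f0 n)" if "\<theta> \<subseteq> I" for \<theta>
    unfolding measurable_Pr by (rule hit_measurable[OF that])
  have each: "(\<integral>\<^sup>+x. hit \<theta> x \<partial>Pr (F \<theta>) n) \<le> ennreal K * (\<integral>\<^sup>+x. hit \<theta> x \<partial>Pr f0 n) + ennreal (1 / K) * ennreal ((1 + \<gamma>) ^ n)"
    if \<theta>: "\<theta> \<subseteq> I" for \<theta>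
  proof -
    have L2m: "(\<lambda>x. ennreal ((\<Lambda> \<theta> x)\<^sup>2)) \<in> borel_measurable (Pr f0 n)" using \<Lambda>m[OF \<theta>] by simp
    have "(\<integral>\<^sup>+x. hit \<theta> x \<partial>Pr (F \<theta>) n) = (\<integral>\<^sup>+x. ennreal (\<Lambda> \<theta> x) * hit \<theta> x \<partial>Pr f0 n)"
      unfolding \<Lambda>_def by (rule change_of_measure[OF \<theta> hit_measurable[OF \<theta>]])
    also have "\<dots> \<le> (\<integral>\<^sup>+x. ennreal K * hit \<theta> x + ennreal (1 / K) * ennreal ((\<Lambda> \<theta> x)\<^sup>2) \<partial>Pr f0 n)"
      by (rule nn_integral_mono) (rule pt[OF \<theta>], simp only: space_Pr)
    also have "\<dots> = (\<integral>\<^sup>+x. ennreal K * hit \<theta> x \<partial>Pr f0 n) + (\<integral>\<^sup>+x. ennreal (1 / K) * ennreal ((\<Lambda> \<theta> x)\<^sup>2) \<partial>Pr f0 n)"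
      by (rule nn_integral_add) (use hm[OF \<theta>] L2m in \<open>auto intro: borel_measurable_times_ennreal\<close>)
    also have "(\<integral>\<^sup>+x. ennreal K * hit \<theta> x \<partial>Pr f0 n) = ennreal K * (\<integral>\<^sup>+x. hit \<theta> x \<partial>Pr f0 n)"
      by (rule nn_integral_cmult[OF hm[OF \<theta>]])
    also have "(\<integral>\<^sup>+x. ennreal (1 / K) * ennreal ((\<Lambda> \<theta> x)\<^sup>2) \<partial>Pr f0 n) = ennreal (1 / K) * (\<integral>\<^sup>+x. ennreal ((\<Lambda> \<theta> x)\<^sup>2) \<partial>Pr f0 n)"
      by (rule nn_integral_cmult[OF L2m])
    also have "\<dots> \<le> ennreal (1 / K) * ennreal ((1 + \<gamma>) ^ n)" by (intro mult_left_mono sq[OF \<theta>]) simp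
    finally show ?thesis by (simp add: add_left_mono)
  qed
  have "(\<Sum>\<theta>\<in>Pow I. \<integral>\<^sup>+x. hit \<theta> x \<partial>Pr (F \<theta>) n) \<le>
      (\<Sum>\<theta>\<in>Pow I. ennreal K * (\<integral>\<^sup>+x. hit \<theta> x \<partial>Pr f0 n) + ennreal (1 / K) * ennreal ((1 + \<gamma>) ^ n))"
    by (intro sum_mono each) auto
  also have "\<dots> = ennreal K * (\<Sum>\<theta>\<in>Pow I. \<integral>\<^sup>+x. hit \<theta> x \<partial>Pr f0 n) + (\<Sum>\<theta>\<in>Pow I. ennreal (1 / K) * ennreal ((1 + \<gamma>) ^ n))"
    by (simp only: sum.distrib sum_distrib_left)
  also have "(\<Sum>\<theta>\<in>Pow I. \<integral>\<^sup>+x. hit \<theta> x \<partial>Pr f0 n) = (\<integral>\<^sup>+x. (\<Sum>\<theta>\<in>Pow I. hit \<theta> x) \<partial>Pr f0 n)"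
    by (rule nn_integral_sum[symmetric]) (use hm in auto)
  also have "\<dots> \<le> (\<integral>\<^sup>+x. ennreal ((3/2) ^ card I) \<partial>Pr f0 n)"
    by (rule nn_integral_mono) (rule hit_sum, simp only: space_Pr)
  also have "\<dots> = ennreal ((3/2) ^ card I)" by (simp only: nn_integral_const P0.emeasure_space_1 mult_1_right)
  also have "(\<Sum>\<theta>\<in>Pow I. ennreal (1 / K) * ennreal ((1 + \<gamma>) ^ n)) = ennreal (2 ^ card I * (1 + \<gamma>) ^ n / K)"
  proof -
    have "ennreal (1 / K) * ennreal ((1 + \<gamma>) ^ n) = ennreal ((1 + \<gamma>) ^ n / K)"
      using K \<gamma> by (simp add: ennreal_mult[symmetric])
    moreover have "(\<Sum>\<theta>\<in>Pow I. ennreal ((1 + \<gamma>) ^ n / K)) = ennreal (\<Sum>\<theta>\<in>Pow I. (1 + \<gamma>) ^ n / K)"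
      by (rule sum_ennreal) (use K \<gamma> in simp)
    ultimately show ?thesis using I by (simp add: card_Pow)
  qed
  also have "ennreal K * ennreal ((3/2) ^ card I) + ennreal (2 ^ card I * (1 + \<gamma>) ^ n / K)
      = ennreal (K * (3/2) ^ card I + 2 ^ card I * (1 + \<gamma>) ^ n / K)"
    using K \<gamma> by (simp add: ennreal_mult[symmetric] ennreal_plus[symmetric] del: ennreal_plus)
  finally show ?thesis by (simp add: add_right_mono mult_left_mono)
qed

text \<open>Every subset of the sample of size \<open>m\<close> is itself an i.i.d. sample, so a union bound over
  all of them controls every coreset scheme at once.\<close>

lemma hits_union_bound:
  "(\<Sum>\<theta>\<in>Pow I. \<integral>\<^sup>+x. hit \<theta> x \<partial>Pr (F \<theta>) n) \<le> ennreal (real (n choose m) * 2 ^ m * (3/2) ^ card I)"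
proof -
  interpret P0: prob_space "Pr f0 m" by (rule prob_space_Pr[OF f0])
  have near_le: "emeasure (Pr (F \<theta>) m) (near \<theta>) \<le> ennreal (2 ^ m) * emeasure (Pr f0 m) (near \<theta>)"
    if \<theta>: "\<theta> \<subseteq> I" for \<theta>
  proof -
    have ns: "near \<theta> \<in> sets (Pr f m)" for f unfolding sets_Pr by (rule near_sets[OF \<theta>])
    have "emeasure (Pr (F \<theta>) m) (near \<theta>) = (\<integral>\<^sup>+y. indicator (near \<theta>) y \<partial>Pr (F \<theta>) m)"
      by (rule nn_integral_indicator[OF ns, symmetric])
    also have "\<dots> = (\<integral>\<^sup>+y. ennreal (\<Prod>i\<in>{1..m}. LR \<theta> (y i)) * indicator (near \<theta>) y \<partial>Pr f0 m)"
      by (rule change_of_measure[OF \<theta>]) (rule borel_measurable_indicator[OF near_sets[OF \<theta>]])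
    also have "\<dots> \<le> (\<integral>\<^sup>+y. ennreal (2 ^ m) * indicator (near \<theta>) y \<partial>Pr f0 m)"
    proof (intro nn_integral_mono mult_right_mono ennreal_leI)
      fix y :: "nat \<Rightarrow> real ^ 'd"
      have "(\<Prod>i\<in>{1..m}. LR \<theta> (y i)) \<le> (\<Prod>i\<in>{1..m}. 2)" using LR[OF \<theta>] by (intro prod_mono) auto
      then show "(\<Prod>i\<in>{1..m}. LR \<theta> (y i)) \<le> 2 ^ m" by simp
    qed simp
    also have "\<dots> = ennreal (2 ^ m) * emeasure (Pr f0 m) (near \<theta>)" by (rule nn_integral_cmult_indicator[OF ns])
    finally show ?thesis .
  qed
  have each: "(\<integral>\<^sup>+x. hit \<theta> x \<partial>Pr (F \<theta>) n) \<le> of_nat (n choose m) * (ennreal (2 ^ m) * emeasure (Pr f0 m) (near \<theta>))"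
    if \<theta>: "\<theta> \<subseteq> I" for \<theta>
  proof -
    have im: "(\<lambda>x. indicator (near \<theta>) (coreset_points x A) :: ennreal) \<in> borel_measurable (Pr (F \<theta>) n)" if "A \<in> \<Omega>" for A
      unfolding measurable_Pr
      by (rule measurable_compose[OF coreset_points_measurable(1) borel_measurable_indicator[OF near_sets[OF \<theta>]]]) (use that in auto)
    have "(\<integral>\<^sup>+x. hit \<theta> x \<partial>Pr (F \<theta>) n) \<le> (\<integral>\<^sup>+x. (\<Sum>A\<in>\<Omega>. indicator (near \<theta>) (coreset_points x A)) \<partial>Pr (F \<theta>) n)"
    proof (rule nn_integral_mono)
      fix x assume "x \<in> space (Pr (F \<theta>) n)"
      then have x: "x \<in> space X" by (simp only: space_Pr)
      interpret s: prob_space "S x" by (rule S_prob[OF x])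
      \<comment> \<open>Selection probabilities are replaced by 1, which removes the scheme from the
        estimate.\<close>
      have "hit \<theta> x \<le> (\<Sum>A\<in>\<Omega>. 1 * indicator (near \<theta>) (coreset_points x A))"
        unfolding hit_def by (intro sum_mono mult_right_mono s.measure_le_1) auto
      then show "hit \<theta> x \<le> (\<Sum>A\<in>\<Omega>. indicator (near \<theta>) (coreset_points x A))" by simp
    qed
    also have "\<dots> = (\<Sum>A\<in>\<Omega>. \<integral>\<^sup>+x. indicator (near \<theta>) (coreset_points x A) \<partial>Pr (F \<theta>) n)"
      by (rule nn_integral_sum) (rule im)
    also have "\<dots> = (\<Sum>A\<in>\<Omega>. emeasure (Pr (F \<theta>) m) (near \<theta>))"
    proof (rule sum.cong[OF refl])
      fix A assume A: "A \<in> \<Omega>"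
      have ns: "near \<theta> \<in> sets (Pr (F \<theta>) m)" unfolding sets_Pr by (rule near_sets[OF \<theta>])
      have cm: "(\<lambda>x. coreset_points x A) \<in> measurable (Pr (F \<theta>) n) (Pr (F \<theta>) m)"
        by (rule coreset_points_measurable(1)) (use A in auto)
      have "(\<integral>\<^sup>+x. indicator (near \<theta>) (coreset_points x A) \<partial>Pr (F \<theta>) n)
          = (\<integral>\<^sup>+y. indicator (near \<theta>) y \<partial>distr (Pr (F \<theta>) n) (Pr (F \<theta>) m) (\<lambda>x. coreset_points x A))"
        by (rule nn_integral_distr[OF cm, symmetric]) (use ns in simp)
      also have "distr (Pr (F \<theta>) n) (Pr (F \<theta>) m) (\<lambda>x. coreset_points x A) = Pr (F \<theta>) m"
        by (rule coreset_points_measurable(2)) (use A prob_space_dens[OF F[OF \<theta>]] in auto)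
      also have "(\<integral>\<^sup>+y. indicator (near \<theta>) y \<partial>Pr (F \<theta>) m) = emeasure (Pr (F \<theta>) m) (near \<theta>)"
        by (rule nn_integral_indicator[OF ns])
      finally show "(\<integral>\<^sup>+x. indicator (near \<theta>) (coreset_points x A) \<partial>Pr (F \<theta>) n) = emeasure (Pr (F \<theta>) m) (near \<theta>)" .
    qed
    also have "\<dots> = of_nat (n choose m) * emeasure (Pr (F \<theta>) m) (near \<theta>)"
      using n_subsets[of "{1..n}" m] by simp
    also have "\<dots> \<le> of_nat (n choose m) * (ennreal (2 ^ m) * emeasure (Pr f0 m) (near \<theta>))"
      by (intro mult_left_mono near_le[OF \<theta>]) simp
    finally show ?thesis .
  qed
  have "(\<Sum>\<theta>\<in>Pow I. \<integral>\<^sup>+x. hit \<theta> x \<partial>Pr (F \<theta>) n) \<le>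
      (\<Sum>\<theta>\<in>Pow I. of_nat (n choose m) * (ennreal (2 ^ m) * emeasure (Pr f0 m) (near \<theta>)))"
    by (intro sum_mono each) auto
  also have "\<dots> = of_nat (n choose m) * (ennreal (2 ^ m) * (\<Sum>\<theta>\<in>Pow I. emeasure (Pr f0 m) (near \<theta>)))"
    by (simp only: sum_distrib_left)
  also have "(\<Sum>\<theta>\<in>Pow I. emeasure (Pr f0 m) (near \<theta>)) = (\<Sum>\<theta>\<in>Pow I. \<integral>\<^sup>+y. indicator (near \<theta>) y \<partial>Pr f0 m)"
    by (intro sum.cong refl nn_integral_indicator[symmetric]) (simp only: sets_Pr, rule near_sets, simp)
  also have "\<dots> = (\<integral>\<^sup>+y. (\<Sum>\<theta>\<in>Pow I. indicator (near \<theta>) y) \<partial>Pr f0 m)"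
    by (rule nn_integral_sum[symmetric], rule borel_measurable_indicator, simp only: sets_Pr, rule near_sets, simp)
  also have "\<dots> \<le> (\<integral>\<^sup>+y. ennreal ((3/2) ^ card I) \<partial>Pr f0 m)"
    by (rule nn_integral_mono) (rule near_multiplicity, simp only: space_Pr)
  also have "\<dots> = ennreal ((3/2) ^ card I)" by (simp only: nn_integral_const P0.emeasure_space_1 mult_1_right)
  also have "of_nat (n choose m) * (ennreal (2 ^ m) * ennreal ((3/2) ^ card I)) = ennreal (real (n choose m) * 2 ^ m * (3/2) ^ card I)"
    by (simp add: ennreal_of_nat_eq_real_of_nat ennreal_mult[symmetric] mult.assoc)
  finally show ?thesis by (simp add: mult_left_mono)
qed

end

text \<open>The grid must be so fine that the number of cells outweighs either the information in
  the whole sample or the number of possible coresets; each alternative alone brings the average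
  success probability down to 1/4. In the first one, at least 30 cells make the exponentially small
  terms add up to at most 1/4.\<close>

lemma lower_bound_parameters:
  assumes \<beta>: "\<beta> > 0" and L: "L > 0"
    and ne: "\<exists>L'<L. holder_densities \<beta> L' \<noteq> ({} :: (real ^ 'd::finite \<Rightarrow> real) set)"
  shows "\<exists>c>0. \<exists>a>0. \<forall>n m N :: nat. 1 \<le> N \<longrightarrow> 1 \<le> n \<longrightarrow> 30 \<le> N ^ CARD('d) \<longrightarrow>
    (real n * a * real N powr (- 2 * \<beta>) \<le> real (N ^ CARD('d)) / 10 \<or>
      real (n choose m) * 2 ^ m \<le> exp (real (N ^ CARD('d)) / 4) / 4) \<longrightarrow>
    ennreal (c * real N powr (- \<beta>)) \<le> coreset_minimax_risk TYPE('d) \<beta> L n m"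
proof -
  let ?d = "CARD('d)"
  obtain L' f0 where L': "L' < L" and f0: "f0 \<in> (holder_densities \<beta> L' :: (real ^ 'd \<Rightarrow> real) set)"
    using ne by blast
  obtain a1 a2 where a1: "a1 > 0" and a2: "a2 > 0" and pert: "\<And>N::nat. N \<ge> 1 \<Longrightarrow> \<exists>(I :: ('d \<Rightarrow> nat) set) F LR. finite I \<and> card I = N ^ CARD('d) \<and>
    (\<forall>\<theta>. \<theta> \<subseteq> I \<longrightarrow> F \<theta> \<in> holder_densities \<beta> L \<and> LR \<theta> \<in> borel_measurable borel \<and>
      (\<forall>x. 0 \<le> LR \<theta> x \<and> LR \<theta> x \<le> 2 \<and> F \<theta> x = f0 x * LR \<theta> x) \<and>
      integrable lborel (\<lambda>x. f0 x * (LR \<theta> x)\<^sup>2) \<and>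
      (\<integral>x. f0 x * (LR \<theta> x)\<^sup>2 \<partial>lborel) \<le> 1 + a2 * real N powr (- 2 * \<beta>)) \<and>
    (\<forall>\<theta> \<theta>'. \<theta> \<subseteq> I \<longrightarrow> \<theta>' \<subseteq> I \<longrightarrow>
      a1 * (real (card (sym_diff \<theta> \<theta>')) / real (card I)) * real N powr (- 2 * \<beta>) \<le> (L2_norm (\<lambda>x. F \<theta> x - F \<theta>' x))\<^sup>2)"
    using perturbations[OF \<beta> L' f0] by blast
  \<comment> \<open>With \<open>r = 2 * c * real N powr (- \<beta>)\<close> the square of
    \<open>2 * r\<close> is \<open>a1 / 8 * real N powr (- 2 * \<beta>)\<close>, so the separation
    bound limits the fraction of differing cells to 1/8.\<close>
  define c where "c = sqrt (a1 / 32) / 2"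
  have c: "c > 0" using a1 by (simp add: c_def)
  have "ennreal (c * real N powr (- \<beta>)) \<le> coreset_minimax_risk TYPE('d) \<beta> L n m"
    if N: "1 \<le> N" and n: "1 \<le> n" and D30: "30 \<le> N ^ ?d"
      and cond: "real n * a2 * real N powr (- 2 * \<beta>) \<le> real (N ^ ?d) / 10 \<or>
        real (n choose m) * 2 ^ m \<le> exp (real (N ^ ?d) / 4) / 4" for n m N :: nat
  proof -
    obtain I :: "('d \<Rightarrow> nat) set" and F LR where IF: "finite I \<and> card I = N ^ CARD('d) \<and>
      (\<forall>\<theta>. \<theta> \<subseteq> I \<longrightarrow> F \<theta> \<in> holder_densities \<beta> L \<and> LR \<theta> \<in> borel_measurable borel \<and>
        (\<forall>x. 0 \<le> LR \<theta> x \<and> LR \<theta> x \<le> 2 \<and> F \<theta> x = f0 x * LR \<theta> x) \<and>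
        integrable lborel (\<lambda>x. f0 x * (LR \<theta> x)\<^sup>2) \<and>
        (\<integral>x. f0 x * (LR \<theta> x)\<^sup>2 \<partial>lborel) \<le> 1 + a2 * real N powr (- 2 * \<beta>)) \<and>
      (\<forall>\<theta> \<theta>'. \<theta> \<subseteq> I \<longrightarrow> \<theta>' \<subseteq> I \<longrightarrow>
        a1 * (real (card (sym_diff \<theta> \<theta>')) / real (card I)) * real N powr (- 2 * \<beta>) \<le> (L2_norm (\<lambda>x. F \<theta> x - F \<theta>' x))\<^sup>2)"
      using pert[OF N] by (elim exE)
    note fI = IF[THEN conjunct1] and cI = IF[THEN conjunct2, THEN conjunct1]
      and per = IF[THEN conjunct2, THEN conjunct2, THEN conjunct1, rule_format]
      and sep = IF[THEN conjunct2, THEN conjunct2, THEN conjunct2, rule_format]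
    note F = per[THEN conjunct1] and LRm = per[THEN conjunct2, THEN conjunct1]
      and LRi = per[THEN conjunct2, THEN conjunct2, THEN conjunct2, THEN conjunct1]
      and LR2 = per[THEN conjunct2, THEN conjunct2, THEN conjunct2, THEN conjunct2]
    have LR: "0 \<le> LR \<theta> x \<and> LR \<theta> x \<le> 2 \<and> F \<theta> x = f0 x * LR \<theta> x" if "\<theta> \<subseteq> I" for \<theta> x
      by (rule per[OF that, THEN conjunct2, THEN conjunct2, THEN conjunct1, THEN spec])
    let ?D = "card I"
    define r where "r = 2 * c * real N powr (- \<beta>)"
    have r: "r > 0" using c N by (simp add: r_def)
    have r2: "(2 * r)\<^sup>2 = a1 / 8 * real N powr (- 2 * \<beta>)"
    proof -
      have "(real N powr (- \<beta>))\<^sup>2 = real N powr (- 2 * \<beta>)" by (simp add: power2_eq_square powr_add[symmetric])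
      moreover have "(2 * (2 * c))\<^sup>2 = a1 / 8" using a1 by (simp add: c_def power_mult_distrib)
      ultimately show ?thesis by (simp add: r_def power_mult_distrib)
    qed
    have Dpos: "real ?D > 0" using cI N by simp
    have sep': "8 * card (sym_diff \<theta> \<theta>') \<le> ?D"
      if t: "\<theta> \<subseteq> I" "\<theta>' \<subseteq> I" "L2_norm (\<lambda>x. F \<theta> x - F \<theta>' x) < 2 * r" for \<theta> \<theta>'
    proof -
      have "(L2_norm (\<lambda>x. F \<theta> x - F \<theta>' x))\<^sup>2 \<le> (2 * r)\<^sup>2" using t(3) by (intro power_mono) auto
      then have "a1 * (real (card (sym_diff \<theta> \<theta>')) / real ?D) * real N powr (- 2 * \<beta>) \<le> a1 * (1/8) * real N powr (- 2 * \<beta>)"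
        using sep[OF t(1,2)] unfolding r2 by linarith
      then have "real (card (sym_diff \<theta> \<theta>')) / real ?D \<le> 1/8"
      proof -
        assume le: "a1 * (real (card (sym_diff \<theta> \<theta>')) / real ?D) * real N powr (- 2 * \<beta>) \<le> a1 * (1/8) * real N powr (- 2 * \<beta>)"
        have "0 < real N powr (- 2 * \<beta>)" using N by simp
        from mult_right_le_imp_le[OF le this] show ?thesis by (rule mult_left_le_imp_le[OF _ a1])
      qed
      then have "8 * real (card (sym_diff \<theta> \<theta>')) \<le> real ?D" using Dpos by (simp add: pos_divide_le_eq)
      then show ?thesis by linarith
    qed
    show ?thesis
      unfolding coreset_minimax_risk_def
    proof (rule INF_greatest, clarify)
      fix fhat :: "(nat \<Rightarrow> real ^ 'd) \<Rightarrow> real ^ 'd \<Rightarrow> real" and S :: "(nat \<Rightarrow> real ^ 'd) \<Rightarrow> nat set measure"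
      assume fS: "fhat \<in> estimators m" "S \<in> coreset_schemes n m"
      interpret coreset_lower \<beta> L L' n m fhat S I F LR f0 r "a2 * real N powr (- 2 * \<beta>)"
        by unfold_locales (fact \<beta> L fS fI F f0 LRm LR LRi LR2 r sep')+
      have "(\<Sum>\<theta>\<in>Pow I. \<integral>\<^sup>+x. hit \<theta> x \<partial>Pr (F \<theta>) n) \<le> ennreal (2 ^ ?D / 4)"
        using cond
      proof
        assume c1: "real n * a2 * real N powr (- 2 * \<beta>) \<le> real (N ^ ?d) / 10"
        let ?\<gamma> = "a2 * real N powr (- 2 * \<beta>)"
        have \<gamma>: "0 \<le> ?\<gamma>" using a2 by simp
        \<comment> \<open>The truncation level \<open>(6/5) ^ card I\<close> exceeds the second
          moment, at most \<open>(10/9) ^ card I\<close>, yet stays below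
          \<open>(4/3) ^ card I\<close>. Relative to \<open>2 ^ card I\<close> the two terms are
          then at most \<open>(9/10) ^ card I\<close> and \<open>(25/27) ^ card I\<close>.\<close>
        have "(\<Sum>\<theta>\<in>Pow I. \<integral>\<^sup>+x. hit \<theta> x \<partial>Pr (F \<theta>) n) \<le>
            ennreal ((6/5) ^ ?D * (3/2) ^ ?D + 2 ^ ?D * (1 + ?\<gamma>) ^ n / (6/5) ^ ?D)"
          by (rule hits_chi_square) simp
        also have "\<dots> \<le> ennreal (2 ^ ?D / 4)"
        proof (rule ennreal_leI)
          have p1: "(6/5 :: real) ^ ?D * (3/2) ^ ?D = 2 ^ ?D * (9/10) ^ ?D"
            by (simp add: power_mult_distrib[symmetric])
          have "(1 + ?\<gamma>) ^ n \<le> exp ?\<gamma> ^ n" using \<gamma> by (intro power_mono) auto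
          also have "\<dots> = exp (real n * ?\<gamma>)" by (rule exp_of_nat_mult[symmetric])
          also have "\<dots> \<le> exp (real ?D * (1/10))" using c1 cI by (simp add: mult.assoc)
          also have "\<dots> = exp (1/10) ^ ?D" by (rule exp_of_nat_mult)
          also have "\<dots> \<le> (10/9) ^ ?D"
          proof (rule power_mono)
            have "9/10 \<le> exp (- (1/10) :: real)" using exp_ge_add_one_self[of "- (1/10) :: real"] by simp
            then show "exp (1/10) \<le> (10/9 :: real)" by (simp add: exp_minus field_simps)
          qed simp
          finally have "2 ^ ?D * (1 + ?\<gamma>) ^ n / (6/5) ^ ?D \<le> 2 ^ ?D * (10/9) ^ ?D / (6/5) ^ ?D"
            by (intro divide_right_mono mult_left_mono) auto
          also have "\<dots> = 2 ^ ?D * (25/27) ^ ?D"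
            by (simp add: power_divide[symmetric] power_mult_distrib[symmetric])
          finally have p2: "2 ^ ?D * (1 + ?\<gamma>) ^ n / (6/5) ^ ?D \<le> 2 ^ ?D * (25/27) ^ ?D" .
          have D: "30 \<le> ?D" using D30 cI by simp
          have "(9/10 :: real) ^ ?D \<le> (9/10) ^ 30" by (rule power_decreasing[OF D]) auto
          moreover have "(9/10 :: real) ^ 30 \<le> 1/20" by (simp add: power_divide)
          moreover have "(25/27 :: real) ^ ?D \<le> (25/27) ^ 30" by (rule power_decreasing[OF D]) auto
          moreover have "(25/27 :: real) ^ 30 \<le> 1/5" by (simp add: power_divide)
          ultimately have "(9/10 :: real) ^ ?D + (25/27) ^ ?D \<le> 1/4" by linarith
          then have "2 ^ ?D * ((9/10 :: real) ^ ?D + (25/27) ^ ?D) \<le> 2 ^ ?D * (1/4)" by (intro mult_left_mono) auto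
          then show "(6/5) ^ ?D * (3/2) ^ ?D + 2 ^ ?D * (1 + ?\<gamma>) ^ n / (6/5) ^ ?D \<le> 2 ^ ?D / 4"
            using p1 p2 by (simp only: distrib_left)
        qed
        finally show ?thesis .
      next
        assume c2: "real (n choose m) * 2 ^ m \<le> exp (real (N ^ ?d) / 4) / 4"
        have "(\<Sum>\<theta>\<in>Pow I. \<integral>\<^sup>+x. hit \<theta> x \<partial>Pr (F \<theta>) n) \<le> ennreal (real (n choose m) * 2 ^ m * (3/2) ^ ?D)"
          by (rule hits_union_bound)
        also have "\<dots> \<le> ennreal (2 ^ ?D / 4)"
        proof (rule ennreal_leI)
          have "real (n choose m) * 2 ^ m * (3/2) ^ ?D \<le> exp (real ?D / 4) / 4 * (3/2) ^ ?D"
            using c2 cI by (intro mult_right_mono) auto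
          \<comment> \<open>Since \<open>exp (1/4)\<close> is at most 4/3, and 4/3 times 3/2 is 2,
            the union bound consumes the whole \<open>2 ^ card I\<close> and leaves just the factor
            1/4.\<close>
          also have "exp (real ?D / 4) = exp (1/4) ^ ?D" using exp_of_nat_mult[of ?D "1/4 :: real"] by simp
          also have "exp (1/4) ^ ?D / 4 * (3/2) ^ ?D \<le> (4/3) ^ ?D / 4 * (3/2 :: real) ^ ?D"
          proof (intro mult_right_mono divide_right_mono power_mono)
            have "3/4 \<le> exp (- (1/4) :: real)" using exp_ge_add_one_self[of "- (1/4) :: real"] by simp
            then show "exp (1/4) \<le> (4/3 :: real)" by (simp add: exp_minus field_simps)
          qed auto
          also have "\<dots> = 2 ^ ?D / 4" by (simp add: power_mult_distrib[symmetric])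
          finally show "real (n choose m) * 2 ^ m * (3/2) ^ ?D \<le> 2 ^ ?D / 4" .
        qed
        finally show ?thesis .
      qed
      then obtain \<theta> where \<theta>: "\<theta> \<subseteq> I" "ennreal (r / 2) \<le> coreset_risk n fhat S (F \<theta>)"
        using risk_from_hits by blast
      have "coreset_risk n fhat S (F \<theta>) \<le> (SUP f\<in>holder_densities \<beta> L. coreset_risk n fhat S f)"
        by (rule SUP_upper[OF F[OF \<theta>(1)]])
      then show "ennreal (c * real N powr (- \<beta>)) \<le> (SUP f\<in>holder_densities \<beta> L. coreset_risk n fhat S f)"
        using \<theta>(2) by (simp add: r_def)
    qed
  qed
  then show ?thesis using c a2 by blast
qed

section \<open>Choice of the grid size\<close>

lemma ceiling_power_scale:
  assumes z: "z \<ge> (1::real)" and d: "d \<ge> (1::nat)" and \<beta>: "\<beta> > 0"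
  defines "N \<equiv> nat \<lceil>z\<rceil>"
  shows "1 \<le> N" "z \<le> real N" "2 powr (- \<beta>) * z powr (- \<beta>) \<le> real N powr (- \<beta>)"
proof -
  have N: "z \<le> real N" "real N \<le> 2 * z" unfolding N_def using z by linarith+
  then show "z \<le> real N" "1 \<le> N" using z by linarith+
  have "(2 * z) powr (- \<beta>) \<le> real N powr (- \<beta>)" using N z \<beta> by (intro powr_mono2') auto
  then show "2 powr (- \<beta>) * z powr (- \<beta>) \<le> real N powr (- \<beta>)" by (simp add: powr_mult)
qed

text \<open>The two terms of the rate come from two different grids; a maximum of two terms is at
  least half their sum.\<close>

lemma lower_bound:
  assumes \<beta>: "\<beta> > 0" and L: "L > 0"
    and ne: "\<exists>L'<L. holder_densities \<beta> L' \<noteq> ({} :: (real ^ 'd::finite \<Rightarrow> real) set)"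
  shows "\<exists>c>0. \<forall>m :: nat \<Rightarrow> nat. (\<forall>\<^sub>F n in sequentially. 1 \<le> m n) \<longrightarrow>
    (\<forall>\<^sub>F n in sequentially. ennreal (c * (real n powr (- \<beta> / (2 * \<beta> + real CARD('d)))
        + (real (m n) * ln (real n)) powr (- \<beta> / real CARD('d)))) \<le> coreset_minimax_risk TYPE('d) \<beta> L n (m n))"
proof -
  let ?d = "CARD('d)" and ?D = "real CARD('d)"
  obtain c a where c: "c > 0" and a: "a > 0" and main: "\<And>n m N :: nat. 1 \<le> N \<Longrightarrow> 1 \<le> n \<Longrightarrow> 30 \<le> N ^ ?d \<Longrightarrow>
    (real n * a * real N powr (- 2 * \<beta>) \<le> real (N ^ ?d) / 10 \<or>
      real (n choose m) * 2 ^ m \<le> exp (real (N ^ ?d) / 4) / 4) \<Longrightarrow>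
    ennreal (c * real N powr (- \<beta>)) \<le> coreset_minimax_risk TYPE('d) \<beta> L n m"
    using lower_bound_parameters[OF assms] by blast
  have d: "?d \<ge> 1" by (simp add: Suc_le_eq)
  then have D: "?D \<ge> 1" by simp
  define p where "p = 2 * \<beta> + ?D"
  have p: "p > 0" using \<beta> D by (simp add: p_def)
  define c1 where "c1 = c * (2 powr (- \<beta>) * (10 * a) powr (- \<beta> / p))"
  define c2 where "c2 = c * (2 powr (- \<beta>) * 16 powr (- \<beta> / ?D))"
  define C where "C = min c1 c2 / 2"
  have C: "C > 0" unfolding C_def c1_def c2_def using c a by simp
  have ev: "\<forall>\<^sub>F n in sequentially. 30 \<le> (10 * a * real n) powr (1 / p)"
    "\<forall>\<^sub>F n in sequentially. 2 \<le> ln (real n)" "\<forall>\<^sub>F n in sequentially. 2 \<le> real n"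
    using a p by real_asymp+
  have "\<forall>\<^sub>F n in sequentially. ennreal (C * (real n powr (- \<beta> / (2 * \<beta> + ?D))
        + (real (m n) * ln (real n)) powr (- \<beta> / ?D))) \<le> coreset_minimax_risk TYPE('d) \<beta> L n (m n)"
    if m1: "\<forall>\<^sub>F n in sequentially. 1 \<le> m n" for m :: "nat \<Rightarrow> nat"
    using m1 ev
  proof eventually_elim
    case (elim n)
    have n1: "1 \<le> n" using elim by linarith
    let ?risk = "coreset_minimax_risk TYPE('d) \<beta> L n (m n)"
    have b1: "ennreal (c1 * real n powr (- \<beta> / p)) \<le> ?risk"
    proof -
      \<comment> \<open>This balances the divergence
        \<open>real n * a * real N powr (- 2 * \<beta>)\<close> against the number of cells:
        \<open>10 * a * real n\<close> equals \<open>z powr p\<close>.\<close>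
      define z where "z = (10 * a * real n) powr (1 / p)"
      define N where "N = nat \<lceil>z\<rceil>"
      have z1: "z \<ge> 1" using elim by (simp add: z_def)
      note N = ceiling_power_scale[OF z1 d \<beta>, folded N_def]
      have N30: "30 \<le> N ^ ?d"
      proof -
        have "30 \<le> N" using N(2) elim(2) unfolding z_def by linarith
        also have "N ^ 1 \<le> N ^ ?d" using d N(1) by (intro power_increasing) auto
        finally show ?thesis by simp
      qed
      have "10 * a * real n = z powr p" unfolding z_def using a p n1 by (simp add: powr_powr)
      also have "\<dots> \<le> real N powr p" using N(2) z1 p by (intro powr_mono2) auto
      also have "\<dots> = real N powr (2 * \<beta>) * real (N ^ ?d)"
        using N(1) by (simp add: p_def powr_add powr_realpow)
      finally have "10 * a * real n * real N powr (- 2 * \<beta>) \<le> real N powr (2 * \<beta>) * real (N ^ ?d) * real N powr (- 2 * \<beta>)"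
        by (intro mult_right_mono) auto
      also have "\<dots> = real (N ^ ?d) * (real N powr (2 * \<beta>) * real N powr (- 2 * \<beta>))" by (simp only: mult_ac)
      also have "real N powr (2 * \<beta>) * real N powr (- 2 * \<beta>) = 1" using N(1) by (simp add: powr_add[symmetric])
      finally have "real n * a * real N powr (- 2 * \<beta>) \<le> real (N ^ ?d) / 10" by (simp add: mult_ac)
      then have "ennreal (c * real N powr (- \<beta>)) \<le> ?risk" using main[OF N(1) n1 N30] by blast
      moreover have "c1 * real n powr (- \<beta> / p) \<le> c * real N powr (- \<beta>)"
      proof -
        have "z powr (- \<beta>) = (10 * a) powr (- \<beta> / p) * real n powr (- \<beta> / p)"
          unfolding z_def using p by (simp add: powr_powr powr_mult)
        then have "c1 * real n powr (- \<beta> / p) = c * (2 powr (- \<beta>) * z powr (- \<beta>))"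
          by (simp add: c1_def mult.assoc)
        also have "\<dots> \<le> c * real N powr (- \<beta>)" using c N(3) by (intro mult_left_mono) auto
        finally show ?thesis .
      qed
      ultimately show ?thesis using ennreal_leI order_trans by blast
    qed
    have b2: "ennreal (c2 * (real (m n) * ln (real n)) powr (- \<beta> / ?D)) \<le> ?risk"
    proof -
      define w where "w = real (m n) * ln (real n)"
      have w: "w \<ge> 2"
      proof -
        have "1 * 2 \<le> real (m n) * ln (real n)" using elim by (intro mult_mono) auto
        then show ?thesis by (simp add: w_def)
      qed
      \<comment> \<open>Coresets and likelihood ratios cost a factor of at most
        \<open>n ^ m n * 2 ^ m n\<close>, hence at most \<open>exp (2 * w)\<close>. With
        \<open>16 * w\<close> cells the allowance is \<open>exp (4 * w) / 4\<close>, and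
        \<open>w \<ge> 2\<close> leaves room for the division by 4 and for the required 30
        cells.\<close>
      define z where "z = (16 * w) powr (1 / ?D)"
      define N where "N = nat \<lceil>z\<rceil>"
      have z1: "z \<ge> 1" unfolding z_def using w D by (intro ge_one_powr_ge_zero) auto
      note N = ceiling_power_scale[OF z1 d \<beta>, folded N_def]
      have ND: "16 * w \<le> real (N ^ ?d)"
      proof -
        have "16 * w = z powr ?D" unfolding z_def using w by (simp add: powr_powr)
        also have "\<dots> \<le> real N powr ?D" using N(2) z1 by (intro powr_mono2) auto
        also have "\<dots> = real (N ^ ?d)" using N(1) by (simp add: powr_realpow)
        finally show ?thesis .
      qed
      have N30: "30 \<le> N ^ ?d" using ND w by linarith
      have "real (n choose m n) * 2 ^ m n \<le> real n ^ m n * 2 ^ m n"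
      proof (rule mult_right_mono)
        have "n choose m n \<le> n ^ m n"
          using binomial_le_pow[of "m n" n] by (cases "m n \<le> n") (auto simp: binomial_eq_0)
        then show "real (n choose m n) \<le> real n ^ m n" by (simp only: of_nat_power[symmetric] of_nat_le_iff)
      qed simp
      also have "\<dots> \<le> real n ^ m n * real n ^ m n" using elim by (intro mult_left_mono power_mono) auto
      also have "\<dots> = exp (2 * w)"
      proof -
        have "real n ^ m n = exp (real (m n) * ln (real n))" using n1 by (simp add: exp_of_nat_mult)
        then show ?thesis by (simp add: w_def exp_add[symmetric])
      qed
      also have "\<dots> \<le> exp (real (N ^ ?d) / 4) / 4"
      proof -
        have "exp (2 * w) * 4 \<le> exp (2 * w) * (exp 1 * exp 1)"
          using exp_ge_add_one_self[of 1] mult_mono[of 2 "exp 1 :: real" 2 "exp 1"] by (intro mult_left_mono) auto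
        also have "\<dots> = exp (2 * w + 2)" by (simp add: exp_add[symmetric])
        also have "\<dots> \<le> exp (real (N ^ ?d) / 4)" using ND w by simp
        finally show ?thesis by simp
      qed
      finally have "ennreal (c * real N powr (- \<beta>)) \<le> ?risk" using main[OF N(1) n1 N30] by blast
      moreover have "c2 * w powr (- \<beta> / ?D) \<le> c * real N powr (- \<beta>)"
      proof -
        have "z powr (- \<beta>) = 16 powr (- \<beta> / ?D) * w powr (- \<beta> / ?D)"
          unfolding z_def by (simp add: powr_powr powr_mult)
        then have "c2 * w powr (- \<beta> / ?D) = c * (2 powr (- \<beta>) * z powr (- \<beta>))"
          by (simp add: c2_def mult.assoc)
        also have "\<dots> \<le> c * real N powr (- \<beta>)" using c N(3) by (intro mult_left_mono) auto
        finally show ?thesis .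
      qed
      ultimately show ?thesis unfolding w_def[symmetric] using ennreal_leI order_trans by blast
    qed
    let ?x = "real n powr (- \<beta> / p)" and ?y = "(real (m n) * ln (real n)) powr (- \<beta> / ?D)"
    have "C * (?x + ?y) \<le> max (c1 * ?x) (c2 * ?y)"
    proof -
      have "min c1 c2 * ?x \<le> c1 * ?x" "min c1 c2 * ?y \<le> c2 * ?y" by (intro mult_right_mono; simp)+
      then have "min c1 c2 * ?x + min c1 c2 * ?y \<le> 2 * max (c1 * ?x) (c2 * ?y)" by linarith
      then show ?thesis by (simp add: C_def distrib_left)
    qed
    moreover have "ennreal (max (c1 * ?x) (c2 * ?y)) \<le> ?risk" using b1 b2 by (simp add: max_def)
    ultimately show ?case unfolding p_def using ennreal_leI order_trans by blast
  qed
  then show ?thesis using C by blast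
qed

lemma holder_densities_mono:
  assumes "L \<le> M"
  shows "holder_densities \<beta> L \<subseteq> holder_densities \<beta> M"
  using holder_derivs_mono[OF _ assms] unfolding holder_densities_def by (auto simp: holder_class_iff)

text \<open>The constants precede m, so they depend on \<beta>, L and the dimension only. For m = 0
  the second summand would be 0 by the convention for \<open>powr\<close>, while a constant estimate
  cannot have vanishing risk; hence m is eventually positive. A class consisting of a single density
  would have risk 0, which \<open>nondegenerate\<close> excludes.\<close>

theorem theorem1:
  fixes \<beta> L :: real
  assumes "\<beta> > 0" and "L > 0"
    and nondegenerate: "\<exists>L'<L. holder_densities \<beta> L' \<noteq> ({} :: (real ^ 'd::finite \<Rightarrow> real) set)"
  shows "\<exists>c>0. \<exists>C>0. \<forall>m :: nat \<Rightarrow> nat.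
    (\<lambda>n. real (m n)) \<in> o(\<lambda>n. real n) \<longrightarrow>
    (\<forall>\<^sub>F n in sequentially. 1 \<le> m n) \<longrightarrow>
    (\<forall>\<^sub>F n in sequentially.
       let r = real n powr (- \<beta> / (2 * \<beta> + real CARD('d)))
             + (real (m n) * ln (real n)) powr (- \<beta> / real CARD('d))
       in ennreal (c * r) \<le> coreset_minimax_risk TYPE('d) \<beta> L n (m n) \<and>
          coreset_minimax_risk TYPE('d) \<beta> L n (m n) \<le> ennreal (C * r))"
proof -
  let ?r = "\<lambda>m n. real n powr (- \<beta> / (2 * \<beta> + real CARD('d)))
    + (real (m n) * ln (real n)) powr (- \<beta> / real CARD('d))"
  have "holder_densities \<beta> L \<noteq> ({} :: (real ^ 'd \<Rightarrow> real) set)"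
    using nondegenerate holder_densities_mono less_imp_le by blast
  then obtain C where C: "C > 0" and upper: "\<And>m :: nat \<Rightarrow> nat. (\<lambda>n. real (m n)) \<in> o(\<lambda>n. real n) \<Longrightarrow>
      \<forall>\<^sub>F n in sequentially. 1 \<le> m n \<Longrightarrow>
      \<forall>\<^sub>F n in sequentially. coreset_minimax_risk TYPE('d) \<beta> L n (m n) \<le> ennreal (C * ?r m n)"
    using upper_bound[OF assms(1,2), where 'd = 'd] by blast
  obtain c where c: "c > 0" and lower: "\<And>m :: nat \<Rightarrow> nat. \<forall>\<^sub>F n in sequentially. 1 \<le> m n \<Longrightarrow>
      \<forall>\<^sub>F n in sequentially. ennreal (c * ?r m n) \<le> coreset_minimax_risk TYPE('d) \<beta> L n (m n)"
    using lower_bound[OF assms] by blast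
  show ?thesis
  proof (rule exI[of _ c], rule conjI[OF c], rule exI[of _ C], rule conjI[OF C], intro allI impI)
    fix m :: "nat \<Rightarrow> nat"
    assume m: "(\<lambda>n. real (m n)) \<in> o(\<lambda>n. real n)" "\<forall>\<^sub>F n in sequentially. 1 \<le> m n"
    show "\<forall>\<^sub>F n in sequentially. let r = ?r m n
       in ennreal (c * r) \<le> coreset_minimax_risk TYPE('d) \<beta> L n (m n) \<and>
          coreset_minimax_risk TYPE('d) \<beta> L n (m n) \<le> ennreal (C * r)"
      unfolding Let_def using lower[OF m(2)] upper[OF m] by (rule eventually_conj)
  qed
qed

end
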